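(* Let $g=\lambda_+^2g_{Kerr}$ be the complex Kähler metric conformal to Kerr, with Levi-Civita connection $\nabla$, scalar curvature $s$, self-dual 2-forms $\omega,\Omega^\pm$ and 1-form $a$ as in the context. Let $d_+=P_+d:\Lambda^1\to\Lambda^+$ and $d_+^*=\delta P_+:\Lambda^2\to\Lambda^1$, where $\delta$ is the codifferential of $g$, and let $\Delta_H=d\delta+\delta d$ be the Hodge Laplacian of $g$ on 2-forms. Then $\mathcal{O}:=2d_+d_+^*=\Delta_HP_+$, and for all smooth complex functions $\Phi,\Phi^+,\Phi^-$, $$\mathcal{O}\big(\Phi\,\omega+\Phi^-\Omega^++\Phi^+\Omega^-\big)=\big(-\nabla^\alpha\nabla_\alpha\Phi\big)\,\omega+\big(\mathcal{O}_{-1}\Phi^-\big)\,\Omega^++\big(\mathcal{O}_{+1}\Phi^+\big)\,\Omega^-,$$ where $\mathcal{O}_{k}\Psi=-(\nabla^\alpha+{\rm i}ka^\alpha)(\nabla_\alpha+{\rm i}ka_\alpha)\Psi+\frac{1+2k^2}{6}s\Psi$, so that $\mathcal{O}_{\pm1}\Psi=-(\nabla^\alpha\pm{\rm i}a^\alpha)(\nabla_\alpha\pm{\rm i}a_\alpha)\Psi+\frac{s}{2}\Psi$. In particular $\mathcal{O}$ preserves each of the line subbundles of $\Lambda^+$ spanned by $\omega$, $\Omega^+$, $\Omega^-$.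
   Context: Coordinates $(t,r,q,\phi)$ on the region where $C(r)=r^2-2Mr+a^2>0$ and $-1<q<1$; $D(q)=1-q^2$, $\rho^2=r^2+a^2q^2$, $M,a$ real. Coframe: $e^0=\frac{\sqrt C}{\rho}(dt-a(1-q^2)d\phi)$, $e^1=\frac{\rho}{\sqrt C}dr$, $e^2=\frac{\rho}{\sqrt D}dq$, $e^3=\frac{\sqrt D}{\rho}((r^2+a^2)d\phi-a\,dt)$; the Kerr metric is $g_{Kerr}=-e^0\otimes e^0+\sum_{i=1}^3e^i\otimes e^i$. Set $\Sigma^1={\rm i}e^0\wedge e^1-e^2\wedge e^3$, $\Sigma^2={\rm i}e^0\wedge e^2-e^3\wedge e^1$, $\Sigma^3={\rm i}e^0\wedge e^3-e^1\wedge e^2$. Let $\lambda_\pm=1/(r\pm{\rm i}aq)$, $g=\lambda_+^2g_{Kerr}$ (complex-valued), $\Omega^i=\lambda_+^2\Sigma^i$, $\omega=\Omega^1$, $\Omega^\pm=(\Omega^2\pm{\rm i}\Omega^3)/\sqrt2$. $\Lambda^+$ is the complex span of $\Omega^1,\Omega^2,\Omega^3$ (the self-dual 2-forms); $\star$ denotes the Hodge star on 2-forms (conformally invariant, the same for $g$ and $g_{Kerr}$) with orientation such that $\star\Sigma^i={\rm i}\Sigma^i$, and $P_+=\frac12(1-{\rm i}\star)$ is the projector onto $\Lambda^+$. The codifferential is $(\delta B)_\nu=-\nabla^\mu B_{\mu\nu}$ on 2-forms and $\delta\theta=-\nabla^\mu\theta_\mu$ on 1-forms, indices raised with $g$. The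 metric $g$ satisfies $\nabla\omega=0$, and $a$ is the (unique) complex 1-form with $(\nabla_\mu+{\rm i}a_\mu)\Omega^+_{\rho\sigma}=0$ and $(\nabla_\mu-{\rm i}a_\mu)\Omega^-_{\rho\sigma}=0$. In $\mathcal{O}_k$, $(\nabla_\alpha+{\rm i}ka_\alpha)\Psi=\partial_\alpha\Psi+{\rm i}ka_\alpha\Psi$ and $(\nabla^\alpha+{\rm i}ka^\alpha)v_\alpha=\nabla^\alpha v_\alpha+{\rm i}ka^\alpha v_\alpha$. *)

theory Defs
  imports "HOL-Analysis.Analysis"
begin

text \<open>Coordinate rendering on the chart (t,r,q,phi) = (x$0, x$1, x$2, x$3) of real^4.
  Tensors are represented by their coordinate components; a k-form is a function
  of the point and k indices of type 4. The rotation parameter a of the paper is am.\<close>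

type_synonym pt = "real^4"

definition pd :: "4 \<Rightarrow> (pt \<Rightarrow> complex) \<Rightarrow> pt \<Rightarrow> complex" where
  "pd i f x = vector_derivative (\<lambda>h. f (x + h *\<^sub>R axis i 1)) (at 0)"

fun iter_pd :: "4 list \<Rightarrow> (pt \<Rightarrow> complex) \<Rightarrow> pt \<Rightarrow> complex" where
  "iter_pd [] f = f"
| "iter_pd (i # js) f = pd i (iter_pd js f)"

definition smooth_fn :: "pt set \<Rightarrow> (pt \<Rightarrow> complex) \<Rightarrow> bool" where
  "smooth_fn U f \<longleftrightarrow> (\<forall>js. continuous_on U (iter_pd js f) \<and>
      (\<forall>x\<in>U. \<forall>i. (\<lambda>h. iter_pd js f (x + h *\<^sub>R axis i 1)) differentiable (at 0)))"

definition Cf :: "real \<Rightarrow> real \<Rightarrow> pt \<Rightarrow> real" where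
  "Cf M am x = (x$1)^2 - 2*M*(x$1) + am^2"

definition Df :: "pt \<Rightarrow> real" where
  "Df x = 1 - (x$2)^2"

definition rho :: "real \<Rightarrow> pt \<Rightarrow> real" where
  "rho am x = sqrt ((x$1)^2 + am^2 * (x$2)^2)"

text \<open>The region: C(r) > 0, -1 < q < 1, away from the ring singularity rho = 0.\<close>
definition kerr_dom :: "real \<Rightarrow> real \<Rightarrow> pt set" where
  "kerr_dom M am = {x. Cf M am x > 0 \<and> -1 < x$2 \<and> x$2 < 1 \<and> rho am x \<noteq> 0}"

text \<open>Coframe: ef M am k x mu is the mu-component of e^k at x.\<close>
definition ef :: "real \<Rightarrow> real \<Rightarrow> 4 \<Rightarrow> pt \<Rightarrow> 4 \<Rightarrow> real" where
  "ef M am k x mu =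
    (let C = Cf M am x; D = Df x; p = rho am x; r = x$1; q = x$2 in
     if k = 0 then (if mu = 0 then sqrt C / p else if mu = 3 then - am * (1 - q^2) * sqrt C / p else 0)
     else if k = 1 then (if mu = 1 then p / sqrt C else 0)
     else if k = 2 then (if mu = 2 then p / sqrt D else 0)
     else (if mu = 0 then - am * sqrt D / p else if mu = 3 then sqrt D * (r^2 + am^2) / p else 0))"

definition eta :: "4 \<Rightarrow> real" where
  "eta k = (if k = 0 then -1 else 1)"

definition gKerr :: "real \<Rightarrow> real \<Rightarrow> pt \<Rightarrow> 4 \<Rightarrow> 4 \<Rightarrow> real" where
  "gKerr M am x m n = (\<Sum>k\<in>UNIV. eta k * ef M am k x m * ef M am k x n)"

definition gKinv :: "real \<Rightarrow> real \<Rightarrow> pt \<Rightarrow> 4 \<Rightarrow> 4 \<Rightarrow> real" where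
  "gKinv M am x m n = matrix_inv (\<chi> i j. gKerr M am x i j) $ m $ n"

definition lamp :: "real \<Rightarrow> pt \<Rightarrow> complex" where
  "lamp am x = 1 / Complex (x$1) (am * x$2)"

definition gmet :: "real \<Rightarrow> real \<Rightarrow> pt \<Rightarrow> 4 \<Rightarrow> 4 \<Rightarrow> complex" where
  "gmet M am x m n = (lamp am x)^2 * complex_of_real (gKerr M am x m n)"

definition ginv :: "real \<Rightarrow> real \<Rightarrow> pt \<Rightarrow> 4 \<Rightarrow> 4 \<Rightarrow> complex" where
  "ginv M am x m n = matrix_inv (\<chi> i j. gmet M am x i j) $ m $ n"

definition Gam :: "real \<Rightarrow> real \<Rightarrow> pt \<Rightarrow> 4 \<Rightarrow> 4 \<Rightarrow> 4 \<Rightarrow> complex" where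
  "Gam M am x l m n = (1/2) * (\<Sum>s\<in>UNIV. ginv M am x l s *
      (pd m (\<lambda>y. gmet M am y s n) x + pd n (\<lambda>y. gmet M am y s m) x - pd s (\<lambda>y. gmet M am y m n) x))"

definition cov1 :: "real \<Rightarrow> real \<Rightarrow> (pt \<Rightarrow> 4 \<Rightarrow> complex) \<Rightarrow> pt \<Rightarrow> 4 \<Rightarrow> 4 \<Rightarrow> complex" where
  "cov1 M am th x m n = pd m (\<lambda>y. th y n) x - (\<Sum>l\<in>UNIV. Gam M am x l m n * th x l)"

definition cov2 :: "real \<Rightarrow> real \<Rightarrow> (pt \<Rightarrow> 4 \<Rightarrow> 4 \<Rightarrow> complex) \<Rightarrow> pt \<Rightarrow> 4 \<Rightarrow> 4 \<Rightarrow> 4 \<Rightarrow> complex" where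
  "cov2 M am B x m r s = pd m (\<lambda>y. B y r s) x
     - (\<Sum>l\<in>UNIV. Gam M am x l m r * B x l s + Gam M am x l m s * B x r l)"

definition cov3 :: "real \<Rightarrow> real \<Rightarrow> (pt \<Rightarrow> 4 \<Rightarrow> 4 \<Rightarrow> 4 \<Rightarrow> complex) \<Rightarrow> pt \<Rightarrow> 4 \<Rightarrow> 4 \<Rightarrow> 4 \<Rightarrow> 4 \<Rightarrow> complex" where
  "cov3 M am T x m a b c = pd m (\<lambda>y. T y a b c) x
     - (\<Sum>l\<in>UNIV. Gam M am x l m a * T x l b c + Gam M am x l m b * T x a l c + Gam M am x l m c * T x a b l)"

text \<open>Exterior derivative (forms as antisymmetric tensors, (a wedge b)_{mn} = a_m b_n - a_n b_m).\<close>
definition d0 :: "(pt \<Rightarrow> complex) \<Rightarrow> pt \<Rightarrow> 4 \<Rightarrow> complex" where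
  "d0 f x m = pd m f x"

definition d1 :: "(pt \<Rightarrow> 4 \<Rightarrow> complex) \<Rightarrow> pt \<Rightarrow> 4 \<Rightarrow> 4 \<Rightarrow> complex" where
  "d1 th x m n = pd m (\<lambda>y. th y n) x - pd n (\<lambda>y. th y m) x"

definition d2 :: "(pt \<Rightarrow> 4 \<Rightarrow> 4 \<Rightarrow> complex) \<Rightarrow> pt \<Rightarrow> 4 \<Rightarrow> 4 \<Rightarrow> 4 \<Rightarrow> complex" where
  "d2 B x a b c = pd a (\<lambda>y. B y b c) x + pd b (\<lambda>y. B y c a) x + pd c (\<lambda>y. B y a b) x"

definition del1 :: "real \<Rightarrow> real \<Rightarrow> (pt \<Rightarrow> 4 \<Rightarrow> complex) \<Rightarrow> pt \<Rightarrow> complex" where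
  "del1 M am th x = - (\<Sum>m\<in>UNIV. \<Sum>a\<in>UNIV. ginv M am x m a * cov1 M am th x a m)"

definition del2 :: "real \<Rightarrow> real \<Rightarrow> (pt \<Rightarrow> 4 \<Rightarrow> 4 \<Rightarrow> complex) \<Rightarrow> pt \<Rightarrow> 4 \<Rightarrow> complex" where
  "del2 M am B x n = - (\<Sum>m\<in>UNIV. \<Sum>a\<in>UNIV. ginv M am x m a * cov2 M am B x a m n)"

definition del3 :: "real \<Rightarrow> real \<Rightarrow> (pt \<Rightarrow> 4 \<Rightarrow> 4 \<Rightarrow> 4 \<Rightarrow> complex) \<Rightarrow> pt \<Rightarrow> 4 \<Rightarrow> 4 \<Rightarrow> complex" where
  "del3 M am T x n r = - (\<Sum>m\<in>UNIV. \<Sum>a\<in>UNIV. ginv M am x m a * cov3 M am T x a m n r)"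

text \<open>Volume form e^0 wedge e^1 wedge e^2 wedge e^3 of g_Kerr (fixes the orientation).\<close>
definition vol :: "real \<Rightarrow> real \<Rightarrow> pt \<Rightarrow> 4 \<Rightarrow> 4 \<Rightarrow> 4 \<Rightarrow> 4 \<Rightarrow> real" where
  "vol M am x m n p s = det (\<chi> k j. ef M am k x
      (if j = 0 then m else if j = 1 then n else if j = 2 then p else s))"

text \<open>Hodge star on 2-forms (conformally invariant; computed with g_Kerr).\<close>
definition hstar :: "real \<Rightarrow> real \<Rightarrow> (pt \<Rightarrow> 4 \<Rightarrow> 4 \<Rightarrow> complex) \<Rightarrow> pt \<Rightarrow> 4 \<Rightarrow> 4 \<Rightarrow> complex" where
  "hstar M am B x m n = (1/2) * (\<Sum>a\<in>UNIV. \<Sum>b\<in>UNIV. \<Sum>c\<in>UNIV. \<Sum>d\<in>UNIV.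
      complex_of_real (vol M am x m n a b * gKinv M am x a c * gKinv M am x b d) * B x c d)"

definition Pplus :: "real \<Rightarrow> real \<Rightarrow> (pt \<Rightarrow> 4 \<Rightarrow> 4 \<Rightarrow> complex) \<Rightarrow> pt \<Rightarrow> 4 \<Rightarrow> 4 \<Rightarrow> complex" where
  "Pplus M am B x m n = (1/2) * (B x m n - \<i> * hstar M am B x m n)"

definition dplus :: "real \<Rightarrow> real \<Rightarrow> (pt \<Rightarrow> 4 \<Rightarrow> complex) \<Rightarrow> pt \<Rightarrow> 4 \<Rightarrow> 4 \<Rightarrow> complex" where
  "dplus M am th = Pplus M am (d1 th)"

definition dplus_star :: "real \<Rightarrow> real \<Rightarrow> (pt \<Rightarrow> 4 \<Rightarrow> 4 \<Rightarrow> complex) \<Rightarrow> pt \<Rightarrow> 4 \<Rightarrow> complex" where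
  "dplus_star M am B = del2 M am (Pplus M am B)"

definition Oop :: "real \<Rightarrow> real \<Rightarrow> (pt \<Rightarrow> 4 \<Rightarrow> 4 \<Rightarrow> complex) \<Rightarrow> pt \<Rightarrow> 4 \<Rightarrow> 4 \<Rightarrow> complex" where
  "Oop M am B x m n = 2 * dplus M am (dplus_star M am B) x m n"

definition lapH :: "real \<Rightarrow> real \<Rightarrow> (pt \<Rightarrow> 4 \<Rightarrow> 4 \<Rightarrow> complex) \<Rightarrow> pt \<Rightarrow> 4 \<Rightarrow> 4 \<Rightarrow> complex" where
  "lapH M am B x m n = d1 (del2 M am B) x m n + del3 M am (d2 B) x m n"

definition wedge :: "(pt \<Rightarrow> 4 \<Rightarrow> complex) \<Rightarrow> (pt \<Rightarrow> 4 \<Rightarrow> complex) \<Rightarrow> pt \<Rightarrow> 4 \<Rightarrow> 4 \<Rightarrow> complex" where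
  "wedge al be x m n = al x m * be x n - al x n * be x m"

definition ec :: "real \<Rightarrow> real \<Rightarrow> 4 \<Rightarrow> pt \<Rightarrow> 4 \<Rightarrow> complex" where
  "ec M am k x m = complex_of_real (ef M am k x m)"

definition Sig :: "real \<Rightarrow> real \<Rightarrow> nat \<Rightarrow> pt \<Rightarrow> 4 \<Rightarrow> 4 \<Rightarrow> complex" where
  "Sig M am i x m n =
    (if i = 1 then \<i> * wedge (ec M am 0) (ec M am 1) x m n - wedge (ec M am 2) (ec M am 3) x m n
     else if i = 2 then \<i> * wedge (ec M am 0) (ec M am 2) x m n - wedge (ec M am 3) (ec M am 1) x m n
     else \<i> * wedge (ec M am 0) (ec M am 3) x m n - wedge (ec M am 1) (ec M am 2) x m n)"

definition Om :: "real \<Rightarrow> real \<Rightarrow> nat \<Rightarrow> pt \<Rightarrow> 4 \<Rightarrow> 4 \<Rightarrow> complex" where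
  "Om M am i x m n = (lamp am x)^2 * Sig M am i x m n"

definition omega :: "real \<Rightarrow> real \<Rightarrow> pt \<Rightarrow> 4 \<Rightarrow> 4 \<Rightarrow> complex" where
  "omega M am = Om M am 1"

definition Omp :: "real \<Rightarrow> real \<Rightarrow> pt \<Rightarrow> 4 \<Rightarrow> 4 \<Rightarrow> complex" where
  "Omp M am x m n = (Om M am 2 x m n + \<i> * Om M am 3 x m n) / complex_of_real (sqrt 2)"

definition Omm :: "real \<Rightarrow> real \<Rightarrow> pt \<Rightarrow> 4 \<Rightarrow> 4 \<Rightarrow> complex" where
  "Omm M am x m n = (Om M am 2 x m n - \<i> * Om M am 3 x m n) / complex_of_real (sqrt 2)"

definition aform :: "real \<Rightarrow> real \<Rightarrow> pt \<Rightarrow> 4 \<Rightarrow> complex" where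
  "aform M am x = (THE v :: 4 \<Rightarrow> complex. \<forall>m r s.
      cov2 M am (Omp M am) x m r s + \<i> * v m * Omp M am x r s = 0 \<and>
      cov2 M am (Omm M am) x m r s - \<i> * v m * Omm M am x r s = 0)"

definition Riem :: "real \<Rightarrow> real \<Rightarrow> pt \<Rightarrow> 4 \<Rightarrow> 4 \<Rightarrow> 4 \<Rightarrow> 4 \<Rightarrow> complex" where
  "Riem M am x r s m n = pd m (\<lambda>y. Gam M am y r n s) x - pd n (\<lambda>y. Gam M am y r m s) x
     + (\<Sum>l\<in>UNIV. Gam M am x r m l * Gam M am x l n s - Gam M am x r n l * Gam M am x l m s)"

definition Ric :: "real \<Rightarrow> real \<Rightarrow> pt \<Rightarrow> 4 \<Rightarrow> 4 \<Rightarrow> complex" where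
  "Ric M am x s n = (\<Sum>r\<in>UNIV. Riem M am x r s r n)"

definition scal :: "real \<Rightarrow> real \<Rightarrow> pt \<Rightarrow> complex" where
  "scal M am x = (\<Sum>s\<in>UNIV. \<Sum>n\<in>UNIV. ginv M am x s n * Ric M am x s n)"

definition boxneg :: "real \<Rightarrow> real \<Rightarrow> (pt \<Rightarrow> complex) \<Rightarrow> pt \<Rightarrow> complex" where
  "boxneg M am Phi x = - (\<Sum>al\<in>UNIV. \<Sum>be\<in>UNIV. ginv M am x al be * cov1 M am (d0 Phi) x be al)"

definition Ok :: "real \<Rightarrow> real \<Rightarrow> real \<Rightarrow> (pt \<Rightarrow> complex) \<Rightarrow> pt \<Rightarrow> complex" where
  "Ok M am k Psi x =
    (let v = (\<lambda>y al. pd al Psi y + \<i> * complex_of_real k * aform M am y al * Psi y) in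
     - (\<Sum>al\<in>UNIV. \<Sum>be\<in>UNIV. ginv M am x al be *
           (cov1 M am v x be al + \<i> * complex_of_real k * aform M am x be * v x al))
     + complex_of_real ((1 + 2 * k^2) / 6) * scal M am x * Psi x)"

end

theory Submission
  imports Defs
begin

text \<open>
  Replace the Lorentzian coframe by \<open>h\<^sup>0 = \<i>\<lambda>\<^sub>+e\<^sup>0\<close>, \<open>h\<^sup>k = \<lambda>\<^sub>+e\<^sup>k\<close>.  Then \<open>g = \<Sum>h\<^sup>a\<otimes>h\<^sup>a\<close>
  is formally Euclidean, \<open>\<Omega>\<^sup>i = h\<^sup>0\<and>h\<^sup>i - h\<^sup>j\<and>h\<^sup>k\<close> has constant coefficients, and \<open>P\<^sub>+\<close> is the
  Euclidean projection onto anti-self-dual forms.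

  If \<open>A\<close> is anti-self-dual, then so is \<open>\<nabla>\<^sub>cA\<close>, hence \<open>dA\<close> is the dual of \<open>\<delta>A\<close> and \<open>\<delta>dA\<close> is minus the
  dual of \<open>d\<delta>A\<close>; so \<open>2P\<^sub>+d\<delta>A = \<Delta>\<^sub>H A\<close>.  This holds for every metric.

  For Kerr the connection forms \<open>W\<close> are of type (1,1), which is \<open>\<nabla>\<omega> = 0\<close>, and they act on a form \<open>w\<close>
  of charge \<open>k\<close> under \<open>\<omega>\<close> through \<open>\<i>ka\<close> with \<open>a = W\<^sub>0\<^sub>1 - W\<^sub>2\<^sub>3\<close>.  Therefore \<open>d\<delta>(\<Psi>w)\<close> is a contraction
  of the charged Hessian \<open>Q\<close> of \<open>\<Psi>\<close> with \<open>w\<close>.  Its anti-self-dual part only sees the trace of \<open>Q\<close>, which is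
  the charged wave operator, and the action on \<open>w\<close> of the antisymmetric part of \<open>Q\<close>, which is
  \<open>\<i>k\<Psi>\<cdot>da\<close>.  The first Bianchi identity forces \<open>da\<close> to be of type (1,1) with
  \<open>s = 2((da)\<^sub>0\<^sub>1 - (da)\<^sub>2\<^sub>3)\<close>, so that this second contribution is the potential \<open>k\<^sup>2s/2\<close>.
\<close>

section \<open>Sums and matrices\<close>

lemma sum_UNIV_4: "sum f (UNIV :: 4 set) = f 0 + f 1 + f 2 + f 3"
proof -
  have "f 4 = f 0" by (rule arg_cong[of _ _ f]) simp
  then show ?thesis by (simp add: sum_4 ac_simps)
qed

lemma all_4: "(\<forall>i::4. P i) \<longleftrightarrow> P 0 \<and> P 1 \<and> P 2 \<and> P 3"
proof -
  have "P 4 = P 0" by (rule arg_cong[of _ _ P]) simp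
  then show ?thesis by (auto simp: forall_4)
qed

lemma UNIV_4_eq: "(UNIV :: 4 set) = {0, 1, 2, 3}"
  using all_4[of "\<lambda>i. i \<in> {0, 1, 2, 3}"] by auto

lemma sum_rotate3:
  "(\<Sum>a\<in>A. \<Sum>b\<in>B. \<Sum>c\<in>C. F a b c) = (\<Sum>c\<in>C. \<Sum>a\<in>A. \<Sum>b\<in>B. F a b c)"
  for F :: "_ \<Rightarrow> _ \<Rightarrow> _ \<Rightarrow> 'a::comm_monoid_add"
proof -
  have "(\<Sum>a\<in>A. \<Sum>b\<in>B. \<Sum>c\<in>C. F a b c) = (\<Sum>a\<in>A. \<Sum>c\<in>C. \<Sum>b\<in>B. F a b c)"
    by (rule sum.cong[OF refl], rule sum.swap)
  also have "\<dots> = (\<Sum>c\<in>C. \<Sum>a\<in>A. \<Sum>b\<in>B. F a b c)" by (rule sum.swap)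
  finally show ?thesis .
qed

lemma sum_rotate4:
  "(\<Sum>a\<in>A. \<Sum>b\<in>B. \<Sum>c\<in>C. \<Sum>d\<in>D. F a b c d) = (\<Sum>c\<in>C. \<Sum>d\<in>D. \<Sum>a\<in>A. \<Sum>b\<in>B. F a b c d)"
  for F :: "_ \<Rightarrow> _ \<Rightarrow> _ \<Rightarrow> _ \<Rightarrow> 'a::comm_monoid_add"
proof -
  have "(\<Sum>a\<in>A. \<Sum>b\<in>B. \<Sum>c\<in>C. \<Sum>d\<in>D. F a b c d) = (\<Sum>c\<in>C. \<Sum>a\<in>A. \<Sum>b\<in>B. \<Sum>d\<in>D. F a b c d)"
    by (rule sum_rotate3)
  also have "\<dots> = (\<Sum>c\<in>C. \<Sum>d\<in>D. \<Sum>a\<in>A. \<Sum>b\<in>B. F a b c d)"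
    by (rule sum.cong[OF refl], rule sum_rotate3)
  finally show ?thesis .
qed

lemma sum_mult_delta [simp]:
  fixes X :: "'n::finite \<Rightarrow> 'a::semiring_1"
  shows "(\<Sum>a\<in>UNIV. X a * (if a = b then 1 else 0)) = X b"
    and "(\<Sum>a\<in>UNIV. X a * (if b = a then 1 else 0)) = X b"
  by (simp_all add: if_distrib cong: if_cong)

lemma matrix_inv_unique:
  fixes A B :: "'a::field^'n^'n"
  assumes "A ** B = mat 1"
  shows "matrix_inv A = B"
proof -
  have BA: "B ** A = mat 1" using assms by (simp add: matrix_left_right_inverse)
  have "A ** matrix_inv A = mat 1 \<and> matrix_inv A ** A = mat 1"
    unfolding matrix_inv_def by (rule someI[of _ B]) (use assms BA in simp)
  then have "B = B ** (A ** matrix_inv A)" by simp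
  also have "\<dots> = matrix_inv A" by (simp add: matrix_mul_assoc BA)
  finally show ?thesis by simp
qed

lemma dual_basis_complete:
  fixes h E :: "'n::finite \<Rightarrow> 'n \<Rightarrow> 'a::field"
  assumes "\<And>a b. (\<Sum>m\<in>UNIV. h a m * E b m) = (if a = b then 1 else 0)"
  shows "(\<Sum>a\<in>UNIV. h a m * E a n) = (if m = n then 1 else 0)"
proof -
  let ?h = "\<chi> a m. h a m" and ?E = "\<chi> m b. E b m"
  have "?h ** ?E = mat 1"
    by (simp add: matrix_matrix_mult_def mat_def vec_eq_iff assms)
  then have "?E ** ?h = mat 1" by (simp add: matrix_left_right_inverse)
  then have "(?E ** ?h) $ n $ m = mat 1 $ n $ m" by simp
  then show ?thesis by (simp add: matrix_matrix_mult_def mat_def ac_simps eq_commute)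
qed

lemma matrix_inv_sum_squares:
  fixes h E :: "'n::finite \<Rightarrow> 'n \<Rightarrow> 'a::field"
  assumes dual: "\<And>a b. (\<Sum>m\<in>UNIV. h a m * E b m) = (if a = b then 1 else 0)"
  shows "matrix_inv (\<chi> m n. \<Sum>a\<in>UNIV. h a m * h a n) = (\<chi> m n. \<Sum>a\<in>UNIV. E a m * E a n)"
proof (rule matrix_inv_unique)
  have "(\<Sum>s\<in>UNIV. (\<Sum>a\<in>UNIV. h a m * h a s) * (\<Sum>b\<in>UNIV. E b s * E b n)) = (if m = n then 1 else 0)"
    for m n
  proof -
    have "(\<Sum>s\<in>UNIV. (\<Sum>a\<in>UNIV. h a m * h a s) * (\<Sum>b\<in>UNIV. E b s * E b n))
        = (\<Sum>s\<in>UNIV. \<Sum>a\<in>UNIV. \<Sum>b\<in>UNIV. h a m * E b n * (h a s * E b s))"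
      unfolding sum_product by (simp add: ac_simps)
    also have "\<dots> = (\<Sum>a\<in>UNIV. \<Sum>b\<in>UNIV. h a m * E b n * (\<Sum>s\<in>UNIV. h a s * E b s))"
      unfolding sum_distrib_left by (rule sum_rotate3[symmetric])
    also have "\<dots> = (\<Sum>a\<in>UNIV. h a m * E a n)" by (simp add: dual)
    finally show ?thesis by (simp add: dual_basis_complete[OF dual])
  qed
  then show "(\<chi> m n. \<Sum>a\<in>UNIV. h a m * h a n) ** (\<chi> m n. \<Sum>a\<in>UNIV. E a m * E a n) = mat 1"
    by (simp add: matrix_matrix_mult_def mat_def vec_eq_iff)
qed

lemma matrix_inv_of_real:
  fixes A :: "real^'n^'n" and X :: "complex^'n^'n"
  assumes "(\<chi> i j. complex_of_real (A$i$j)) ** X = mat 1"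
  shows "complex_of_real (matrix_inv A $ i $ j) = X $ i $ j"
proof -
  let ?A = "\<chi> i j. complex_of_real (A$i$j)" and ?R = "\<chi> i j. Re (X$i$j)"
  have "Re ((?A ** X) $ i $ j) = (if i = j then 1 else 0)" for i j
    by (simp add: assms mat_def)
  then have inv: "A ** ?R = mat 1"
    by (simp add: matrix_matrix_mult_def mat_def vec_eq_iff)
  then have "(A ** ?R) $ i $ j = mat 1 $ i $ j" for i j by simp
  then have "?A ** (\<chi> i j. complex_of_real (?R$i$j)) = mat 1"
    by (simp add: matrix_matrix_mult_def mat_def vec_eq_iff flip: of_real_mult of_real_sum)
  with matrix_inv_unique[OF assms] have "X = (\<chi> i j. complex_of_real (?R$i$j))"
    by (simp add: matrix_inv_unique)
  then have "X $ i $ j = complex_of_real (Re (X $ i $ j))" by (simp add: vec_eq_iff)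
  then show ?thesis by (simp add: matrix_inv_unique[OF inv])
qed

definition cyclic_sign :: "4 \<Rightarrow> 4 \<Rightarrow> 4 \<Rightarrow> 'a::comm_ring_1" where
  "cyclic_sign a b c = (if (a, b, c) \<in> {(1, 2, 3), (2, 3, 1), (3, 1, 2)} then 1
     else if (a, b, c) \<in> {(1, 3, 2), (3, 2, 1), (2, 1, 3)} then -1 else 0)"

definition levi_civita :: "4 \<Rightarrow> 4 \<Rightarrow> 4 \<Rightarrow> 4 \<Rightarrow> 'a::comm_ring_1" where
  "levi_civita a b c d = (if a = 0 then cyclic_sign b c d else if b = 0 then - cyclic_sign a c d
     else if c = 0 then cyclic_sign a b d else if d = 0 then - cyclic_sign a b c else 0)"

lemmas levi_civita_simps = levi_civita_def cyclic_sign_def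

lemma of_real_levi_civita [simp]: "of_real (levi_civita a b c d) = levi_civita a b c d"
  by (simp add: levi_civita_simps)

lemma det_levi_civita:
  fixes A :: "'a::comm_ring_1^4^4"
  shows "det A = (\<Sum>a\<in>UNIV. \<Sum>b\<in>UNIV. \<Sum>c\<in>UNIV. \<Sum>d\<in>UNIV.
    levi_civita a b c d * A$a$0 * A$b$1 * A$c$2 * A$d$3)"
proof -
  have insert_0: "finite {1::4, 2, 3}" "0 \<notin> {1::4, 2, 3}" by auto
  have insert_1: "finite {2::4, 3}" "1 \<notin> {2::4, 3}" by auto
  have insert_2: "finite {3::4}" "2 \<notin> {3::4}" by auto
  show ?thesis
    unfolding det_def UNIV_4_eq sum_over_permutations_insert[OF insert_0]
      sum_over_permutations_insert[OF insert_1] sum_over_permutations_insert[OF insert_2] permutes_sing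
    by (simp add: sign_swap_id permutation_swap_id sign_compose sign_id swap_id_eq
      permutation_compose)
      (simp add: levi_civita_simps)
qed

section \<open>Partial derivatives\<close>

definition has_pd :: "(pt \<Rightarrow> complex) \<Rightarrow> complex \<Rightarrow> 4 \<Rightarrow> pt \<Rightarrow> bool" where
  "has_pd f D i x \<longleftrightarrow> ((\<lambda>h. f (x + h *\<^sub>R axis i 1)) has_vector_derivative D) (at 0)"

definition pdiff :: "(pt \<Rightarrow> complex) \<Rightarrow> 4 \<Rightarrow> pt \<Rightarrow> bool" where
  "pdiff f i x \<longleftrightarrow> (\<lambda>h. f (x + h *\<^sub>R axis i 1)) differentiable (at 0)"

lemma pdiff_has_pd: "pdiff f i x \<Longrightarrow> has_pd f (pd i f x) i x"
  by (simp add: pdiff_def has_pd_def pd_def vector_derivative_works)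

lemma has_pd_imp_pdiff: "has_pd f D i x \<Longrightarrow> pdiff f i x"
  unfolding pdiff_def has_pd_def by (metis differentiableI_vector)

lemma has_pd_imp_pd: "has_pd f D i x \<Longrightarrow> pd i f x = D"
  by (simp add: has_pd_def pd_def vector_derivative_at)

lemma has_pd_const: "has_pd (\<lambda>y. c) 0 i x"
  by (simp add: has_pd_def)

lemma has_pd_add: "has_pd f D i x \<Longrightarrow> has_pd g D' i x \<Longrightarrow> has_pd (\<lambda>y. f y + g y) (D + D') i x"
  unfolding has_pd_def by (rule has_vector_derivative_add)

lemma has_pd_mult:
  "has_pd f D i x \<Longrightarrow> has_pd g D' i x \<Longrightarrow> has_pd (\<lambda>y. f y * g y) (f x * D' + D * g x) i x"
  unfolding has_pd_def using has_vector_derivative_mult by fastforce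

lemma has_pd_power2: "has_pd f D i x \<Longrightarrow> has_pd (\<lambda>y. (f y)^2) (2 * f x * D) i x"
  using has_pd_mult[of f D i x f D] by (simp add: power2_eq_square algebra_simps)

lemma has_pd_coord: "has_pd (\<lambda>y. complex_of_real (y $ j)) (if i = j then 1 else 0) i x"
proof -
  have "((\<lambda>h. complex_of_real (x $ j) + complex_of_real h * (if i = j then 1 else 0))
      has_vector_derivative (if i = j then 1 else 0)) (at 0)"
    by (auto intro!: derivative_eq_intros)
  moreover have "(\<lambda>h. complex_of_real ((x + h *\<^sub>R axis i 1) $ j))
      = (\<lambda>h. complex_of_real (x $ j) + complex_of_real h * (if i = j then 1 else 0))"
    by (auto simp: axis_def)
  ultimately show ?thesis unfolding has_pd_def by simp
qed

lemma has_pd_chain: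
  assumes "has_pd f D i x" "(g has_field_derivative g') (at (f x))"
  shows "has_pd (\<lambda>y. g (f y)) (D * g') i x"
proof -
  have "((g \<circ> (\<lambda>h. f (x + h *\<^sub>R axis i 1))) has_vector_derivative (D * g')) (at 0)"
    using assms by (intro field_vector_diff_chain_at) (simp_all add: has_pd_def)
  then show ?thesis by (simp add: has_pd_def o_def)
qed

lemma has_pd_inverse:
  assumes "has_pd f D i x" "f x \<noteq> 0"
  shows "has_pd (\<lambda>y. inverse (f y)) (- (D * inverse (f x) * inverse (f x))) i x"
  using has_pd_chain[OF assms(1) DERIV_inverse[OF assms(2)]]
  by (simp add: power2_eq_square mult.assoc)

lemma has_pd_csqrt:
  assumes "has_pd f D i x" "f x \<notin> \<real>\<^sub>\<le>\<^sub>0"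
  shows "has_pd (\<lambda>y. csqrt (f y)) (D / (2 * csqrt (f x))) i x"
  using has_pd_chain[OF assms(1) has_field_derivative_csqrt[OF assms(2)]] by (simp add: field_simps)

lemma eventually_line:
  fixes x :: pt
  assumes "open U" "x \<in> U"
  shows "\<forall>\<^sub>F h in nhds 0. x + h *\<^sub>R axis i 1 \<in> U"
proof -
  have "((\<lambda>h. x + h *\<^sub>R axis i 1) \<longlongrightarrow> x + 0 *\<^sub>R axis i 1) (nhds (0::real))"
    by (intro tendsto_intros filterlim_ident)
  then show ?thesis using assms by (intro topological_tendstoD) auto
qed

lemma has_pd_transform:
  assumes "open U" "x \<in> U" "\<And>y. y \<in> U \<Longrightarrow> f y = g y" "has_pd f D i x"
  shows "has_pd g D i x"
proof -
  have "\<forall>\<^sub>F h in nhds 0. f (x + h *\<^sub>R axis i 1) = g (x + h *\<^sub>R axis i 1)"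
    using eventually_line[OF assms(1,2), of i] by eventually_elim (use assms(3) in auto)
  then obtain S where S: "open S" "0 \<in> S"
    "\<And>h. h \<in> S \<Longrightarrow> f (x + h *\<^sub>R axis i 1) = g (x + h *\<^sub>R axis i 1)"
    unfolding eventually_nhds by blast
  show ?thesis using assms(4) unfolding has_pd_def
    by (rule has_vector_derivative_transform_within_open[OF _ S(1,2)]) (use S(3) in auto)
qed

lemma pd_cong:
  assumes "open U" "x \<in> U" "\<And>y. y \<in> U \<Longrightarrow> f y = g y"
  shows "pd i f x = pd i g x"
proof -
  have "has_pd f D i x \<longleftrightarrow> has_pd g D i x" for D
    using has_pd_transform[OF assms(1,2), of f g] has_pd_transform[OF assms(1,2), of g f] assms(3)
    by metis
  then show ?thesis unfolding pd_def vector_derivative_def has_pd_def by simp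
qed

lemma has_pd_of_real_sqrt:
  assumes U: "open U" "x \<in> U" "\<And>y. y \<in> U \<Longrightarrow> f y > 0"
    and D: "has_pd (\<lambda>y. complex_of_real (f y)) D i x"
  shows "has_pd (\<lambda>y. complex_of_real (sqrt (f y))) (D / (2 * complex_of_real (sqrt (f x)))) i x"
proof (rule has_pd_transform[OF U(1,2)])
  show "csqrt (complex_of_real (f y)) = complex_of_real (sqrt (f y))" if "y \<in> U" for y
    using U(3)[OF that] by (simp add: csqrt_of_real)
  from this[OF U(2)] show "has_pd (\<lambda>y. csqrt (complex_of_real (f y)))
      (D / (2 * complex_of_real (sqrt (f x)))) i x"
    using has_pd_csqrt[OF D] U(3)[OF U(2)] by (simp add: complex_nonpos_Reals_iff)
qed

lemma pdiff_cong:
  assumes "open U" "x \<in> U" "\<And>y. y \<in> U \<Longrightarrow> f y = g y" "pdiff f i x"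
  shows "pdiff g i x"
  using has_pd_transform[OF assms(1-3) pdiff_has_pd[OF assms(4)]] by (rule has_pd_imp_pdiff)

lemma pdiff_const: "pdiff (\<lambda>y. c) i x"
  using has_pd_const has_pd_imp_pdiff by blast

lemma pdiff_add: "pdiff f i x \<Longrightarrow> pdiff g i x \<Longrightarrow> pdiff (\<lambda>y. f y + g y) i x"
  using has_pd_add has_pd_imp_pdiff pdiff_has_pd by blast

lemma pdiff_mult: "pdiff f i x \<Longrightarrow> pdiff g i x \<Longrightarrow> pdiff (\<lambda>y. f y * g y) i x"
  using has_pd_mult has_pd_imp_pdiff pdiff_has_pd by blast

lemma pd_const: "pd i (\<lambda>y. c) x = 0"
  using has_pd_const has_pd_imp_pd by blast

lemma pd_add: "pdiff f i x \<Longrightarrow> pdiff g i x \<Longrightarrow> pd i (\<lambda>y. f y + g y) x = pd i f x + pd i g x"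
  by (intro has_pd_imp_pd has_pd_add pdiff_has_pd)

lemma pd_mult:
  "pdiff f i x \<Longrightarrow> pdiff g i x \<Longrightarrow> pd i (\<lambda>y. f y * g y) x = f x * pd i g x + pd i f x * g x"
  by (intro has_pd_imp_pd has_pd_mult pdiff_has_pd)

lemma pd_cmult: "pdiff f i x \<Longrightarrow> pd i (\<lambda>y. c * f y) x = c * pd i f x"
  using pd_mult[OF pdiff_const, of f i x c] by (simp add: pd_const)

lemma pdiff_minus: "pdiff f i x \<Longrightarrow> pdiff (\<lambda>y. - f y) i x"
  using pdiff_mult[OF pdiff_const, of f i x "-1"] by simp

lemma pd_minus: "pdiff f i x \<Longrightarrow> pd i (\<lambda>y. - f y) x = - pd i f x"
  using pd_cmult[of f i x "-1"] by simp

lemma pdiff_diff: "pdiff f i x \<Longrightarrow> pdiff g i x \<Longrightarrow> pdiff (\<lambda>y. f y - g y) i x"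
  using pdiff_add[of f i x "\<lambda>y. - g y"] by (simp add: pdiff_minus)

lemma pd_diff: "pdiff f i x \<Longrightarrow> pdiff g i x \<Longrightarrow> pd i (\<lambda>y. f y - g y) x = pd i f x - pd i g x"
  using pd_add[of f i x "\<lambda>y. - g y"] by (simp add: pdiff_minus pd_minus)

lemma pdiff_sum:
  "(\<And>k. k \<in> I \<Longrightarrow> pdiff (f k) i x) \<Longrightarrow> pdiff (\<lambda>y. \<Sum>k\<in>I. f k y) i x"
  by (induction I rule: infinite_finite_induct) (auto intro: pdiff_const pdiff_add)

lemma pd_sum:
  "(\<And>k. k \<in> I \<Longrightarrow> pdiff (f k) i x) \<Longrightarrow> pd i (\<lambda>y. \<Sum>k\<in>I. f k y) x = (\<Sum>k\<in>I. pd i (f k) x)"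
  by (induction I rule: infinite_finite_induct) (auto simp: pd_const pd_add pdiff_sum)

lemmas pdiff_intros = pdiff_const pdiff_add pdiff_minus pdiff_diff pdiff_mult pdiff_sum

subsection \<open>Finite differentiability classes\<close>

fun Ck_on :: "nat \<Rightarrow> pt set \<Rightarrow> (pt \<Rightarrow> complex) \<Rightarrow> bool" where
  "Ck_on 0 U f \<longleftrightarrow> continuous_on U f"
| "Ck_on (Suc k) U f \<longleftrightarrow> continuous_on U f \<and> (\<forall>x\<in>U. \<forall>i. pdiff f i x) \<and> (\<forall>i. Ck_on k U (pd i f))"

lemma smooth_fn_pd:
  assumes "smooth_fn U f"
  shows "smooth_fn U (pd i f)"
proof -
  have "iter_pd js (pd i f) = iter_pd (js @ [i]) f" for js
    by (induction js) auto
  then show ?thesis using assms unfolding smooth_fn_def by metis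
qed

lemma smooth_fn_imp_Ck_on: "smooth_fn U f \<Longrightarrow> Ck_on k U f"
proof (induction k arbitrary: f)
  case 0
  then have "continuous_on U (iter_pd [] f)" unfolding smooth_fn_def by blast
  then show ?case by simp
next
  case (Suc k)
  have "continuous_on U (iter_pd [] f)"
    "\<forall>x\<in>U. \<forall>i. (\<lambda>h. iter_pd [] f (x + h *\<^sub>R axis i 1)) differentiable (at 0)"
    using Suc.prems unfolding smooth_fn_def by blast+
  with Suc.IH[OF smooth_fn_pd[OF Suc.prems]] show ?case
    by (simp add: pdiff_def)
qed

lemma Ck_on_imp_pdiff: "Ck_on k U f \<Longrightarrow> 0 < k \<Longrightarrow> x \<in> U \<Longrightarrow> pdiff f i x"
  by (cases k) auto

lemma Ck_on_Suc: "Ck_on (Suc k) U f \<Longrightarrow> Ck_on k U f"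
proof (induction k arbitrary: f)
  case (Suc k)
  from Suc.prems have "Ck_on k U (pd i f)" for i
    using Suc.IH[of "pd i f"] by simp
  with Suc.prems show ?case by simp
qed simp

lemma Ck_on_mono: "Ck_on n U f \<Longrightarrow> m \<le> n \<Longrightarrow> Ck_on m U f"
  by (rotate_tac 1, induction n rule: dec_induct) (auto dest: Ck_on_Suc simp del: Ck_on.simps)

lemma Ck_on_pd: "Ck_on n U f \<Longrightarrow> k < n \<Longrightarrow> Ck_on k U (pd i f)"
  using Ck_on_mono[of n U f "Suc k"] by simp

lemma Ck_on_cong:
  assumes "open U" "\<And>x. x \<in> U \<Longrightarrow> f x = g x" "Ck_on k U f"
  shows "Ck_on k U g"
  using assms(2,3)
proof (induction k arbitrary: f g)
  case 0
  then show ?case using continuous_on_cong by force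
next
  case (Suc k)
  have "continuous_on U g" using Suc.prems continuous_on_cong[of U U f g] by simp
  moreover have "pdiff g i x" if "x \<in> U" for x i
    using pdiff_cong[OF assms(1) that Suc.prems(1)] Suc.prems(2) that by simp
  moreover have "Ck_on k U (pd i g)" for i
  proof (rule Suc.IH)
    show "pd i f x = pd i g x" if "x \<in> U" for x
      using assms(1) that Suc.prems(1) by (rule pd_cong)
    show "Ck_on k U (pd i f)" using Suc.prems(2) by simp
  qed
  ultimately show ?case by simp
qed

lemma Ck_on_const: "Ck_on k U (\<lambda>x. c)"
proof (induction k arbitrary: c)
  case (Suc k)
  have "pd i (\<lambda>x. c) = (\<lambda>x. 0)" for i by (auto simp: pd_const)
  with Suc show ?case by (auto simp: pdiff_const)
qed auto

lemma Ck_on_coord: "Ck_on k U (\<lambda>x. complex_of_real (x $ j))"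
proof (cases k)
  case 0
  then show ?thesis by (auto intro!: continuous_intros)
next
  case (Suc n)
  have "pd i (\<lambda>x. complex_of_real (x $ j)) = (\<lambda>x. if i = j then 1 else 0)" for i
    using has_pd_imp_pd[OF has_pd_coord] by blast
  with Suc show ?thesis
    by (auto intro!: continuous_intros has_pd_imp_pdiff[OF has_pd_coord] Ck_on_const)
qed

lemma Ck_on_add: "open U \<Longrightarrow> Ck_on k U f \<Longrightarrow> Ck_on k U g \<Longrightarrow> Ck_on k U (\<lambda>x. f x + g x)"
proof (induction k arbitrary: f g)
  case (Suc k)
  have "Ck_on k U (pd i (\<lambda>x. f x + g x))" for i
    by (rule Ck_on_cong[OF Suc.prems(1) _ Suc.IH[OF Suc.prems(1), of "pd i f" "pd i g"]])
      (use Suc.prems in \<open>auto simp: pd_add\<close>)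
  with Suc.prems show ?case by (auto intro!: continuous_on_add pdiff_add)
qed (auto intro!: continuous_on_add)

lemma Ck_on_mult: "open U \<Longrightarrow> Ck_on k U f \<Longrightarrow> Ck_on k U g \<Longrightarrow> Ck_on k U (\<lambda>x. f x * g x)"
proof (induction k arbitrary: f g)
  case (Suc k)
  note Ck = Ck_on_Suc[OF Suc.prems(2)] Ck_on_Suc[OF Suc.prems(3)]
  have "Ck_on k U (pd i (\<lambda>x. f x * g x))" for i
    by (rule Ck_on_cong[OF Suc.prems(1) _ Ck_on_add[OF Suc.prems(1)
            Suc.IH[OF Suc.prems(1), of f "pd i g"] Suc.IH[OF Suc.prems(1), of "pd i f" g]]])
      (use Suc.prems Ck in \<open>auto simp: pd_mult\<close>)
  with Suc.prems show ?case by (auto intro!: continuous_on_mult pdiff_mult)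
qed (auto intro!: continuous_on_mult)

lemma Ck_on_minus: "open U \<Longrightarrow> Ck_on k U f \<Longrightarrow> Ck_on k U (\<lambda>x. - f x)"
  using Ck_on_mult[of U k "\<lambda>x. -1" f] by (simp add: Ck_on_const)

lemma Ck_on_diff: "open U \<Longrightarrow> Ck_on k U f \<Longrightarrow> Ck_on k U g \<Longrightarrow> Ck_on k U (\<lambda>x. f x - g x)"
  using Ck_on_add[of U k f "\<lambda>x. - g x"] by (simp add: Ck_on_minus)

lemma Ck_on_power: "open U \<Longrightarrow> Ck_on k U f \<Longrightarrow> Ck_on k U (\<lambda>x. f x ^ n)"
  by (induction n) (simp_all add: Ck_on_const Ck_on_mult)

lemma Ck_on_sum:
  "open U \<Longrightarrow> (\<And>j. j \<in> I \<Longrightarrow> Ck_on k U (f j)) \<Longrightarrow> Ck_on k U (\<lambda>x. \<Sum>j\<in>I. f j x)"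
  by (induction I rule: infinite_finite_induct) (simp_all add: Ck_on_const Ck_on_add)

lemma Ck_on_inverse:
  "open U \<Longrightarrow> (\<And>x. x \<in> U \<Longrightarrow> f x \<noteq> 0) \<Longrightarrow> Ck_on k U f \<Longrightarrow> Ck_on k U (\<lambda>x. inverse (f x))"
proof (induction k)
  case 0
  then show ?case by (simp add: continuous_on_inverse)
next
  case (Suc k)
  have deriv: "has_pd (\<lambda>y. inverse (f y)) (- (pd i f x * inverse (f x) * inverse (f x))) i x"
    if "x \<in> U" for x i
    using Suc.prems that by (auto intro!: has_pd_inverse pdiff_has_pd)
  have "Ck_on k U (\<lambda>x. inverse (f x))"
    using Suc.IH Suc.prems Ck_on_Suc by blast
  then have "Ck_on k U (pd i (\<lambda>y. inverse (f y)))" for i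
    by (intro Ck_on_cong[OF Suc.prems(1) has_pd_imp_pd[OF deriv, symmetric]])
      (use Suc.prems in \<open>auto intro!: Ck_on_minus Ck_on_mult\<close>)
  with Suc.prems has_pd_imp_pdiff[OF deriv] show ?case by (auto intro!: continuous_on_inverse)
qed

lemma Ck_on_divide:
  "open U \<Longrightarrow> (\<And>x. x \<in> U \<Longrightarrow> g x \<noteq> 0) \<Longrightarrow> Ck_on k U f \<Longrightarrow> Ck_on k U g \<Longrightarrow> Ck_on k U (\<lambda>x. f x / g x)"
  unfolding divide_inverse using Ck_on_mult[of U k f "\<lambda>x. inverse (g x)"] Ck_on_inverse[of U g k]
    by blast

lemma Ck_on_csqrt:
  "open U \<Longrightarrow> (\<And>x. x \<in> U \<Longrightarrow> f x \<notin> \<real>\<^sub>\<le>\<^sub>0) \<Longrightarrow> Ck_on k U f \<Longrightarrow> Ck_on k U (\<lambda>x. csqrt (f x))"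
proof (induction k)
  case 0
  then show ?case by (simp add: continuous_on_eq_continuous_at)
next
  case (Suc k)
  have deriv: "has_pd (\<lambda>y. csqrt (f y)) (pd i f x / (2 * csqrt (f x))) i x" if "x \<in> U" for x i
    using Suc.prems that by (auto intro!: has_pd_csqrt pdiff_has_pd)
  have nz: "2 * csqrt (f x) \<noteq> 0" if "x \<in> U" for x
    using Suc.prems(2)[OF that] by auto
  have "Ck_on k U (\<lambda>x. csqrt (f x))"
    using Suc.IH Suc.prems Ck_on_Suc by blast
  then have "Ck_on k U (pd i (\<lambda>y. csqrt (f y)))" for i
    by (intro Ck_on_cong[OF Suc.prems(1) has_pd_imp_pd[OF deriv, symmetric]])
      (use Suc.prems nz in \<open>auto intro!: Ck_on_divide Ck_on_mult Ck_on_const\<close>)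
  moreover have "continuous_on U (\<lambda>x. csqrt (f x))"
    using Suc.prems by (simp add: continuous_on_eq_continuous_at)
  ultimately show ?case using has_pd_imp_pdiff[OF deriv] by auto
qed

lemma Ck_on_of_real_sqrt:
  assumes "open U" "\<And>x. x \<in> U \<Longrightarrow> f x > 0" "Ck_on k U (\<lambda>x. complex_of_real (f x))"
  shows "Ck_on k U (\<lambda>x. complex_of_real (sqrt (f x)))"
proof (rule Ck_on_cong[OF assms(1)])
  show "csqrt (complex_of_real (f x)) = complex_of_real (sqrt (f x))" if "x \<in> U" for x
    using assms(2)[OF that] by (simp add: csqrt_of_real)
  show "Ck_on k U (\<lambda>x. csqrt (complex_of_real (f x)))"
    using assms(2) by (intro Ck_on_csqrt assms(1,3)) (force simp: complex_nonpos_Reals_iff)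
qed

subsection \<open>Symmetry of second partial derivatives\<close>

lemma has_pd_along:
  assumes "has_pd f D i (x + s *\<^sub>R axis i 1)"
  shows "((\<lambda>s. f (x + s *\<^sub>R axis i 1)) has_vector_derivative D) (at s)"
proof -
  have "((\<lambda>h. f (x + (s + h) *\<^sub>R axis i 1)) has_vector_derivative D) (at 0)"
    using assms by (simp add: has_pd_def algebra_simps)
  moreover have "((\<lambda>u::real. u - s) has_vector_derivative 1) (at s)"
    by (auto intro!: derivative_eq_intros)
  ultimately have "(((\<lambda>h. f (x + (s + h) *\<^sub>R axis i 1)) \<circ> (\<lambda>u. u - s))
      has_vector_derivative (1 *\<^sub>R D)) (at s)"
    by (intro vector_diff_chain_at) auto
  then show ?thesis by (simp add: o_def)
qed

lemma mixed_difference_eq: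
  fixes F Fs Fst :: "real \<Rightarrow> real \<Rightarrow> real"
  assumes "h > 0"
    and "\<And>s t. 0 \<le> s \<Longrightarrow> s \<le> h \<Longrightarrow> 0 \<le> t \<Longrightarrow> t \<le> h \<Longrightarrow> ((\<lambda>s. F s t) has_real_derivative Fs s t) (at s)"
    and "\<And>s t. 0 \<le> s \<Longrightarrow> s \<le> h \<Longrightarrow> 0 \<le> t \<Longrightarrow> t \<le> h \<Longrightarrow> ((\<lambda>t. Fs s t) has_real_derivative Fst s t) (at t)"
  obtains s t where "0 < s" "s < h" "0 < t" "t < h"
    "F h h - F h 0 - F 0 h + F 0 0 = h * h * Fst s t"
proof -
  have "\<exists>s>0. s < h \<and> (F h h - F h 0) - (F 0 h - F 0 0) = (h - 0) * (Fs s h - Fs s 0)"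
    using assms by (intro MVT2) (auto intro!: DERIV_diff)
  then obtain s where s: "0 < s" "s < h" "(F h h - F h 0) - (F 0 h - F 0 0) = h * (Fs s h - Fs s 0)"
    by auto
  have "\<exists>t>0. t < h \<and> Fs s h - Fs s 0 = (h - 0) * Fst s t"
    using assms s by (intro MVT2) auto
  then obtain t where "0 < t" "t < h" "Fs s h - Fs s 0 = h * Fst s t" by auto
  with s that show thesis by (simp add: algebra_simps)
qed

lemma dist_two_steps_le:
  fixes x :: pt
  shows "dist x (x + s *\<^sub>R axis i 1 + t *\<^sub>R axis j 1) \<le> \<bar>s\<bar> + \<bar>t\<bar>"
proof -
  have "dist x (x + s *\<^sub>R axis i 1 + t *\<^sub>R axis j 1)
      = norm (s *\<^sub>R axis i (1::real) + t *\<^sub>R axis j 1 :: pt)"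
    unfolding dist_norm by (metis add.assoc add_diff_cancel_left' norm_minus_commute)
  also have "\<dots> \<le> \<bar>s\<bar> + \<bar>t\<bar>"
    using norm_triangle_ineq[of "s *\<^sub>R axis i (1::real) :: pt" "t *\<^sub>R axis j 1"] by simp
  finally show ?thesis .
qed

lemma second_difference_eq_pd_pd:
  fixes L :: "complex \<Rightarrow> real"
  assumes L: "bounded_linear L" and f: "Ck_on 2 U f" and h: "h > 0"
    and U: "\<And>s t. 0 \<le> s \<Longrightarrow> s \<le> h \<Longrightarrow> 0 \<le> t \<Longrightarrow> t \<le> h \<Longrightarrow> x + s *\<^sub>R axis i 1 + t *\<^sub>R axis j 1 \<in> U"
  obtains y where "dist x y < 2 * h"
    "L (f (x + h *\<^sub>R axis i 1 + h *\<^sub>R axis j 1)) - L (f (x + h *\<^sub>R axis i 1))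
      - L (f (x + h *\<^sub>R axis j 1)) + L (f x) = h * h * L (pd j (pd i f) y)"
proof -
  define p where "p s t = x + s *\<^sub>R axis i 1 + t *\<^sub>R axis j 1" for s t
  have p_swap: "p s t = (x + t *\<^sub>R axis j 1) + s *\<^sub>R axis i 1" for s t
    by (simp add: p_def algebra_simps)
  have deriv_i: "((\<lambda>s. L (f (p s t))) has_real_derivative L (pd i f (p s t))) (at s)"
    if "0 \<le> s" "s \<le> h" "0 \<le> t" "t \<le> h" for s t
  proof -
    have "pdiff f i (p s t)" using Ck_on_imp_pdiff[OF f] U[OF that] by (simp add: p_def)
    then show ?thesis
      unfolding has_real_derivative_iff_has_vector_derivative p_swap
      by (intro bounded_linear.has_vector_derivative[OF L] has_pd_along pdiff_has_pd)
  qed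
  have deriv_j: "((\<lambda>t. L (pd i f (p s t))) has_real_derivative L (pd j (pd i f) (p s t))) (at t)"
    if "0 \<le> s" "s \<le> h" "0 \<le> t" "t \<le> h" for s t
  proof -
    have "pdiff (pd i f) j (p s t)"
      using Ck_on_imp_pdiff[OF Ck_on_pd[OF f, of 1]] U[OF that] by (simp add: p_def)
    then show ?thesis
      unfolding has_real_derivative_iff_has_vector_derivative p_def
      by (intro bounded_linear.has_vector_derivative[OF L] has_pd_along pdiff_has_pd)
  qed
  obtain s t where st: "0 < s" "s < h" "0 < t" "t < h"
    and eq: "L (f (p h h)) - L (f (p h 0)) - L (f (p 0 h)) + L (f (p 0 0))
        = h * h * L (pd j (pd i f) (p s t))"
    using mixed_difference_eq[OF h deriv_i deriv_j] by blast
  show thesis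
    by (rule that[of "p s t"]) (use dist_two_steps_le[of x s i t j] st eq in \<open>simp_all add: p_def\<close>)
qed

lemma pd_pd_agree_nearby:
  fixes L :: "complex \<Rightarrow> real"
  assumes L: "bounded_linear L" and U: "open U" "x \<in> U" and f: "Ck_on 2 U f" and e: "e > 0"
  obtains y z where "dist x y < e" "dist x z < e" "L (pd j (pd i f) y) = L (pd i (pd j f) z)"
proof -
  obtain d where d: "d > 0" "ball x d \<subseteq> U" using U openE by blast
  define h where "h = min d e / 3"
  have h: "h > 0" "2 * h < d" "2 * h < e" using d e by (auto simp: h_def)
  have inU: "x + s *\<^sub>R axis k 1 + t *\<^sub>R axis l 1 \<in> U"
    if "0 \<le> s" "s \<le> h" "0 \<le> t" "t \<le> h" for s t k l
  proof -
    have "dist x (x + s *\<^sub>R axis k 1 + t *\<^sub>R axis l 1) < d"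
      using dist_two_steps_le[of x s k t l] that h by linarith
    then show ?thesis using d(2) by auto
  qed
  obtain y where y: "dist x y < 2 * h"
    "L (f (x + h *\<^sub>R axis i 1 + h *\<^sub>R axis j 1)) - L (f (x + h *\<^sub>R axis i 1))
      - L (f (x + h *\<^sub>R axis j 1)) + L (f x) = h * h * L (pd j (pd i f) y)"
    using second_difference_eq_pd_pd[OF L f h(1) inU] by blast
  obtain z where z: "dist x z < 2 * h"
    "L (f (x + h *\<^sub>R axis j 1 + h *\<^sub>R axis i 1)) - L (f (x + h *\<^sub>R axis j 1))
      - L (f (x + h *\<^sub>R axis i 1)) + L (f x) = h * h * L (pd i (pd j f) z)"
    using second_difference_eq_pd_pd[OF L f h(1) inU] by blast
  have "h * h * L (pd j (pd i f) y) = h * h * L (pd i (pd j f) z)"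
    using y(2) z(2) by (simp add: algebra_simps)
  then have "L (pd j (pd i f) y) = L (pd i (pd j f) z)" using h(1) by simp
  then show thesis using y(1) z(1) h(3) by (intro that[of y z]) simp_all
qed

lemma pd_commute_component:
  fixes L :: "complex \<Rightarrow> real"
  assumes L: "bounded_linear L" and U: "open U" "x \<in> U" and f: "Ck_on 2 U f"
  shows "L (pd j (pd i f) x) = L (pd i (pd j f) x)"
proof -
  have "\<forall>n. \<exists>y z. dist x y < inverse (real (Suc n)) \<and> dist x z < inverse (real (Suc n)) \<and>
      L (pd j (pd i f) y) = L (pd i (pd j f) z)"
    using pd_pd_agree_nearby[OF L U f]
    by (metis inverse_positive_iff_positive of_nat_0_less_iff zero_less_Suc)
  then obtain y z where yz: "\<And>n. dist x (y n) < inverse (real (Suc n))"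
    "\<And>n. dist x (z n) < inverse (real (Suc n))"
    "\<And>n. L (pd j (pd i f) (y n)) = L (pd i (pd j f) (z n))"
    by metis
  have lim: "w \<longlonglongrightarrow> x" if "\<And>n. dist x (w n) < inverse (real (Suc n))" for w
    using that by (intro metric_tendsto_imp_tendsto[OF LIMSEQ_inverse_real_of_nat])
      (auto intro!: always_eventually less_imp_le simp: dist_commute)
  have cont: "isCont (\<lambda>y. L (pd k (pd l f) y)) x" for k l
  proof -
    have "continuous_on U (pd k (pd l f))"
      using Ck_on_pd[OF Ck_on_pd[OF f, of 1], of 0] by simp
    then show ?thesis
      using U by (intro bounded_linear.isCont[OF L]) (simp add: continuous_on_eq_continuous_at)
  qed
  have "(\<lambda>n. L (pd j (pd i f) (y n))) \<longlonglongrightarrow> L (pd j (pd i f) x)"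
    "(\<lambda>n. L (pd i (pd j f) (z n))) \<longlonglongrightarrow> L (pd i (pd j f) x)"
    by (rule isCont_tendsto_compose[OF cont lim[OF yz(1)]],
        rule isCont_tendsto_compose[OF cont lim[OF yz(2)]])
  then show ?thesis unfolding yz(3) by (rule LIMSEQ_unique)
qed

lemma pd_commute:
  assumes "open U" "x \<in> U" "Ck_on 2 U f"
  shows "pd i (pd j f) x = pd j (pd i f) x"
  using pd_commute_component[OF bounded_linear_Re assms]
    pd_commute_component[OF bounded_linear_Im assms]
  by (simp add: complex_eq_iff)

section \<open>Anti-self-dual matrices\<close>

definition skew :: "(4 \<Rightarrow> 4 \<Rightarrow> complex) \<Rightarrow> bool" where
  "skew t \<longleftrightarrow> (\<forall>a b. t a b = - t b a)"

definition dual :: "(4 \<Rightarrow> 4 \<Rightarrow> complex) \<Rightarrow> 4 \<Rightarrow> 4 \<Rightarrow> complex" where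
  "dual t a b = (1/2) * (\<Sum>c\<in>UNIV. \<Sum>d\<in>UNIV. levi_civita a b c d * t c d)"

definition asd :: "(4 \<Rightarrow> 4 \<Rightarrow> complex) \<Rightarrow> bool" where
  "asd t \<longleftrightarrow> (\<forall>a b. dual t a b = - t a b)"

definition contract :: "(4 \<Rightarrow> complex) \<Rightarrow> (4 \<Rightarrow> 4 \<Rightarrow> complex) \<Rightarrow> 4 \<Rightarrow> complex" where
  "contract v w b = (\<Sum>a\<in>UNIV. v a * w a b)"

definition so_action :: "(4 \<Rightarrow> 4 \<Rightarrow> complex) \<Rightarrow> (4 \<Rightarrow> 4 \<Rightarrow> complex) \<Rightarrow> 4 \<Rightarrow> 4 \<Rightarrow> complex" where
  "so_action A w a b = (\<Sum>d\<in>UNIV. A a d * w d b) + (\<Sum>d\<in>UNIV. A b d * w a d)"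

lemma skewD: "skew t \<Longrightarrow> t a b = - t b a"
  unfolding skew_def by blast

lemma skew_components:
  assumes "skew t"
  shows "t 1 0 = - t 0 1" "t 2 0 = - t 0 2" "t 3 0 = - t 0 3" "t 2 1 = - t 1 2" "t 1 3 = - t 3 1"
    "t 3 2 = - t 2 3"
    "t a a = 0"
proof -
  show "t a a = 0" using skewD[OF assms, of a a] by simp
qed (rule skewD[OF assms])+

lemma dual_components:
  "dual t 0 1 = (t 2 3 - t 3 2) / 2" "dual t 0 2 = (t 3 1 - t 1 3) / 2"
    "dual t 0 3 = (t 1 2 - t 2 1) / 2"
  "dual t 2 3 = (t 0 1 - t 1 0) / 2" "dual t 3 1 = (t 0 2 - t 2 0) / 2"
    "dual t 1 2 = (t 0 3 - t 3 0) / 2"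
  by (simp_all add: dual_def sum_UNIV_4 levi_civita_simps)

lemma skew_dual: "skew (dual t)"
  unfolding skew_def all_4 by (simp add: dual_def sum_UNIV_4 levi_civita_simps field_simps)

lemma dual_add: "dual (\<lambda>a b. s a b + t a b) a b = dual s a b + dual t a b"
  by (simp add: dual_def distrib_left sum.distrib)

lemma dual_cmult: "dual (\<lambda>a b. c * t a b) a b = c * dual t a b"
  by (simp add: dual_def sum_distrib_left ac_simps)

lemma dual_dual:
  assumes "skew t"
  shows "dual (dual t) a b = t a b"
proof -
  have "\<forall>a b. dual (dual t) a b = t a b"
    unfolding all_4 by (simp add: skew_components[OF assms] skew_components[OF skew_dual]
      dual_components)
  then show ?thesis by blast
qed

lemma skew_eqI:
  assumes "skew s" "skew t" "s 0 1 = t 0 1" "s 0 2 = t 0 2" "s 0 3 = t 0 3" "s 2 3 = t 2 3"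
    "s 3 1 = t 3 1" "s 1 2 = t 1 2"
  shows "s a b = t a b"
proof -
  have "\<forall>a b. s a b = t a b"
    unfolding all_4 using assms(3-)
    by (simp add: skew_components[OF assms(1)] skew_components[OF assms(2)])
  then show ?thesis by blast
qed

lemma asd_imp_skew: "asd t \<Longrightarrow> skew t"
  using skew_dual[of t] unfolding asd_def skew_def by (metis neg_equal_iff_equal)

lemma asd_iff: "asd t \<longleftrightarrow> skew t \<and> t 2 3 = - t 0 1 \<and> t 3 1 = - t 0 2 \<and> t 1 2 = - t 0 3"
proof
  assume t: "asd t"
  then have "dual t a b = - t a b" for a b unfolding asd_def by blast
  from this[of 0 1] this[of 0 2] this[of 0 3]
  show "skew t \<and> t 2 3 = - t 0 1 \<and> t 3 1 = - t 0 2 \<and> t 1 2 = - t 0 3"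
    using asd_imp_skew[OF t] by (simp add: dual_components skew_components)
next
  assume t: "skew t \<and> t 2 3 = - t 0 1 \<and> t 3 1 = - t 0 2 \<and> t 1 2 = - t 0 3"
  then show "asd t"
    unfolding asd_def all_4
    by (simp add: skew_components[OF skew_dual] dual_components skew_components[of t])
qed

lemma asd_components:
  assumes "asd t"
  shows "t 1 0 = - t 0 1" "t 2 0 = - t 0 2" "t 3 0 = - t 0 3" "t 2 3 = - t 0 1" "t 3 2 = t 0 1"
    "t 3 1 = - t 0 2" "t 1 3 = t 0 2" "t 1 2 = - t 0 3" "t 2 1 = t 0 3" "t a a = 0"
  using assms skew_components[of t] unfolding asd_iff by simp_all

lemma asd_add: "asd s \<Longrightarrow> asd t \<Longrightarrow> asd (\<lambda>a b. s a b + t a b)"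
  by (simp add: asd_def dual_add)

lemma asd_cmult: "asd t \<Longrightarrow> asd (\<lambda>a b. c * t a b)"
  by (simp add: asd_def dual_cmult)

lemma asd_projection:
  assumes "skew t"
  shows "asd (\<lambda>a b. (t a b - dual t a b) / 2)"
proof -
  have "dual (\<lambda>a b. (t a b - dual t a b) / 2) a b = - ((t a b - dual t a b) / 2)" for a b
    using dual_cmult[of "1/2" "\<lambda>a b. t a b + - 1 * dual t a b" a b]
      dual_add[of t "\<lambda>a b. - 1 * dual t a b" a b]
      dual_cmult[of "- 1" "dual t" a b] dual_dual[OF assms, of a b]
    by (simp add: field_simps)
  then show ?thesis unfolding asd_def by blast
qed

lemma asd_so_action:
  assumes "skew A" "asd w"
  shows "asd (so_action A w)"
  unfolding asd_iff skew_def all_4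
  by (simp add: so_action_def sum_UNIV_4 skew_components[OF assms(1)] asd_components[OF assms(2)])

lemma levi_civita_invariant:
  assumes "skew A"
  shows "(\<Sum>d\<in>UNIV. A a d * (\<Sum>e\<in>UNIV. levi_civita d b c e * v e))
      + (\<Sum>d\<in>UNIV. A b d * (\<Sum>e\<in>UNIV. levi_civita a d c e * v e))
      + (\<Sum>d\<in>UNIV. A c d * (\<Sum>e\<in>UNIV. levi_civita a b d e * v e))
    = (\<Sum>d\<in>UNIV. levi_civita a b c d * (\<Sum>e\<in>UNIV. A d e * v e))"
proof -
  have "\<forall>a b c. (\<Sum>d\<in>UNIV. A a d * (\<Sum>e\<in>UNIV. levi_civita d b c e * v e))
      + (\<Sum>d\<in>UNIV. A b d * (\<Sum>e\<in>UNIV. levi_civita a d c e * v e))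
      + (\<Sum>d\<in>UNIV. A c d * (\<Sum>e\<in>UNIV. levi_civita a b d e * v e))
    = (\<Sum>d\<in>UNIV. levi_civita a b c d * (\<Sum>e\<in>UNIV. A d e * v e))"
    unfolding all_4 by (simp add: sum_UNIV_4 levi_civita_simps skew_components[OF assms] ac_simps)
  then show ?thesis by blast
qed

lemma asd_cyclic_sum:
  assumes "\<And>c. asd (T c)"
  shows "T a b c + T b c a + T c a b = (\<Sum>d\<in>UNIV. levi_civita a b c d * (- (\<Sum>e\<in>UNIV. T e e d)))"
proof -
  have "\<forall>a b c. T a b c + T b c a + T c a b
      = (\<Sum>d\<in>UNIV. levi_civita a b c d * (- (\<Sum>e\<in>UNIV. T e e d)))"
    unfolding all_4 by (simp add: sum_UNIV_4 levi_civita_simps asd_components[OF assms])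
  then show ?thesis by blast
qed

lemma dual_antisymmetrization:
  "dual (\<lambda>a b. g a b - g b a) b c = (\<Sum>a\<in>UNIV. \<Sum>d\<in>UNIV. levi_civita a b c d * g a d)"
proof -
  have "\<forall>b c. dual (\<lambda>a b. g a b - g b a) b c = (\<Sum>a\<in>UNIV. \<Sum>d\<in>UNIV. levi_civita a b c d * g a d)"
    unfolding all_4 by (simp add: dual_def sum_UNIV_4 levi_civita_simps)
  then show ?thesis by blast
qed

lemma so_action_contract:
  assumes "skew A"
  shows "(\<Sum>c\<in>UNIV. A b c * contract v w c)
    = contract (\<lambda>a. \<Sum>d\<in>UNIV. A a d * v d) w b + contract v (so_action A w) b"
proof -
  have "\<forall>b. (\<Sum>c\<in>UNIV. A b c * contract v w c)
    = contract (\<lambda>a. \<Sum>d\<in>UNIV. A a d * v d) w b + contract v (so_action A w) b"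
    unfolding all_4 by (simp add: contract_def so_action_def sum_UNIV_4 skew_components[OF assms]
      algebra_simps)
  then show ?thesis by blast
qed

definition antisym_contract :: "(4 \<Rightarrow> 4 \<Rightarrow> complex) \<Rightarrow> (4 \<Rightarrow> 4 \<Rightarrow> complex) \<Rightarrow> 4 \<Rightarrow> 4 \<Rightarrow> complex" where
  "antisym_contract q w a b = contract (q b) w a - contract (q a) w b"

lemma asd_part_antisym_contract:
  assumes "asd w"
  shows "antisym_contract q w a b - dual (antisym_contract q w) a b
    = - (\<Sum>c\<in>UNIV. q c c) * w a b - so_action (\<lambda>a b. q a b - q b a) w a b"
proof -
  note components = antisym_contract_def contract_def so_action_def sum_UNIV_4
    asd_components[OF assms]
  show ?thesis
  proof (rule skew_eqI)
    have "skew (antisym_contract q w)"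
      by (simp add: skew_def antisym_contract_def)
    then show "skew (\<lambda>a b. antisym_contract q w a b - dual (antisym_contract q w) a b)"
      using skew_dual unfolding skew_def by (metis minus_diff_minus)
    show "skew (\<lambda>a b. - (\<Sum>c\<in>UNIV. q c c) * w a b - so_action (\<lambda>a b. q a b - q b a) w a b)"
      unfolding skew_def all_4 by (simp add: components algebra_simps)
  qed (simp_all add: dual_components components field_simps)
qed

definition omega1 :: "4 \<Rightarrow> 4 \<Rightarrow> complex" where
  "omega1 a b = (if (a, b) \<in> {(0, 1), (3, 2)} then 1
     else if (a, b) \<in> {(1, 0), (2, 3)} then -1 else 0)"

definition omega2 :: "4 \<Rightarrow> 4 \<Rightarrow> complex" where
  "omega2 a b = (if (a, b) \<in> {(0, 2), (1, 3)} then 1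
     else if (a, b) \<in> {(2, 0), (3, 1)} then -1 else 0)"

definition omega3 :: "4 \<Rightarrow> 4 \<Rightarrow> complex" where
  "omega3 a b = (if (a, b) \<in> {(0, 3), (2, 1)} then 1
     else if (a, b) \<in> {(3, 0), (1, 2)} then -1 else 0)"

definition omega_plus :: "4 \<Rightarrow> 4 \<Rightarrow> complex" where
  "omega_plus a b = (omega2 a b + \<i> * omega3 a b) / complex_of_real (sqrt 2)"

definition omega_minus :: "4 \<Rightarrow> 4 \<Rightarrow> complex" where
  "omega_minus a b = (omega2 a b - \<i> * omega3 a b) / complex_of_real (sqrt 2)"

lemmas omega_simps = omega1_def omega2_def omega3_def omega_plus_def omega_minus_def

text \<open>The skew matrices commuting with the complex structure \<open>omega1\<close>, i.e. those of type (1,1).\<close>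
definition type_11 :: "(4 \<Rightarrow> 4 \<Rightarrow> complex) \<Rightarrow> bool" where
  "type_11 A \<longleftrightarrow> skew A \<and> A 0 2 = A 3 1 \<and> A 0 3 = A 1 2"

definition has_charge :: "complex \<Rightarrow> (4 \<Rightarrow> 4 \<Rightarrow> complex) \<Rightarrow> bool" where
  "has_charge k w \<longleftrightarrow> asd w \<and> (\<forall>a b. so_action omega1 w a b = 2 * \<i> * k * w a b)"

lemma has_charge_omega: "has_charge 0 omega1" "has_charge (-1) omega_plus"
  "has_charge 1 omega_minus"
  unfolding has_charge_def asd_iff skew_def all_4
  by (simp_all add: so_action_def sum_UNIV_4 omega_simps field_simps)

lemma so_action_type_11:
  assumes A: "type_11 A" and w: "asd w"
  shows "so_action A w a b = (A 0 1 - A 2 3) / 2 * so_action omega1 w a b"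
proof -
  have "skew A" "A 3 1 = A 0 2" "A 1 2 = A 0 3"
    using A by (simp_all add: type_11_def)
  then have "\<forall>a b. so_action A w a b = (A 0 1 - A 2 3) / 2 * so_action omega1 w a b"
    unfolding all_4
    by (simp add: so_action_def sum_UNIV_4 omega1_def skew_components asd_components[OF w]
      field_simps)
  then show ?thesis by blast
qed

lemma so_action_has_charge:
  assumes "type_11 A" "has_charge k w"
  shows "so_action A w a b = \<i> * k * (A 0 1 - A 2 3) * w a b"
  using assms(2) so_action_type_11[OF assms(1), of w a b] by (simp add: has_charge_def)

lemma riemann_pair_symmetry:
  fixes R :: "4 \<Rightarrow> 4 \<Rightarrow> 4 \<Rightarrow> 4 \<Rightarrow> complex"
  assumes skew_form: "\<And>a b. skew (\<lambda>c d. R c d a b)" and skew_val: "\<And>c d. skew (R c d)"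
    and bianchi: "\<And>a b c d. R c d a b + R d b a c + R b c a d = 0"
  shows "R a b c d = R c d a b"
  using skewD[OF skew_val, of c d a b] skewD[OF skew_val, of a b c d] skewD[OF skew_val, of b c a d]
    skewD[OF skew_val, of a d b c] skewD[OF skew_val, of a c b d] skewD[OF skew_val, of b d a c]
    skewD[OF skew_form, of c d a b] skewD[OF skew_form, of c d b a] skewD[OF skew_form, of a b c d]
    skewD[OF skew_form, of a b d c] skewD[OF skew_form, of b c a d] skewD[OF skew_form, of b c d a]
    skewD[OF skew_form, of a d b c] skewD[OF skew_form, of a d c b] skewD[OF skew_form, of a c b d]
    skewD[OF skew_form, of a c d b] skewD[OF skew_form, of b d a c] skewD[OF skew_form, of b d c a]
    bianchi[of c d a b] bianchi[of d a b c] bianchi[of a b c d] bianchi[of b c d a]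
  \<comment> \<open>the sum of the four cyclic identities\<close>
  unfolding complex_eq_iff by (simp; linarith)

lemma kaehler_curvature:
  fixes R :: "4 \<Rightarrow> 4 \<Rightarrow> 4 \<Rightarrow> 4 \<Rightarrow> complex"
  assumes skew_form: "\<And>a b. skew (\<lambda>c d. R c d a b)" and type: "\<And>c d. type_11 (R c d)"
    and bianchi: "\<And>a b c d. R c d a b + R d b a c + R b c a d = 0"
  defines "F c d \<equiv> R c d 0 1 - R c d 2 3"
  shows "type_11 F" "(\<Sum>a\<in>UNIV. \<Sum>b\<in>UNIV. R a b a b) = 2 * (F 0 1 - F 2 3)"
proof -
  have skew_val: "skew (R c d)" for c d using type by (simp add: type_11_def)
  note pair = riemann_pair_symmetry[of R, OF skew_form skew_val bianchi]
  have type_eqs: "R c d 0 2 = R c d 3 1" "R c d 0 3 = R c d 1 2" for c d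
    using type by (simp_all add: type_11_def)
  have "R 0 2 c d = R 3 1 c d" "R 0 3 c d = R 1 2 c d" for c d
    using type_eqs[of c d] pair[of 0 2 c d] pair[of 3 1 c d] pair[of 0 3 c d] pair[of 1 2 c d]
    by simp_all
  moreover have "skew F"
    unfolding F_def skew_def by (metis (no_types, lifting) minus_diff_minus skewD[OF skew_form])
  ultimately show "type_11 F" by (simp add: type_11_def F_def)
  have "(\<Sum>a\<in>UNIV. \<Sum>b\<in>UNIV. R a b a b)
      = 2 * (R 0 1 0 1 + R 2 3 2 3 + R 0 2 0 2 + R 3 1 3 1 + R 0 3 0 3 + R 1 2 1 2)"
    by (simp add: sum_UNIV_4 skew_components[OF skew_val] skew_components[OF skew_form])
  also have "\<dots> = 2 * (F 0 1 - F 2 3) + 4 * (R 2 3 0 1 + R 3 1 0 2 + R 1 2 0 3)"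
    using type_eqs[of 0 2] type_eqs[of 3 1] type_eqs[of 0 3] type_eqs[of 1 2]
      pair[of 0 1 2 3] pair[of 0 2 3 1] pair[of 0 3 1 2]
    by (simp add: F_def algebra_simps)
  also have "R 2 3 0 1 + R 3 1 0 2 + R 1 2 0 3 = 0" using bianchi[of 2 3 0 1] by simp
  finally show "(\<Sum>a\<in>UNIV. \<Sum>b\<in>UNIV. R a b a b) = 2 * (F 0 1 - F 2 3)" by simp
qed

section \<open>Tensors in an orthonormal coframe\<close>

text \<open>\<open>h a\<close> is the coframe, \<open>E a\<close> the dual frame, and \<open>W a b\<close> are the connection forms; all frame
  indices are lowered, since the metric is \<open>\<Sum>h\<^sup>a\<otimes>h\<^sup>a\<close> over the complex numbers.\<close>
locale orthonormal_coframe =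
  fixes M am :: real and U :: "pt set"
    and h E :: "4 \<Rightarrow> pt \<Rightarrow> 4 \<Rightarrow> complex" and W :: "4 \<Rightarrow> 4 \<Rightarrow> pt \<Rightarrow> 4 \<Rightarrow> complex"
  assumes open_U: "open U"
    and h_E: "x \<in> U \<Longrightarrow> (\<Sum>m\<in>UNIV. h a x m * E b x m) = (if a = b then 1 else 0)"
    and h_C2: "Ck_on 2 U (\<lambda>x. h a x m)"
    and E_C2: "Ck_on 2 U (\<lambda>x. E a x m)"
    and W_C1: "Ck_on 1 U (\<lambda>x. W a b x m)"
    and metric: "x \<in> U \<Longrightarrow> gmet M am x m n = (\<Sum>a\<in>UNIV. h a x m * h a x n)"
    and skew_W: "x \<in> U \<Longrightarrow> skew (\<lambda>a b. W a b x m)"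
    and structure_eq: "x \<in> U \<Longrightarrow> d1 (h a) x m n + (\<Sum>b\<in>UNIV. wedge (W a b) (h b) x m n) = 0"
begin

definition comps1 :: "(pt \<Rightarrow> 4 \<Rightarrow> complex) \<Rightarrow> pt \<Rightarrow> 4 \<Rightarrow> complex" where
  "comps1 v x a = (\<Sum>m\<in>UNIV. E a x m * v x m)"

definition comps2 :: "(pt \<Rightarrow> 4 \<Rightarrow> 4 \<Rightarrow> complex) \<Rightarrow> pt \<Rightarrow> 4 \<Rightarrow> 4 \<Rightarrow> complex" where
  "comps2 B x a b = (\<Sum>m\<in>UNIV. \<Sum>n\<in>UNIV. E a x m * E b x n * B x m n)"

definition tensor1 :: "(pt \<Rightarrow> 4 \<Rightarrow> complex) \<Rightarrow> pt \<Rightarrow> 4 \<Rightarrow> complex" where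
  "tensor1 t x m = (\<Sum>a\<in>UNIV. t x a * h a x m)"

definition tensor2 :: "(pt \<Rightarrow> 4 \<Rightarrow> 4 \<Rightarrow> complex) \<Rightarrow> pt \<Rightarrow> 4 \<Rightarrow> 4 \<Rightarrow> complex" where
  "tensor2 t x m n = (\<Sum>a\<in>UNIV. \<Sum>b\<in>UNIV. t x a b * h a x m * h b x n)"

definition tensor3 :: "(pt \<Rightarrow> 4 \<Rightarrow> 4 \<Rightarrow> 4 \<Rightarrow> complex) \<Rightarrow> pt \<Rightarrow> 4 \<Rightarrow> 4 \<Rightarrow> 4 \<Rightarrow> complex" where
  "tensor3 t x m n p = (\<Sum>a\<in>UNIV. \<Sum>b\<in>UNIV. \<Sum>c\<in>UNIV. t x a b c * h a x m * h b x n * h c x p)"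

lemma E_h: "x \<in> U \<Longrightarrow> (\<Sum>a\<in>UNIV. h a x m * E a x n) = (if m = n then 1 else 0)"
  by (rule dual_basis_complete) (rule h_E)

lemma comps1_tensor1:
  assumes "x \<in> U"
  shows "comps1 (tensor1 t) x a = t x a"
proof -
  have "comps1 (tensor1 t) x a = (\<Sum>b\<in>UNIV. t x b * (\<Sum>m\<in>UNIV. h b x m * E a x m))"
    unfolding comps1_def tensor1_def sum_distrib_left by (subst sum.swap) (simp add: ac_simps)
  then show ?thesis by (simp add: h_E[OF assms])
qed

lemma tensor1_comps1:
  assumes "x \<in> U"
  shows "tensor1 (comps1 v) x m = v x m"
proof -
  have "tensor1 (comps1 v) x m = (\<Sum>n\<in>UNIV. v x n * (\<Sum>a\<in>UNIV. h a x m * E a x n))"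
    unfolding comps1_def tensor1_def sum_distrib_left sum_distrib_right
    by (subst sum.swap) (simp add: ac_simps)
  then show ?thesis by (simp add: E_h[OF assms])
qed

lemma comps2_eq_comps1: "comps2 B x a b = comps1 (\<lambda>y m. comps1 (\<lambda>z. B z m) y b) x a"
  by (simp add: comps1_def comps2_def sum_distrib_left ac_simps)

lemma tensor2_eq_tensor1: "tensor2 t x m n = tensor1 (\<lambda>y a. tensor1 (\<lambda>z. t z a) y n) x m"
  by (simp add: tensor1_def tensor2_def sum_distrib_left sum_distrib_right ac_simps)

lemma tensor3_eq_tensor1: "tensor3 t x m n p = tensor1 (\<lambda>y a. tensor2 (\<lambda>z. t z a) y n p) x m"
  by (simp add: tensor1_def tensor2_def tensor3_def sum_distrib_left sum_distrib_right ac_simps)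

lemma tensor3_eq_tensor2: "tensor3 t x m n p = tensor2 (\<lambda>y a b. tensor1 (\<lambda>z. t z a b) y p) x m n"
  by (simp add: tensor1_def tensor2_def tensor3_def sum_distrib_left sum_distrib_right ac_simps)

lemma tensor1_cong: "(\<And>a. t x a = t' x a) \<Longrightarrow> tensor1 t x m = tensor1 t' x m"
  by (simp add: tensor1_def)

lemma tensor2_cong: "(\<And>a b. t x a b = t' x a b) \<Longrightarrow> tensor2 t x m n = tensor2 t' x m n"
  by (simp add: tensor2_def)

lemma tensor3_cong: "(\<And>a b c. t x a b c = t' x a b c) \<Longrightarrow> tensor3 t x m n p = tensor3 t' x m n p"
  by (simp add: tensor3_def)

lemma comps2_tensor2: "x \<in> U \<Longrightarrow> comps2 (tensor2 t) x a b = t x a b"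
proof -
  assume x: "x \<in> U"
  have "comps1 (\<lambda>z. tensor2 t z m) x b = tensor1 (\<lambda>y a. t y a b) x m" for m
  proof -
    have "tensor2 t x m = tensor1 (\<lambda>y b. tensor1 (\<lambda>z a. t z a b) y m) x"
      unfolding tensor1_def tensor2_def by (intro ext, subst sum.swap) (simp add: sum_distrib_right)
    then show ?thesis
      using comps1_tensor1[OF x, of "\<lambda>y b. tensor1 (\<lambda>z a. t z a b) y m" b] by (simp add: comps1_def)
  qed
  then show ?thesis
    using comps1_tensor1[OF x, of "\<lambda>y a. t y a b" a] by (simp add: comps2_eq_comps1 comps1_def)
qed

lemma tensor1_comps2:
  assumes x: "x \<in> U"
  shows "tensor1 (\<lambda>y. comps2 B y a) x n = comps1 (\<lambda>y m. B y m n) x a"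
proof -
  have "comps2 B y a b = comps1 (\<lambda>y n. comps1 (\<lambda>z m. B z m n) y a) y b" for y b
    unfolding comps1_def comps2_def by (subst sum.swap) (simp add: sum_distrib_left ac_simps)
  then show ?thesis
    using tensor1_comps1[OF x, of "\<lambda>y n. comps1 (\<lambda>z m. B z m n) y a" n] by (simp add: tensor1_def)
qed

lemma tensor2_comps2:
  assumes x: "x \<in> U"
  shows "tensor2 (comps2 B) x m n = B x m n"
proof -
  have "tensor2 (comps2 B) x m n = tensor1 (comps1 (\<lambda>y m. B y m n)) x m"
    unfolding tensor2_eq_tensor1 by (rule tensor1_cong) (rule tensor1_comps2[OF x])
  then show ?thesis by (simp add: tensor1_comps1[OF x])
qed

lemma tensor3_eq_0D:
  assumes x: "x \<in> U" and "\<And>m n p. tensor3 t x m n p = 0"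
  shows "t x a b c = 0"
proof -
  have "tensor2 (\<lambda>z. t z a) x n p = 0" for n p
    using comps1_tensor1[OF x, of "\<lambda>y a. tensor2 (\<lambda>z. t z a) y n p" a] assms(2)
    by (simp add: comps1_def tensor3_eq_tensor1)
  then show ?thesis
    using comps2_tensor2[OF x, of "\<lambda>z. t z a" b c] by (simp add: comps2_def)
qed

lemma tensor2_transpose: "tensor2 t x n m = tensor2 (\<lambda>y a b. t y b a) x m n"
  unfolding tensor2_def by (subst sum.swap) (simp add: ac_simps)

lemma tensor3_cycle: "tensor3 t x n p m = tensor3 (\<lambda>y a b c. t y b c a) x m n p"
  unfolding tensor3_def by (subst sum_rotate3) (simp add: ac_simps)

lemma tensor2_add: "tensor2 (\<lambda>y a b. s y a b + t y a b) x m n = tensor2 s x m n + tensor2 t x m n"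
  by (simp add: tensor2_def distrib_right sum.distrib)

lemma tensor2_cmult: "tensor2 (\<lambda>y a b. f y * t y a b) x m n = f x * tensor2 t x m n"
  by (simp add: tensor2_def sum_distrib_left ac_simps)

lemma tensor3_add:
  "tensor3 (\<lambda>y a b c. s y a b c + t y a b c) x m n p = tensor3 s x m n p + tensor3 t x m n p"
  by (simp add: tensor3_def distrib_right sum.distrib)

lemma comps2_wedge:
  "comps2 (wedge u v) x a b = comps1 u x a * comps1 v x b - comps1 u x b * comps1 v x a"
proof -
  have "comps2 (wedge u v) x a b = (\<Sum>m\<in>UNIV. \<Sum>n\<in>UNIV. E a x m * u x m * (E b x n * v x n))
      - (\<Sum>m\<in>UNIV. \<Sum>n\<in>UNIV. E b x n * u x n * (E a x m * v x m))"
    by (simp add: comps2_def wedge_def sum_subtractf right_diff_distrib ac_simps)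
  also have "(\<Sum>m\<in>UNIV. \<Sum>n\<in>UNIV. E b x n * u x n * (E a x m * v x m)) = comps1 u x b * comps1 v x a"
    unfolding comps1_def sum_product by (rule sum.swap)
  finally show ?thesis by (simp add: comps1_def sum_product)
qed

lemma pdiff_h: "x \<in> U \<Longrightarrow> pdiff (\<lambda>y. h a y m) i x"
  using Ck_on_imp_pdiff[OF h_C2] by simp

lemma pdiff_W: "x \<in> U \<Longrightarrow> pdiff (\<lambda>y. W a b y m) i x"
  using Ck_on_imp_pdiff[OF W_C1] by simp

lemmas Ck_on_intros = Ck_on_const Ck_on_add[OF open_U] Ck_on_minus[OF open_U] Ck_on_diff[OF open_U]
  Ck_on_mult[OF open_U] Ck_on_sum[OF open_U]

section \<open>The Levi-Civita connection in the coframe\<close>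

lemma ginv_frame:
  assumes "x \<in> U"
  shows "ginv M am x m n = (\<Sum>a\<in>UNIV. E a x m * E a x n)"
  using matrix_inv_sum_squares[of "\<lambda>a m. h a x m" "\<lambda>a m. E a x m", OF h_E[OF assms]]
  by (simp add: ginv_def metric[OF assms])

lemma ginv_tensor2:
  assumes x: "x \<in> U"
  shows "(\<Sum>m\<in>UNIV. \<Sum>n\<in>UNIV. ginv M am x m n * tensor2 t x n m) = (\<Sum>a\<in>UNIV. t x a a)"
proof -
  have "(\<Sum>m\<in>UNIV. \<Sum>n\<in>UNIV. ginv M am x m n * tensor2 t x n m)
     = (\<Sum>a\<in>UNIV. \<Sum>m\<in>UNIV. \<Sum>n\<in>UNIV. E a x m * E a x n * tensor2 t x n m)"
    unfolding ginv_frame[OF x] sum_distrib_right by (rule sum_rotate3)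
  also have "\<dots> = (\<Sum>a\<in>UNIV. comps2 (tensor2 t) x a a)"
    unfolding comps2_def by (rule sum.cong[OF refl], subst sum.swap) (simp add: ac_simps)
  finally show ?thesis by (simp add: comps2_tensor2[OF x])
qed

text \<open>The Christoffel symbols with their upper index referred to the coframe.\<close>
definition christoffel :: "4 \<Rightarrow> pt \<Rightarrow> 4 \<Rightarrow> 4 \<Rightarrow> complex" where
  "christoffel a x m n = pd m (\<lambda>y. h a y n) x + (\<Sum>b\<in>UNIV. W a b x m * h b x n)"

lemma christoffel_sym:
  assumes "x \<in> U"
  shows "christoffel a x m n = christoffel a x n m"
  using structure_eq[OF assms, of a m n]
  by (simp add: christoffel_def d1_def wedge_def sum_subtractf algebra_simps)

lemma pd_gmet:
  assumes x: "x \<in> U"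
  shows "pd m (\<lambda>y. gmet M am y s n) x
    = (\<Sum>a\<in>UNIV. h a x s * christoffel a x m n + christoffel a x m s * h a x n)"
proof -
  have "pd m (\<lambda>y. gmet M am y s n) x = pd m (\<lambda>y. \<Sum>a\<in>UNIV. h a y s * h a y n) x"
    by (rule pd_cong[OF open_U x]) (rule metric)
  also have "\<dots> = (\<Sum>a\<in>UNIV. h a x s * pd m (\<lambda>y. h a y n) x + pd m (\<lambda>y. h a y s) x * h a x n)"
    using x by (simp add: pd_sum pd_mult pdiff_h pdiff_mult)
  also have "\<dots> = (\<Sum>a\<in>UNIV. h a x s * christoffel a x m n + christoffel a x m s * h a x n)"
    by (simp add: christoffel_def sum_UNIV_4 skew_components[OF skew_W[OF x]] algebra_simps)
  finally show ?thesis .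
qed

lemma Gam_eq_christoffel:
  assumes x: "x \<in> U"
  shows "Gam M am x l m n = (\<Sum>a\<in>UNIV. E a x l * christoffel a x m n)"
proof -
  have koszul: "pd m (\<lambda>y. gmet M am y s n) x + pd n (\<lambda>y. gmet M am y s m) x
      - pd s (\<lambda>y. gmet M am y m n) x
      = 2 * tensor1 (\<lambda>y a. christoffel a y m n) x s" for s
    unfolding pd_gmet[OF x] tensor1_def christoffel_sym[OF x, of _ n m]
      christoffel_sym[OF x, of _ s n]
      christoffel_sym[OF x, of _ s m]
    by (simp add: sum_distrib_left sum.distrib[symmetric] sum_subtractf[symmetric] algebra_simps)
  have "Gam M am x l m n = (\<Sum>s\<in>UNIV. \<Sum>a\<in>UNIV.
      E a x l * (E a x s * tensor1 (\<lambda>y a. christoffel a y m n) x s))"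
    unfolding Gam_def koszul by (simp add: ginv_frame[OF x] sum_distrib_left sum_distrib_right
      ac_simps)
  also have "\<dots> = (\<Sum>a\<in>UNIV. E a x l * comps1 (tensor1 (\<lambda>y a. christoffel a y m n)) x a)"
    unfolding comps1_def sum_distrib_left by (rule sum.swap)
  finally show ?thesis by (simp add: comps1_tensor1[OF x])
qed

lemma Gam_sym: "x \<in> U \<Longrightarrow> Gam M am x l m n = Gam M am x l n m"
  by (simp add: Gam_eq_christoffel christoffel_sym[of x _ m n])

lemma Gam_h:
  assumes x: "x \<in> U"
  shows "(\<Sum>l\<in>UNIV. Gam M am x l m n * h a x l) = christoffel a x m n"
proof -
  have "(\<Sum>l\<in>UNIV. Gam M am x l m n * h a x l)
      = (\<Sum>b\<in>UNIV. christoffel b x m n * (\<Sum>l\<in>UNIV. h a x l * E b x l))"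
    unfolding Gam_eq_christoffel[OF x] sum_distrib_left sum_distrib_right
    by (subst sum.swap) (simp add: ac_simps)
  then show ?thesis by (simp add: h_E[OF x])
qed

lemma Gam_tensor1:
  assumes "x \<in> U"
  shows "(\<Sum>l\<in>UNIV. Gam M am x l m n * tensor1 t x l) = (\<Sum>a\<in>UNIV. t x a * christoffel a x m n)"
proof -
  have "(\<Sum>l\<in>UNIV. Gam M am x l m n * tensor1 t x l)
      = (\<Sum>a\<in>UNIV. t x a * (\<Sum>l\<in>UNIV. Gam M am x l m n * h a x l))"
    unfolding tensor1_def sum_distrib_left by (subst sum.swap) (simp add: ac_simps)
  then show ?thesis by (simp add: Gam_h[OF assms])
qed

text \<open>In \<open>covd\<close> the first index is a coordinate index, in \<open>nabla\<close> a frame index.\<close>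
definition covd1 :: "(pt \<Rightarrow> 4 \<Rightarrow> complex) \<Rightarrow> pt \<Rightarrow> 4 \<Rightarrow> 4 \<Rightarrow> complex" where
  "covd1 t x l a = pd l (\<lambda>y. t y a) x + (\<Sum>b\<in>UNIV. W a b x l * t x b)"

definition covd2 :: "(pt \<Rightarrow> 4 \<Rightarrow> 4 \<Rightarrow> complex) \<Rightarrow> pt \<Rightarrow> 4 \<Rightarrow> 4 \<Rightarrow> 4 \<Rightarrow> complex" where
  "covd2 t x l a b = pd l (\<lambda>y. t y a b) x + so_action (\<lambda>a b. W a b x l) (t x) a b"

definition covd3 :: "(pt \<Rightarrow> 4 \<Rightarrow> 4 \<Rightarrow> 4 \<Rightarrow> complex) \<Rightarrow> pt \<Rightarrow> 4 \<Rightarrow> 4 \<Rightarrow> 4 \<Rightarrow> 4 \<Rightarrow> complex" where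
  "covd3 t x l a b c = pd l (\<lambda>y. t y a b c) x + (\<Sum>d\<in>UNIV. W a d x l * t x d b c)
     + (\<Sum>d\<in>UNIV. W b d x l * t x a d c) + (\<Sum>d\<in>UNIV. W c d x l * t x a b d)"

definition nabla1 :: "(pt \<Rightarrow> 4 \<Rightarrow> complex) \<Rightarrow> pt \<Rightarrow> 4 \<Rightarrow> 4 \<Rightarrow> complex" where
  "nabla1 t x c a = comps1 (\<lambda>y l. covd1 t y l a) x c"

definition nabla2 :: "(pt \<Rightarrow> 4 \<Rightarrow> 4 \<Rightarrow> complex) \<Rightarrow> pt \<Rightarrow> 4 \<Rightarrow> 4 \<Rightarrow> 4 \<Rightarrow> complex" where
  "nabla2 t x c a b = comps1 (\<lambda>y l. covd2 t y l a b) x c"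

definition nabla3 :: "(pt \<Rightarrow> 4 \<Rightarrow> 4 \<Rightarrow> 4 \<Rightarrow> complex) \<Rightarrow> pt \<Rightarrow> 4 \<Rightarrow> 4 \<Rightarrow> 4 \<Rightarrow> 4 \<Rightarrow> complex" where
  "nabla3 t x d a b c = comps1 (\<lambda>y l. covd3 t y l a b c) x d"

lemma cov1_tensor1:
  assumes x: "x \<in> U" and t: "\<And>a. pdiff (\<lambda>y. t y a) l x"
  shows "cov1 M am (tensor1 t) x l n = tensor1 (\<lambda>y. covd1 t y l) x n"
proof -
  have "pd l (\<lambda>y. tensor1 t y n) x
      = (\<Sum>a\<in>UNIV. t x a * pd l (\<lambda>y. h a y n) x + pd l (\<lambda>y. t y a) x * h a x n)"
    unfolding tensor1_def using x t by (simp add: pd_sum pd_mult pdiff_h pdiff_mult)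
  then have "cov1 M am (tensor1 t) x l n
     = (\<Sum>a\<in>UNIV. pd l (\<lambda>y. t y a) x * h a x n) - (\<Sum>a\<in>UNIV. \<Sum>b\<in>UNIV. t x a * W a b x l * h b x n)"
    unfolding cov1_def Gam_tensor1[OF x]
    by (simp add: christoffel_def sum.distrib sum_distrib_left distrib_left ac_simps)
  also have "(\<Sum>a\<in>UNIV. \<Sum>b\<in>UNIV. t x a * W a b x l * h b x n)
      = (\<Sum>b\<in>UNIV. \<Sum>a\<in>UNIV. t x a * W a b x l * h b x n)"
    by (rule sum.swap)
  also have "\<dots> = - (\<Sum>b\<in>UNIV. (\<Sum>a\<in>UNIV. W b a x l * t x a) * h b x n)"
  proof -
    have "t x a * W a b x l * h b x n = - (W b a x l * t x a * h b x n)" for a b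
      using skewD[OF skew_W[OF x], of a b l] by simp
    then show ?thesis by (simp only: sum_negf sum_distrib_right)
  qed
  also have "(\<Sum>a\<in>UNIV. pd l (\<lambda>y. t y a) x * h a x n) - \<dots> = tensor1 (\<lambda>y. covd1 t y l) x n"
    by (simp add: tensor1_def covd1_def distrib_right sum.distrib)
  finally show ?thesis .
qed

lemma pdiff_tensor1:
  assumes "x \<in> U" "\<And>a. pdiff (\<lambda>y. t y a) l x"
  shows "pdiff (\<lambda>y. tensor1 t y n) l x"
  unfolding tensor1_def by (intro pdiff_intros pdiff_h assms)

lemma pdiff_tensor2:
  assumes "x \<in> U" "\<And>a b. pdiff (\<lambda>y. t y a b) l x"
  shows "pdiff (\<lambda>y. tensor2 t y m n) l x"
  unfolding tensor2_eq_tensor1 by (intro pdiff_tensor1 assms)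

lemma cov2_tensor2:
  assumes x: "x \<in> U" and t: "\<And>a b. pdiff (\<lambda>y. t y a b) l x"
  shows "cov2 M am (tensor2 t) x l m n = tensor2 (\<lambda>y. covd2 t y l) x m n"
proof -
  define X where "X y a = tensor1 (\<lambda>z. t z a) y n" for y a
  have X: "tensor2 t y k n = tensor1 X y k" for y k
    unfolding X_def by (rule tensor2_eq_tensor1)
  have "cov2 M am (tensor2 t) x l m n
     = cov1 M am (tensor1 X) x l m - (\<Sum>k\<in>UNIV. Gam M am x k l n * tensor2 t x m k)"
    by (simp add: cov2_def cov1_def sum.distrib X)
  also have "cov1 M am (tensor1 X) x l m = tensor1 (\<lambda>y. covd1 X y l) x m"
    unfolding X_def by (intro cov1_tensor1 pdiff_tensor1 x t)
  also have "(\<Sum>k\<in>UNIV. Gam M am x k l n * tensor2 t x m k)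
     = (\<Sum>a\<in>UNIV. (\<Sum>k\<in>UNIV. Gam M am x k l n * tensor1 (\<lambda>z. t z a) x k) * h a x m)"
    unfolding tensor2_eq_tensor1 tensor1_def[of _ x m] sum_distrib_left sum_distrib_right
    by (subst sum.swap) (simp add: ac_simps)
  also have "tensor1 (\<lambda>y. covd1 X y l) x m - \<dots>
     = (\<Sum>a\<in>UNIV. (cov1 M am (tensor1 (\<lambda>z. t z a)) x l n + (\<Sum>b\<in>UNIV. W a b x l * X x b)) * h a x m)"
    by (simp add: tensor1_def[of _ x m] covd1_def cov1_def X_def sum_subtractf[symmetric]
      algebra_simps)
  also have "\<dots> = (\<Sum>a\<in>UNIV. tensor1 (\<lambda>y. covd2 t y l a) x n * h a x m)"
  proof -
    have "(\<Sum>b\<in>UNIV. W a b x l * X x b) = (\<Sum>b\<in>UNIV. (\<Sum>d\<in>UNIV. W a d x l * t x d b) * h b x n)" for a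
      unfolding X_def tensor1_def sum_distrib_left sum_distrib_right
      by (subst sum.swap) (simp add: ac_simps)
    then show ?thesis
      by (simp add: cov1_tensor1[OF x t] tensor1_def covd1_def covd2_def so_action_def
          sum.distrib distrib_right add_ac)
  qed
  also have "\<dots> = tensor2 (\<lambda>y. covd2 t y l) x m n"
    by (simp add: tensor2_eq_tensor1 tensor1_def[of _ x m])
  finally show ?thesis .
qed

lemma cov3_tensor3:
  assumes x: "x \<in> U" and t: "\<And>a b c. pdiff (\<lambda>y. t y a b c) l x"
  shows "cov3 M am (tensor3 t) x l m n p = tensor3 (\<lambda>y. covd3 t y l) x m n p"
proof -
  define X where "X y a = tensor2 (\<lambda>z. t z a) y n p" for y a
  have X: "tensor3 t y k n p = tensor1 X y k" for y k
    unfolding X_def by (rule tensor3_eq_tensor1)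
  have "cov3 M am (tensor3 t) x l m n p = cov1 M am (tensor1 X) x l m
      - (\<Sum>k\<in>UNIV. Gam M am x k l n * tensor3 t x m k p + Gam M am x k l p * tensor3 t x m n k)"
    by (simp add: cov3_def cov1_def sum.distrib X)
  also have "cov1 M am (tensor1 X) x l m = tensor1 (\<lambda>y. covd1 X y l) x m"
    unfolding X_def by (intro cov1_tensor1 pdiff_tensor2 x t)
  also have "(\<Sum>k\<in>UNIV. Gam M am x k l n * tensor3 t x m k p + Gam M am x k l p * tensor3 t x m n k)
     = (\<Sum>a\<in>UNIV. (\<Sum>k\<in>UNIV. Gam M am x k l n * tensor2 (\<lambda>z. t z a) x k p
         + Gam M am x k l p * tensor2 (\<lambda>z. t z a) x n k) * h a x m)"
    unfolding tensor3_eq_tensor1 tensor1_def[of _ x m] sum_distrib_left sum_distrib_right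
      sum.distrib[symmetric]
    by (subst sum.swap) (simp add: algebra_simps)
  also have "tensor1 (\<lambda>y. covd1 X y l) x m - \<dots>
     = (\<Sum>a\<in>UNIV. (cov2 M am (tensor2 (\<lambda>z. t z a)) x l n p
         + (\<Sum>b\<in>UNIV. W a b x l * X x b)) * h a x m)"
    by (simp add: tensor1_def[of _ x m] covd1_def cov2_def X_def sum_subtractf[symmetric]
      algebra_simps)
  also have "\<dots> = (\<Sum>a\<in>UNIV. tensor2 (\<lambda>y. covd3 t y l a) x n p * h a x m)"
  proof -
    have "(\<Sum>b\<in>UNIV. W a b x l * X x b)
        = tensor2 (\<lambda>y b c. \<Sum>d\<in>UNIV. W a d y l * t y d b c) x n p" for a
      unfolding X_def tensor2_def sum_distrib_left sum_distrib_right
      by (subst sum_rotate3[symmetric]) (simp add: ac_simps)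
    then show ?thesis
      by (simp add: cov2_tensor2[OF x t] tensor2_def covd2_def covd3_def so_action_def
          sum.distrib distrib_right add_ac)
  qed
  also have "\<dots> = tensor3 (\<lambda>y. covd3 t y l) x m n p"
    by (simp add: tensor3_eq_tensor1 tensor1_def[of _ x m])
  finally show ?thesis .
qed

lemma tensor2_comps1:
  assumes "x \<in> U"
  shows "tensor2 (\<lambda>y c a. comps1 (\<lambda>z l. F z l a) y c) x l m = tensor1 (\<lambda>y. F y l) x m"
proof -
  have "tensor2 (\<lambda>y c a. comps1 (\<lambda>z l. F z l a) y c) x l m
      = (\<Sum>a\<in>UNIV. tensor1 (comps1 (\<lambda>z l. F z l a)) x l * h a x m)"
    unfolding tensor2_def tensor1_def sum_distrib_right by (subst sum.swap) (simp add: ac_simps)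
  then show ?thesis unfolding tensor1_comps1[OF assms] by (simp add: tensor1_def)
qed

lemma comps1_tensor1_swap:
  "comps1 (\<lambda>z l. tensor1 (\<lambda>y. G y l) z n) x c = tensor1 (\<lambda>y a. comps1 (\<lambda>z l. G z l a) y c) x n"
  unfolding comps1_def tensor1_def sum_distrib_left sum_distrib_right
  by (subst sum.swap) (simp add: ac_simps)

lemma comps1_tensor2_swap:
  "comps1 (\<lambda>z l. tensor2 (\<lambda>y. G y l) z n p) x c
    = tensor2 (\<lambda>y a b. comps1 (\<lambda>z l. G z l a b) y c) x n p"
  unfolding tensor2_eq_tensor1 comps1_tensor1_swap ..

lemma cov1_nabla1:
  assumes "x \<in> U" "\<And>a. pdiff (\<lambda>y. t y a) l x"
  shows "cov1 M am (tensor1 t) x l m = tensor2 (nabla1 t) x l m"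
  unfolding cov1_tensor1[OF assms] nabla1_def[abs_def] tensor2_comps1[OF assms(1)] ..

lemma cov2_nabla2:
  assumes x: "x \<in> U" and t: "\<And>a b. pdiff (\<lambda>y. t y a b) l x"
  shows "cov2 M am (tensor2 t) x l m n = tensor3 (nabla2 t) x l m n"
  unfolding cov2_tensor2[OF x t] tensor2_eq_tensor1[of _ x m n] tensor3_eq_tensor2 nabla2_def
    comps1_tensor1_swap[symmetric] tensor2_comps1[OF x] ..

lemma cov3_nabla3:
  assumes x: "x \<in> U" and t: "\<And>a b c. pdiff (\<lambda>y. t y a b c) l x"
  shows "cov3 M am (tensor3 t) x l m n p
    = tensor2 (\<lambda>y d a. tensor2 (\<lambda>z. nabla3 t z d a) y n p) x l m"
  unfolding cov3_tensor3[OF x t] tensor3_eq_tensor1 nabla3_def comps1_tensor2_swap[symmetric]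
    tensor2_comps1[OF x] ..

definition ext_deriv :: "(pt \<Rightarrow> 4 \<Rightarrow> complex) \<Rightarrow> pt \<Rightarrow> 4 \<Rightarrow> 4 \<Rightarrow> complex" where
  "ext_deriv v x a b = nabla1 v x a b - nabla1 v x b a"

definition codiff :: "(pt \<Rightarrow> 4 \<Rightarrow> 4 \<Rightarrow> complex) \<Rightarrow> pt \<Rightarrow> 4 \<Rightarrow> complex" where
  "codiff t x b = - (\<Sum>a\<in>UNIV. nabla2 t x a a b)"

lemma d1_eq_cov1: "x \<in> U \<Longrightarrow> d1 th x m n = cov1 M am th x m n - cov1 M am th x n m"
  by (simp add: d1_def cov1_def Gam_sym[of x _ n m])

lemma d2_eq_cov2:
  assumes x: "x \<in> U" and B: "\<And>r s. B x r s = - B x s r"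
  shows "d2 B x a b c = cov2 M am B x a b c + cov2 M am B x b c a + cov2 M am B x c a b"
proof -
  have "(\<Sum>l\<in>UNIV. Gam M am x l a b * B x l c + Gam M am x l a c * B x b l)
      + (\<Sum>l\<in>UNIV. Gam M am x l b c * B x l a + Gam M am x l b a * B x c l)
      + (\<Sum>l\<in>UNIV. Gam M am x l c a * B x l b + Gam M am x l c b * B x a l) = 0"
    unfolding sum.distrib[symmetric] Gam_sym[OF x, of _ b a] Gam_sym[OF x, of _ c a]
      Gam_sym[OF x, of _ c b]
      B[of b] B[of c] B[of a] by (simp add: algebra_simps)
  then show ?thesis by (simp add: d2_def cov2_def algebra_simps)
qed

lemma d1_tensor1:
  assumes x: "x \<in> U" and t: "\<And>a m. pdiff (\<lambda>y. t y a) m x"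
  shows "d1 (tensor1 t) x m n = tensor2 (ext_deriv t) x m n"
proof -
  have "d1 (tensor1 t) x m n = tensor2 (nabla1 t) x m n - tensor2 (\<lambda>y a b. nabla1 t y b a) x m n"
    unfolding d1_eq_cov1[OF x] cov1_nabla1[OF x t] tensor2_transpose[of "nabla1 t" x n m] ..
  then show ?thesis by (simp add: tensor2_def ext_deriv_def left_diff_distrib sum_subtractf)
qed

lemma del2_tensor2:
  assumes x: "x \<in> U" and t: "\<And>a b m. pdiff (\<lambda>y. t y a b) m x"
  shows "del2 M am (tensor2 t) x n = tensor1 (codiff t) x n"
proof -
  have "del2 M am (tensor2 t) x n = - (\<Sum>a\<in>UNIV. tensor1 (\<lambda>z. nabla2 t z a a) x n)"
    unfolding del2_def cov2_nabla2[OF x t] tensor3_eq_tensor2 ginv_tensor2[OF x] ..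
  also have "\<dots> = - (\<Sum>b\<in>UNIV. \<Sum>a\<in>UNIV. nabla2 t x a a b * h b x n)"
    unfolding tensor1_def by (subst sum.swap) simp
  finally show ?thesis by (simp add: tensor1_def codiff_def sum_distrib_right sum_negf)
qed

lemma d2_tensor2:
  assumes x: "x \<in> U" and skew: "skew (t x)" and t: "\<And>a b m. pdiff (\<lambda>y. t y a b) m x"
  shows "d2 (tensor2 t) x m n p
    = tensor3 (\<lambda>y a b c. nabla2 t y a b c + nabla2 t y b c a + nabla2 t y c a b) x m n p"
proof -
  have anti: "tensor2 t x r s = - tensor2 t x s r" for r s
  proof -
    have "tensor2 t x s r = tensor2 (\<lambda>y a b. t y b a) x r s" by (rule tensor2_transpose)
    also have "\<dots> = tensor2 (\<lambda>y a b. - t y a b) x r s"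
      by (rule tensor2_cong) (rule skewD[OF skew])
    also have "\<dots> = - tensor2 t x r s" by (simp add: tensor2_def sum_negf)
    finally show ?thesis by simp
  qed
  show ?thesis
    unfolding d2_eq_cov2[of x "tensor2 t", OF x anti] cov2_nabla2[OF x t] tensor3_add
    by (simp add: tensor3_cycle[of _ x m n p] tensor3_cycle[of _ x n p m])
qed

lemma del3_tensor3:
  assumes x: "x \<in> U" and t: "\<And>a b c m. pdiff (\<lambda>y. t y a b c) m x"
  shows "del3 M am (tensor3 t) x m n = tensor2 (\<lambda>y b c. - (\<Sum>a\<in>UNIV. nabla3 t y a a b c)) x m n"
proof -
  have "del3 M am (tensor3 t) x m n = - (\<Sum>a\<in>UNIV. tensor2 (\<lambda>z. nabla3 t z a a) x m n)"
    unfolding del3_def cov3_nabla3[OF x t] ginv_tensor2[OF x] ..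
  also have "\<dots> = - (\<Sum>b\<in>UNIV. \<Sum>c\<in>UNIV. \<Sum>a\<in>UNIV. nabla3 t x a a b c * h b x m * h c x n)"
    unfolding tensor2_def by (subst (2) sum_rotate3) simp
  finally show ?thesis by (simp add: tensor2_def sum_distrib_right sum_negf)
qed

lemma d1_cong:
  assumes "x \<in> U" "\<And>y. y \<in> U \<Longrightarrow> v y = v' y"
  shows "d1 v x m n = d1 v' x m n"
proof -
  have "pd l (\<lambda>y. v y k) x = pd l (\<lambda>y. v' y k) x" for l k
    using assms by (intro pd_cong[OF open_U]) simp_all
  then show ?thesis by (simp add: d1_def)
qed

lemma cov1_cong:
  assumes x: "x \<in> U" and v: "\<And>y. y \<in> U \<Longrightarrow> v y = v' y"
  shows "cov1 M am v x m n = cov1 M am v' x m n"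
proof -
  have "pd m (\<lambda>y. v y n) x = pd m (\<lambda>y. v' y n) x"
    using x v by (intro pd_cong[OF open_U]) simp_all
  then show ?thesis by (simp add: cov1_def v[OF x])
qed

lemma cov2_cong:
  assumes x: "x \<in> U" and B: "\<And>y. y \<in> U \<Longrightarrow> B y = B' y"
  shows "cov2 M am B x m r s = cov2 M am B' x m r s"
proof -
  have "pd m (\<lambda>y. B y r s) x = pd m (\<lambda>y. B' y r s) x"
    using x B by (intro pd_cong[OF open_U]) simp_all
  then show ?thesis by (simp add: cov2_def B[OF x])
qed

lemma cov3_cong:
  assumes x: "x \<in> U" and T: "\<And>y. y \<in> U \<Longrightarrow> T y = T' y"
  shows "cov3 M am T x m r s q = cov3 M am T' x m r s q"
proof -
  have "pd m (\<lambda>y. T y r s q) x = pd m (\<lambda>y. T' y r s q) x"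
    using x T by (intro pd_cong[OF open_U]) simp_all
  then show ?thesis by (simp add: cov3_def T[OF x])
qed

lemma del2_cong:
  assumes "x \<in> U" "\<And>y. y \<in> U \<Longrightarrow> B y = B' y"
  shows "del2 M am B x n = del2 M am B' x n"
  using cov2_cong[OF assms] by (simp add: del2_def)

lemma d2_cong:
  assumes "x \<in> U" "\<And>y. y \<in> U \<Longrightarrow> B y = B' y"
  shows "d2 B x m n p = d2 B' x m n p"
proof -
  have "pd l (\<lambda>y. B y r s) x = pd l (\<lambda>y. B' y r s) x" for l r s
    using assms by (intro pd_cong[OF open_U]) simp_all
  then show ?thesis by (simp add: d2_def)
qed

lemma del3_cong:
  assumes "x \<in> U" "\<And>y. y \<in> U \<Longrightarrow> T y = T' y"
  shows "del3 M am T x m n = del3 M am T' x m n"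
  using cov3_cong[OF assms] by (simp add: del3_def)

lemma E_C1: "Ck_on 1 U (\<lambda>x. E a x m)"
  by (rule Ck_on_mono[OF E_C2]) simp

lemma Ck_nabla2:
  assumes "\<And>a b. Ck_on 2 U (\<lambda>y. t y a b)"
  shows "Ck_on 1 U (\<lambda>x. nabla2 t x c a b)"
proof -
  have "Ck_on 1 U (\<lambda>y. t y a b)" "Ck_on 1 U (pd l (\<lambda>y. t y a b))" for a b l
    using Ck_on_mono[OF assms, of 1] Ck_on_pd[OF assms, of 1] by simp_all
  then show ?thesis
    unfolding nabla2_def comps1_def covd2_def so_action_def by (intro Ck_on_intros E_C1 W_C1)
qed

lemma Ck_codiff:
  assumes "\<And>a b. Ck_on 2 U (\<lambda>y. t y a b)"
  shows "Ck_on 1 U (\<lambda>x. codiff t x b)"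
  unfolding codiff_def by (intro Ck_on_intros Ck_nabla2 assms)

lemma nabla1_cong:
  assumes x: "x \<in> U" and v: "\<And>y. y \<in> U \<Longrightarrow> v y = v' y"
  shows "nabla1 v x a b = nabla1 v' x a b"
proof -
  have "pd l (\<lambda>y. v y c) x = pd l (\<lambda>y. v' y c) x" for l c
    using x v by (intro pd_cong[OF open_U]) simp_all
  then show ?thesis by (simp add: nabla1_def comps1_def covd1_def v[OF x])
qed

lemma nabla1_add:
  assumes "\<And>b l. pdiff (\<lambda>y. u y b) l x" "\<And>b l. pdiff (\<lambda>y. v y b) l x"
  shows "nabla1 (\<lambda>y b. u y b + v y b) x a b = nabla1 u x a b + nabla1 v x a b"
  by (simp add: nabla1_def comps1_def covd1_def pd_add[OF assms] sum.distrib distrib_left)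

lemma codiff_add:
  assumes "\<And>a b l. pdiff (\<lambda>y. s y a b) l x" "\<And>a b l. pdiff (\<lambda>y. t y a b) l x"
  shows "codiff (\<lambda>y a b. s y a b + t y a b) x b = codiff s x b + codiff t x b"
  by (simp add: codiff_def nabla2_def comps1_def covd2_def so_action_def pd_add[OF assms]
      sum.distrib distrib_left)

section \<open>Anti-self-dual fields\<close>

lemma asd_nabla2:
  assumes x: "x \<in> U" and asd: "\<And>y. y \<in> U \<Longrightarrow> asd (t y)" and t: "\<And>a b m. pdiff (\<lambda>y. t y a b) m x"
  shows "asd (nabla2 t x c)"
proof -
  have "dual (\<lambda>a b. pd l (\<lambda>y. t y a b) x) a b = pd l (\<lambda>y. dual (t y) a b) x" for l a b
    unfolding dual_def by (simp only: pd_cmult pd_sum pdiff_sum pdiff_mult pdiff_const t)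
  also have "pd l (\<lambda>y. dual (t y) a b) x = pd l (\<lambda>y. - t y a b) x" for l a b
    using asd by (intro pd_cong[OF open_U x]) (simp add: asd_def)
  finally have "asd (\<lambda>a b. pd l (\<lambda>y. t y a b) x)" for l
    by (simp add: asd_def pd_minus t)
  then have "asd (covd2 t x l)" for l
    unfolding covd2_def[abs_def] by (intro asd_add asd_so_action skew_W asd x)
  then show ?thesis
    unfolding nabla2_def[abs_def] comps1_def sum_UNIV_4 by (intro asd_add asd_cmult)
qed

lemma d2_tensor2_asd:
  assumes x: "x \<in> U" and asd: "\<And>y. y \<in> U \<Longrightarrow> asd (t y)" and t: "\<And>a b m. pdiff (\<lambda>y. t y a b) m x"
  shows "d2 (tensor2 t) x m n p
    = tensor3 (\<lambda>y a b c. \<Sum>d\<in>UNIV. levi_civita a b c d * codiff t y d) x m n p"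
  unfolding d2_tensor2[OF x asd_imp_skew[OF asd[OF x]] t] codiff_def
  by (rule tensor3_cong, rule asd_cyclic_sum[OF asd_nabla2[OF x asd t]])

lemma nabla3_levi_civita:
  assumes x: "x \<in> U" and v: "\<And>d l. pdiff (\<lambda>y. v y d) l x"
  shows "nabla3 (\<lambda>y a b c. \<Sum>d\<in>UNIV. levi_civita a b c d * v y d) x e a b c
    = (\<Sum>d\<in>UNIV. levi_civita a b c d * nabla1 v x e d)"
proof -
  have "pd l (\<lambda>y. \<Sum>d\<in>UNIV. levi_civita a b c d * v y d) x
      = (\<Sum>d\<in>UNIV. levi_civita a b c d * pd l (\<lambda>y. v y d) x)" for l
    by (simp add: pd_sum pdiff_mult pdiff_const pd_cmult v)
  then have "covd3 (\<lambda>y a b c. \<Sum>d\<in>UNIV. levi_civita a b c d * v y d) x l a b c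
      = (\<Sum>d\<in>UNIV. levi_civita a b c d * covd1 v x l d)" for l
    using levi_civita_invariant[OF skew_W[OF x], of a l b c "v x"]
    by (simp add: covd3_def covd1_def distrib_left sum.distrib add.assoc)
  then show ?thesis
    unfolding nabla3_def nabla1_def comps1_def sum_distrib_left
    by (subst sum.swap) (simp add: sum_distrib_left ac_simps)
qed

lemma del3_d2_asd:
  assumes x: "x \<in> U" and asd: "\<And>y. y \<in> U \<Longrightarrow> asd (t y)" and t: "\<And>a b. Ck_on 2 U (\<lambda>y. t y a b)"
  shows "del3 M am (d2 (tensor2 t)) x m n = - tensor2 (\<lambda>y. dual (ext_deriv (codiff t) y)) x m n"
proof -
  have diff_t: "pdiff (\<lambda>y. t y a b) l y" if "y \<in> U" for a b l y
    using Ck_on_imp_pdiff[OF t] that by simp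
  have diff_codiff: "pdiff (\<lambda>y. codiff t y d) l x" for d l
    using Ck_on_imp_pdiff[OF Ck_codiff[OF t]] x by simp
  let ?T = "\<lambda>y a b c. \<Sum>d\<in>UNIV. levi_civita a b c d * codiff t y d"
  have "del3 M am (d2 (tensor2 t)) x m n = del3 M am (tensor3 ?T) x m n"
    by (rule del3_cong[OF x]) (intro ext d2_tensor2_asd asd diff_t)
  also have "\<dots> = tensor2 (\<lambda>y b c. - (\<Sum>a\<in>UNIV. nabla3 ?T y a a b c)) x m n"
    by (intro del3_tensor3 x pdiff_intros diff_codiff)
  also have "\<dots> = tensor2 (\<lambda>y b c. - dual (ext_deriv (codiff t) y) b c) x m n"
    by (rule tensor2_cong)
      (simp add: nabla3_levi_civita[OF x diff_codiff] ext_deriv_def[abs_def]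
        dual_antisymmetrization)
  also have "\<dots> = - tensor2 (\<lambda>y. dual (ext_deriv (codiff t) y)) x m n"
    by (simp add: tensor2_def sum_negf)
  finally show ?thesis .
qed

lemma d1_del2_tensor2:
  assumes x: "x \<in> U" and t: "\<And>a b. Ck_on 2 U (\<lambda>y. t y a b)"
  shows "d1 (del2 M am (tensor2 t)) x m n = tensor2 (ext_deriv (codiff t)) x m n"
proof -
  have "d1 (del2 M am (tensor2 t)) x m n = d1 (tensor1 (codiff t)) x m n"
    by (rule d1_cong[OF x]) (intro ext del2_tensor2 Ck_on_imp_pdiff[OF t]; simp)
  also have "\<dots> = tensor2 (ext_deriv (codiff t)) x m n"
    by (intro d1_tensor1 x Ck_on_imp_pdiff[OF Ck_codiff[OF t]]) simp
  finally show ?thesis .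
qed

lemma lapH_tensor2_asd:
  assumes x: "x \<in> U" and asd: "\<And>y. y \<in> U \<Longrightarrow> asd (t y)" and t: "\<And>a b. Ck_on 2 U (\<lambda>y. t y a b)"
  shows "lapH M am (tensor2 t) x m n
    = tensor2 (ext_deriv (codiff t)) x m n - tensor2 (\<lambda>y. dual (ext_deriv (codiff t) y)) x m n"
  by (simp add: lapH_def d1_del2_tensor2[OF x t] del3_d2_asd[OF x asd t])

lemma lapH_cong:
  assumes x: "x \<in> U" and B: "\<And>y. y \<in> U \<Longrightarrow> B y = B' y"
  shows "lapH M am B x m n = lapH M am B' x m n"
  unfolding lapH_def
proof (intro arg_cong2[of _ _ _ _ "(+)"])
  show "d1 (del2 M am B) x m n = d1 (del2 M am B') x m n"
    by (rule d1_cong[OF x]) (intro ext del2_cong B)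
  show "del3 M am (d2 B) x m n = del3 M am (d2 B') x m n"
    by (rule del3_cong[OF x]) (intro ext d2_cong B)
qed

lemma skew_comps2:
  assumes "\<And>m n. B x m n = - B x n m"
  shows "skew (comps2 B x)"
proof -
  have "comps2 B x a b = - comps2 B x b a" for a b
  proof -
    have "comps2 B x a b = (\<Sum>m\<in>UNIV. \<Sum>n\<in>UNIV. - (E b x n * E a x m * B x n m))"
      unfolding comps2_def by (subst assms) (simp add: ac_simps)
    also have "\<dots> = (\<Sum>n\<in>UNIV. \<Sum>m\<in>UNIV. - (E b x n * E a x m * B x n m))" by (rule sum.swap)
    finally show ?thesis by (simp add: comps2_def sum_negf)
  qed
  then show ?thesis unfolding skew_def by blast
qed

end

section \<open>The operator \<open>2d\<^sub>+d\<^sub>+\<^sup>*\<close>\<close>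

text \<open>The factor \<open>\<i>\<close> in the volume form comes from \<open>h 0\<close> being \<open>\<i>\<lambda>\<^sub>+e\<^sup>0\<close>.\<close>
locale oriented_coframe = orthonormal_coframe +
  assumes lamp_nonzero: "x \<in> U \<Longrightarrow> lamp am x \<noteq> 0"
    and vol_frame: "x \<in> U \<Longrightarrow> complex_of_real (vol M am x m n p q) = - \<i> / (lamp am x)^4 *
      (\<Sum>a\<in>UNIV. \<Sum>b\<in>UNIV. \<Sum>c\<in>UNIV. \<Sum>d\<in>UNIV.
        levi_civita a b c d * h a x m * h b x n * h c x p * h d x q)"
begin

lemma h_ginv:
  assumes "x \<in> U"
  shows "(\<Sum>p\<in>UNIV. h c x p * ginv M am x p r) = E c x r"
proof -
  have "(\<Sum>p\<in>UNIV. h c x p * ginv M am x p r) = (\<Sum>a\<in>UNIV. E a x r * (\<Sum>p\<in>UNIV. h c x p * E a x p))"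
    unfolding ginv_frame[OF assms] sum_distrib_left by (subst sum.swap) (simp add: ac_simps)
  then show ?thesis by (simp add: h_E[OF assms])
qed

lemma gKinv_conformal:
  assumes x: "x \<in> U"
  shows "complex_of_real (gKinv M am x m n) = (lamp am x)^2 * ginv M am x m n"
proof -
  have "(\<Sum>s\<in>UNIV. complex_of_real (gKerr M am x m s) * ((lamp am x)^2 * ginv M am x s n))
      = (if m = n then 1 else 0)" for m n
  proof -
    have "(\<Sum>s\<in>UNIV. complex_of_real (gKerr M am x m s) * ((lamp am x)^2 * ginv M am x s n))
        = (\<Sum>s\<in>UNIV. \<Sum>a\<in>UNIV. h a x m * (h a x s * ginv M am x s n))"
    proof (rule sum.cong[OF refl])
      fix s
      have "complex_of_real (gKerr M am x m s) * ((lamp am x)^2 * ginv M am x s n)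
          = gmet M am x m s * ginv M am x s n"
        by (simp add: gmet_def)
      then show "complex_of_real (gKerr M am x m s) * ((lamp am x)^2 * ginv M am x s n)
          = (\<Sum>a\<in>UNIV. h a x m * (h a x s * ginv M am x s n))"
        by (simp add: metric[OF x] sum_distrib_right mult.assoc)
    qed
    also have "\<dots> = (\<Sum>a\<in>UNIV. h a x m * E a x n)"
      by (subst sum.swap) (simp add: sum_distrib_left[symmetric] h_ginv[OF x])
    finally show ?thesis by (simp add: E_h[OF x])
  qed
  then have "(\<chi> m n. complex_of_real ((\<chi> m n. gKerr M am x m n) $ m $ n))
      ** (\<chi> m n. (lamp am x)^2 * ginv M am x m n) = mat 1"
    by (simp add: matrix_matrix_mult_def mat_def vec_eq_iff)
  from matrix_inv_of_real[OF this] show ?thesis by (simp add: gKinv_def)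
qed

lemma tensor2_ginv_ginv:
  assumes x: "x \<in> U"
  shows "(\<Sum>p\<in>UNIV. \<Sum>q\<in>UNIV. tensor2 t x p q * (ginv M am x p r * ginv M am x q s))
    = (\<Sum>c\<in>UNIV. \<Sum>d\<in>UNIV. t x c d * (E c x r * E d x s))"
proof -
  have "(\<Sum>p\<in>UNIV. \<Sum>q\<in>UNIV. tensor2 t x p q * (ginv M am x p r * ginv M am x q s))
     = (\<Sum>p\<in>UNIV. \<Sum>q\<in>UNIV. \<Sum>c\<in>UNIV. \<Sum>d\<in>UNIV.
         t x c d * (h c x p * ginv M am x p r * (h d x q * ginv M am x q s)))"
    by (simp add: tensor2_def sum_distrib_left sum_distrib_right ac_simps)
  also have "\<dots> = (\<Sum>c\<in>UNIV. \<Sum>d\<in>UNIV. \<Sum>p\<in>UNIV. \<Sum>q\<in>UNIV.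
         t x c d * (h c x p * ginv M am x p r * (h d x q * ginv M am x q s)))"
    by (rule sum_rotate4)
  also have "\<dots> = (\<Sum>c\<in>UNIV. \<Sum>d\<in>UNIV. t x c d * ((\<Sum>p\<in>UNIV. h c x p * ginv M am x p r) *
         (\<Sum>q\<in>UNIV. h d x q * ginv M am x q s)))"
    unfolding sum_product unfolding sum_distrib_left ..
  finally show ?thesis by (simp add: h_ginv[OF x])
qed

lemma hstar_frame:
  assumes x: "x \<in> U"
  shows "hstar M am B x m n = - \<i> * tensor2 (\<lambda>y. dual (comps2 B y)) x m n"
proof -
  define t where "t y c d = (\<Sum>a\<in>UNIV. \<Sum>b\<in>UNIV. levi_civita a b c d * h a y m * h b y n)" for y c d
  have "complex_of_real (vol M am x m n p q * gKinv M am x p r * gKinv M am x q s)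
      = - \<i> * (tensor2 t x p q * (ginv M am x p r * ginv M am x q s))" for p q r s
  proof -
    have "(\<Sum>a\<in>UNIV. \<Sum>b\<in>UNIV. \<Sum>c\<in>UNIV. \<Sum>d\<in>UNIV.
          levi_civita a b c d * h a x m * h b x n * h c x p * h d x q)
        = tensor2 t x p q"
      unfolding tensor2_def t_def sum_distrib_right by (rule sum_rotate4)
    then show ?thesis
      using lamp_nonzero[OF x] by (simp add: gKinv_conformal[OF x] vol_frame[OF x]
        power2_eq_square power4_eq_xxxx)
  qed
  then have "hstar M am B x m n = (1/2) * (\<Sum>p\<in>UNIV. \<Sum>q\<in>UNIV. \<Sum>r\<in>UNIV. \<Sum>s\<in>UNIV.
      - \<i> * (tensor2 t x p q * (ginv M am x p r * ginv M am x q s)) * B x r s)"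
    unfolding hstar_def by (simp only:)
  also have "\<dots> = (1/2) * (\<Sum>r\<in>UNIV. \<Sum>s\<in>UNIV. \<Sum>p\<in>UNIV. \<Sum>q\<in>UNIV.
      - \<i> * (tensor2 t x p q * (ginv M am x p r * ginv M am x q s)) * B x r s)"
    by (subst sum_rotate4) (rule refl)
  also have "\<dots> = - \<i> * ((1/2) * (\<Sum>r\<in>UNIV. \<Sum>s\<in>UNIV.
      (\<Sum>p\<in>UNIV. \<Sum>q\<in>UNIV. tensor2 t x p q * (ginv M am x p r * ginv M am x q s)) * B x r s))"
    by (simp add: sum_distrib_left sum_distrib_right ac_simps)
  also have "\<dots> = - \<i> * ((1/2) * (\<Sum>r\<in>UNIV. \<Sum>s\<in>UNIV. \<Sum>c\<in>UNIV. \<Sum>d\<in>UNIV.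
      t x c d * (E c x r * E d x s * B x r s)))"
    unfolding tensor2_ginv_ginv[OF x] by (simp add: sum_distrib_right mult.assoc)
  also have "\<dots> = - \<i> * ((1/2) * (\<Sum>c\<in>UNIV. \<Sum>d\<in>UNIV. t x c d * comps2 B x c d))"
    by (subst sum_rotate4) (simp add: comps2_def sum_distrib_left)
  also have "\<dots> = - \<i> * ((1/2) * (\<Sum>a\<in>UNIV. \<Sum>b\<in>UNIV. \<Sum>c\<in>UNIV. \<Sum>d\<in>UNIV.
      levi_civita a b c d * h a x m * h b x n * comps2 B x c d))"
    unfolding t_def sum_distrib_right by (subst sum_rotate4) (rule refl)
  finally show ?thesis
    by (simp add: tensor2_def dual_def sum_distrib_left sum_distrib_right ac_simps)
qed

lemma Pplus_tensor2:
  assumes x: "x \<in> U"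
  shows "Pplus M am (tensor2 t) x m n = tensor2 (\<lambda>y a b. (t y a b - dual (t y) a b) / 2) x m n"
proof -
  have "comps2 (tensor2 t) x = t x" by (intro ext comps2_tensor2[OF x])
  then have "\<i> * hstar M am (tensor2 t) x m n = tensor2 (\<lambda>y. dual (t y)) x m n"
    unfolding hstar_frame[OF x] tensor2_def by (simp flip: mult.assoc)
  then show ?thesis unfolding Pplus_def
    by (simp add: tensor2_def sum_divide_distrib sum_subtractf left_diff_distrib
      diff_divide_distrib)
qed

lemma Pplus_tensor2_asd:
  assumes "x \<in> U" "asd (t x)"
  shows "Pplus M am (tensor2 t) x m n = tensor2 t x m n"
  unfolding Pplus_tensor2[OF assms(1)]
  by (rule tensor2_cong) (use assms(2) in \<open>simp add: asd_def\<close>)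

lemma Pplus_cong: "B x = B' x \<Longrightarrow> Pplus M am B x = Pplus M am B' x"
  by (intro ext) (simp add: Pplus_def hstar_def)

lemma Oop_eq_Pplus:
  assumes "d1 (del2 M am (Pplus M am B)) x = F x"
  shows "Oop M am B x m n = 2 * Pplus M am F x m n"
proof -
  have "Pplus M am (d1 (del2 M am (Pplus M am B))) x = Pplus M am F x"
    using assms by (rule Pplus_cong)
  then show ?thesis by (simp add: Oop_def dplus_def dplus_star_def)
qed

lemma Oop_cong_Pplus:
  assumes x: "x \<in> U" and B: "\<And>y. y \<in> U \<Longrightarrow> Pplus M am B y = Pplus M am B' y"
  shows "Oop M am B x m n = Oop M am B' x m n"
proof -
  have "del2 M am (Pplus M am B) y = del2 M am (Pplus M am B') y" if "y \<in> U" for y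
    by (intro ext del2_cong[OF that] B)
  then have "d1 (del2 M am (Pplus M am B)) x = d1 (del2 M am (Pplus M am B')) x"
    by (intro ext) (rule d1_cong[OF x], simp)
  then have "Oop M am B x m n = 2 * Pplus M am (d1 (del2 M am (Pplus M am B'))) x m n"
    by (rule Oop_eq_Pplus)
  then show ?thesis by (simp add: Oop_def dplus_def dplus_star_def)
qed

lemma Oop_tensor2_asd:
  assumes x: "x \<in> U" and asd: "\<And>y. y \<in> U \<Longrightarrow> asd (t y)" and t: "\<And>a b. Ck_on 2 U (\<lambda>y. t y a b)"
  shows "Oop M am (tensor2 t) x m n
    = tensor2 (\<lambda>y a b. ext_deriv (codiff t) y a b - dual (ext_deriv (codiff t) y) a b) x m n"
proof -
  have "del2 M am (Pplus M am (tensor2 t)) y = del2 M am (tensor2 t) y" if "y \<in> U" for y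
    by (intro ext del2_cong[OF that] Pplus_tensor2_asd asd)
  then have "d1 (del2 M am (Pplus M am (tensor2 t))) x = d1 (del2 M am (tensor2 t)) x"
    by (intro ext) (rule d1_cong[OF x], simp)
  also have "\<dots> = tensor2 (ext_deriv (codiff t)) x"
    by (intro ext d1_del2_tensor2[OF x t])
  finally have "d1 (del2 M am (Pplus M am (tensor2 t))) x = tensor2 (ext_deriv (codiff t)) x" .
  then have "Oop M am (tensor2 t) x m n = 2 * Pplus M am (tensor2 (ext_deriv (codiff t))) x m n"
    by (rule Oop_eq_Pplus)
  then show ?thesis by (simp add: Pplus_tensor2[OF x] tensor2_def sum_distrib_left)
qed

lemma Oop_tensor2_eq_lapH:
  assumes "x \<in> U" "\<And>y. y \<in> U \<Longrightarrow> asd (t y)" "\<And>a b. Ck_on 2 U (\<lambda>y. t y a b)"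
  shows "Oop M am (tensor2 t) x m n = lapH M am (tensor2 t) x m n"
  by (simp add: Oop_tensor2_asd[OF assms] lapH_tensor2_asd[OF assms] tensor2_def left_diff_distrib
    sum_subtractf)

theorem Oop_eq_lapH:
  assumes x: "x \<in> U" and B: "\<And>r s. Ck_on 2 U (\<lambda>y. B y r s)"
    and anti: "\<And>y r s. y \<in> U \<Longrightarrow> B y r s = - B y s r"
  shows "Oop M am B x m n = lapH M am (Pplus M am B) x m n"
proof -
  define t where "t y a b = (comps2 B y a b - dual (comps2 B y) a b) / 2" for y a b
  have asd: "asd (t y)" if "y \<in> U" for y
    unfolding t_def[abs_def] by (intro asd_projection skew_comps2 anti that)
  have t_C2: "Ck_on 2 U (\<lambda>y. t y a b)" for a b
    unfolding t_def comps2_def dual_def divide_inverse by (intro Ck_on_intros E_C2 B)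
  have Pplus_B: "Pplus M am B y = tensor2 t y" if "y \<in> U" for y
  proof -
    have "B y = tensor2 (comps2 B) y" by (intro ext tensor2_comps2[OF that, symmetric])
    then have "Pplus M am B y = Pplus M am (tensor2 (comps2 B)) y" by (rule Pplus_cong)
    also have "\<dots> = tensor2 t y" unfolding t_def[abs_def] by (intro ext Pplus_tensor2 that)
    finally show ?thesis .
  qed
  have "Oop M am B x m n = Oop M am (tensor2 t) x m n"
  proof (rule Oop_cong_Pplus[OF x])
    show "Pplus M am B y = Pplus M am (tensor2 t) y" if "y \<in> U" for y
      unfolding Pplus_B[OF that] by (intro ext Pplus_tensor2_asd[symmetric] that asd)
  qed
  also have "\<dots> = lapH M am (tensor2 t) x m n" by (intro Oop_tensor2_eq_lapH x asd t_C2)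
  also have "\<dots> = lapH M am (Pplus M am B) x m n" by (rule lapH_cong[OF x]) (rule Pplus_B[symmetric])
  finally show ?thesis .
qed

lemma Oop_add:
  assumes x: "x \<in> U"
    and s: "\<And>y. y \<in> U \<Longrightarrow> asd (s y)" "\<And>a b. Ck_on 2 U (\<lambda>y. s y a b)"
    and t: "\<And>y. y \<in> U \<Longrightarrow> asd (t y)" "\<And>a b. Ck_on 2 U (\<lambda>y. t y a b)"
  shows "Oop M am (tensor2 (\<lambda>y a b. s y a b + t y a b)) x m n
    = Oop M am (tensor2 s) x m n + Oop M am (tensor2 t) x m n"
proof -
  have pdiff: "pdiff (\<lambda>y. s y a b) l y" "pdiff (\<lambda>y. t y a b) l y" if "y \<in> U" for a b l y
    using Ck_on_imp_pdiff[OF s(2)] Ck_on_imp_pdiff[OF t(2)] that by simp_all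
  have "codiff (\<lambda>y a b. s y a b + t y a b) y = (\<lambda>b. codiff s y b + codiff t y b)" if "y \<in> U" for y
    by (intro ext codiff_add pdiff that)
  then have "nabla1 (codiff (\<lambda>y a b. s y a b + t y a b)) x a b
      = nabla1 (\<lambda>y b. codiff s y b + codiff t y b) x a b" for a b
    by (rule nabla1_cong[OF x])
  also have "\<dots> a b = nabla1 (codiff s) x a b + nabla1 (codiff t) x a b" for a b
    by (intro nabla1_add Ck_on_imp_pdiff[OF Ck_codiff[OF s(2)]]
      Ck_on_imp_pdiff[OF Ck_codiff[OF t(2)]] x) simp_all
  finally have "ext_deriv (codiff (\<lambda>y a b. s y a b + t y a b)) x
      = (\<lambda>a b. ext_deriv (codiff s) x a b + ext_deriv (codiff t) x a b)"
    by (intro ext) (simp add: ext_deriv_def)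
  moreover have "asd (\<lambda>a b. s y a b + t y a b)" if "y \<in> U" for y
    by (intro asd_add s t that)
  moreover have "Ck_on 2 U (\<lambda>y. s y a b + t y a b)" for a b
    by (intro Ck_on_intros s t)
  ultimately show ?thesis
    by (simp add: Oop_tensor2_asd[OF x] s t dual_add tensor2_def algebra_simps sum.distrib
      sum_subtractf)
qed

end

section \<open>Curvature\<close>

context orthonormal_coframe begin

definition curvature :: "4 \<Rightarrow> 4 \<Rightarrow> pt \<Rightarrow> 4 \<Rightarrow> 4 \<Rightarrow> complex" where
  "curvature a b x m n = d1 (W a b) x m n + (\<Sum>c\<in>UNIV. wedge (W a c) (W c b) x m n)"

lemma skew_d1_W:
  assumes x: "x \<in> U"
  shows "skew (\<lambda>a b. d1 (W a b) x m n)"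
proof -
  have "pd m (\<lambda>y. W a b y n) x = - pd m (\<lambda>y. W b a y n) x" for a b m n
  proof -
    have "pd m (\<lambda>y. W a b y n) x = pd m (\<lambda>y. - W b a y n) x"
      by (rule pd_cong[OF open_U x]) (rule skewD[OF skew_W])
    then show ?thesis using pd_minus[OF pdiff_W[OF x]] by simp
  qed
  then show ?thesis unfolding skew_def d1_def by (metis minus_diff_minus)
qed

lemma skew_curvature:
  assumes x: "x \<in> U"
  shows "skew (\<lambda>a b. curvature a b x m n)"
proof -
  have wedges: "(\<Sum>c\<in>UNIV. wedge (W a c) (W c b) x m n) = - (\<Sum>c\<in>UNIV. wedge (W b c) (W c a) x m n)"
    for a b
  proof -
    have "wedge (W a c) (W c b) x m n = - wedge (W b c) (W c a) x m n" for c
      using skewD[OF skew_W[OF x], of a c] skewD[OF skew_W[OF x], of c b] by (simp add: wedge_def)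
    then show ?thesis by (simp only: sum_negf)
  qed
  have "curvature a b x m n = - curvature b a x m n" for a b
    using skewD[OF skew_d1_W[OF x], of a b] wedges[of a b] by (simp add: curvature_def)
  then show ?thesis unfolding skew_def by blast
qed

lemma christoffel_C1: "Ck_on 1 U (\<lambda>x. christoffel a x m n)"
  unfolding christoffel_def
  by (intro Ck_on_intros W_C1 Ck_on_pd[OF h_C2] Ck_on_mono[OF h_C2]) simp_all

lemma pdiff_Gam:
  assumes x: "x \<in> U"
  shows "pdiff (\<lambda>y. Gam M am y r n s) m x"
proof -
  have "Ck_on 1 U (\<lambda>y. \<Sum>a\<in>UNIV. E a y r * christoffel a y n s)"
    by (intro Ck_on_intros E_C1 christoffel_C1)
  from Ck_on_cong[OF open_U _ this] have "Ck_on 1 U (\<lambda>y. Gam M am y r n s)"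
    by (simp add: Gam_eq_christoffel)
  from Ck_on_imp_pdiff[OF this _ x] show ?thesis by simp
qed

lemma pd_h:
  assumes "x \<in> U"
  shows "pd n (\<lambda>y. h a y s) x = (\<Sum>r\<in>UNIV. Gam M am x r n s * h a x r)
      - (\<Sum>b\<in>UNIV. W a b x n * h b x s)"
  by (simp add: Gam_h[OF assms] christoffel_def)

lemma Gam_pd_h:
  assumes x: "x \<in> U"
  shows "(\<Sum>r\<in>UNIV. Gam M am x r n s * pd m (\<lambda>y. h a y r) x)
    = (\<Sum>k\<in>UNIV. (\<Sum>r\<in>UNIV. Gam M am x k m r * Gam M am x r n s) * h a x k)
      - (\<Sum>b\<in>UNIV. W a b x m * christoffel b x n s)"
proof -
  have "(\<Sum>r\<in>UNIV. Gam M am x r n s * pd m (\<lambda>y. h a y r) x)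
      = (\<Sum>r\<in>UNIV. Gam M am x r n s * (\<Sum>k\<in>UNIV. Gam M am x k m r * h a x k))
        - (\<Sum>r\<in>UNIV. Gam M am x r n s * tensor1 (\<lambda>y b. W a b y m) x r)"
    unfolding pd_h[OF x] by (simp add: right_diff_distrib sum_subtractf tensor1_def)
  also have "(\<Sum>r\<in>UNIV. Gam M am x r n s * (\<Sum>k\<in>UNIV. Gam M am x k m r * h a x k))
      = (\<Sum>k\<in>UNIV. (\<Sum>r\<in>UNIV. Gam M am x k m r * Gam M am x r n s) * h a x k)"
    unfolding sum_distrib_left sum_distrib_right by (subst sum.swap) (simp add: ac_simps)
  finally show ?thesis unfolding Gam_tensor1[OF x] .
qed

lemma W_pd_h:
  assumes x: "x \<in> U"
  shows "(\<Sum>b\<in>UNIV. W a b x n * pd m (\<lambda>y. h b y s) x)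
    = (\<Sum>b\<in>UNIV. W a b x n * christoffel b x m s)
      - (\<Sum>c\<in>UNIV. (\<Sum>b\<in>UNIV. W a b x n * W b c x m) * h c x s)"
proof -
  have "(\<Sum>b\<in>UNIV. W a b x n * (\<Sum>c\<in>UNIV. W b c x m * h c x s))
      = (\<Sum>c\<in>UNIV. (\<Sum>b\<in>UNIV. W a b x n * W b c x m) * h c x s)"
    unfolding sum_distrib_left sum_distrib_right by (subst sum.swap) (simp add: ac_simps)
  moreover have "pd m (\<lambda>y. h b y s) x = christoffel b x m s - (\<Sum>c\<in>UNIV. W b c x m * h c x s)" for b
    by (simp add: christoffel_def)
  ultimately show ?thesis by (simp add: right_diff_distrib sum_subtractf)
qed

lemma pd_pd_h:
  assumes x: "x \<in> U"
  shows "pd m (pd n (\<lambda>y. h a y s)) x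
    = (\<Sum>k\<in>UNIV. (pd m (\<lambda>y. Gam M am y k n s) x + (\<Sum>r\<in>UNIV. Gam M am x k m r * Gam M am x r n s))
      * h a x k)
      - (\<Sum>b\<in>UNIV. W a b x m * christoffel b x n s + W a b x n * christoffel b x m s)
      - (\<Sum>c\<in>UNIV. (pd m (\<lambda>y. W a c y n) x - (\<Sum>b\<in>UNIV. W a b x n * W b c x m)) * h c x s)"
proof -
  have "pd m (pd n (\<lambda>y. h a y s)) x
      = pd m (\<lambda>y. (\<Sum>r\<in>UNIV. Gam M am y r n s * h a y r) - (\<Sum>b\<in>UNIV. W a b y n * h b y s)) x"
    by (rule pd_cong[OF open_U x]) (rule pd_h)
  also have "\<dots> = (\<Sum>r\<in>UNIV. Gam M am x r n s * pd m (\<lambda>y. h a y r) x)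
      + (\<Sum>r\<in>UNIV. pd m (\<lambda>y. Gam M am y r n s) x * h a x r)
      - ((\<Sum>b\<in>UNIV. W a b x n * pd m (\<lambda>y. h b y s) x) + (\<Sum>b\<in>UNIV. pd m (\<lambda>y. W a b y n) x * h b x s))"
    by (simp add: pd_diff pd_sum pd_mult pdiff_sum pdiff_mult pdiff_Gam pdiff_h pdiff_W x
      sum.distrib)
  finally show ?thesis
    unfolding Gam_pd_h[OF x] W_pd_h[OF x] by (simp add: sum.distrib sum_subtractf algebra_simps)
qed

text \<open>Antisymmetrizing \<open>pd_pd_h\<close> in the two derivatives kills the left-hand side and the mixed terms.\<close>
lemma Riem_curvature:
  assumes x: "x \<in> U"
  shows "(\<Sum>r\<in>UNIV. Riem M am x r s m n * h a x r) = (\<Sum>b\<in>UNIV. curvature a b x m n * h b x s)"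
proof -
  have commute: "pd m (pd n (\<lambda>y. h a y s)) x = pd n (pd m (\<lambda>y. h a y s)) x"
    by (rule pd_commute[OF open_U x h_C2])
  have Riem: "(\<Sum>r\<in>UNIV. Riem M am x r s m n * h a x r)
      = (\<Sum>k\<in>UNIV. (pd m (\<lambda>y. Gam M am y k n s) x + (\<Sum>r\<in>UNIV. Gam M am x k m r * Gam M am x r n s))
        * h a x k)
      - (\<Sum>k\<in>UNIV. (pd n (\<lambda>y. Gam M am y k m s) x + (\<Sum>r\<in>UNIV. Gam M am x k n r * Gam M am x r m s))
        * h a x k)"
    by (simp add: Riem_def sum_subtractf sum.distrib algebra_simps)
  have curv: "(\<Sum>b\<in>UNIV. curvature a b x m n * h b x s)
      = (\<Sum>c\<in>UNIV. (pd m (\<lambda>y. W a c y n) x - (\<Sum>b\<in>UNIV. W a b x n * W b c x m)) * h c x s)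
      - (\<Sum>c\<in>UNIV. (pd n (\<lambda>y. W a c y m) x - (\<Sum>b\<in>UNIV. W a b x m * W b c x n)) * h c x s)"
    by (simp add: curvature_def d1_def wedge_def sum_subtractf sum.distrib algebra_simps)
  have mixed: "(\<Sum>b\<in>UNIV. W a b x n * christoffel b x m s + W a b x m * christoffel b x n s)
      = (\<Sum>b\<in>UNIV. W a b x m * christoffel b x n s + W a b x n * christoffel b x m s)"
    by (simp add: add.commute)
  have cancel: "u - u' = v - v'" if "u - c - v = u' - c - v'" for u u' v v' c :: complex
    using that by (simp add: algebra_simps)
  show ?thesis
    unfolding Riem curv by (rule cancel[OF commute[unfolded pd_pd_h[OF x] mixed]])
qed

lemma Riem_bianchi:
  assumes x: "x \<in> U"
  shows "Riem M am x r s m n + Riem M am x r m n s + Riem M am x r n s m = 0"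
proof -
  have "pd i (\<lambda>y. Gam M am y r j k) x = pd i (\<lambda>y. Gam M am y r k j) x" for i j k
    by (rule pd_cong[OF open_U x]) (rule Gam_sym)
  note pd_Gam_sym = this[of m s n] this[of n s m] this[of s n m]
  note Gam_sym = Gam_sym[OF x, of _ s n] Gam_sym[OF x, of _ s m] Gam_sym[OF x, of _ n m]
  show ?thesis unfolding Riem_def pd_Gam_sym Gam_sym sum_subtractf by simp
qed

definition riemann :: "pt \<Rightarrow> 4 \<Rightarrow> 4 \<Rightarrow> 4 \<Rightarrow> 4 \<Rightarrow> complex" where
  "riemann x c d a b = comps2 (curvature a b) x c d"

lemma skew_riemann_form:
  assumes "x \<in> U"
  shows "skew (\<lambda>c d. riemann x c d a b)"
proof -
  have "curvature a b x m n = - curvature a b x n m" for m n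
    by (simp add: curvature_def d1_def wedge_def sum_subtractf)
  then show ?thesis unfolding riemann_def by (rule skew_comps2)
qed

lemma riemann_bianchi:
  assumes x: "x \<in> U"
  shows "riemann x c d a b + riemann x d b a c + riemann x b c a d = 0"
proof -
  have lower: "tensor3 (\<lambda>y c d b. riemann y c d a b) x m n s
      = (\<Sum>r\<in>UNIV. Riem M am x r s m n * h a x r)" for m n s
  proof -
    have "tensor3 (\<lambda>y c d b. riemann y c d a b) x m n s
        = (\<Sum>b\<in>UNIV. tensor2 (comps2 (curvature a b)) x m n * h b x s)"
      unfolding tensor3_def tensor2_def sum_distrib_right riemann_def by (rule sum_rotate3)
    then show ?thesis by (simp add: tensor2_comps2[OF x] Riem_curvature[OF x])
  qed
  have "tensor3 (\<lambda>y c d b. riemann y c d a b + riemann y d b a c + riemann y b c a d) x m n s = 0"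
    for m n s
  proof -
    let ?R = "\<lambda>y c d b. riemann y c d a b"
    have "tensor3 (\<lambda>y c d b. riemann y c d a b + riemann y d b a c + riemann y b c a d) x m n s
        = tensor3 ?R x m n s + tensor3 ?R x n s m + tensor3 ?R x s m n"
      unfolding tensor3_add tensor3_cycle[of ?R x s m n] tensor3_cycle[of _ x n s m] by simp
    also have "\<dots> = (\<Sum>r\<in>UNIV.
        (Riem M am x r s m n + Riem M am x r m n s + Riem M am x r n s m) * h a x r)"
      unfolding lower by (simp add: distrib_right sum.distrib)
    finally show ?thesis by (simp add: Riem_bianchi[OF x])
  qed
  from tensor3_eq_0D[OF x this] show ?thesis .
qed

lemma Riem_eq_curvature:
  assumes x: "x \<in> U"
  shows "Riem M am x r s m n = (\<Sum>a\<in>UNIV. \<Sum>b\<in>UNIV. E a x r * curvature a b x m n * h b x s)"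
proof -
  have "Riem M am x r s m n = (\<Sum>k\<in>UNIV. Riem M am x k s m n * (\<Sum>a\<in>UNIV. h a x k * E a x r))"
    by (simp add: E_h[OF x])
  also have "\<dots> = (\<Sum>a\<in>UNIV. E a x r * (\<Sum>k\<in>UNIV. Riem M am x k s m n * h a x k))"
    unfolding sum_distrib_left by (subst sum.swap) (simp add: ac_simps)
  finally show ?thesis by (simp add: Riem_curvature[OF x] sum_distrib_left mult.assoc)
qed

lemma scal_eq_riemann:
  assumes x: "x \<in> U"
  shows "scal M am x = (\<Sum>a\<in>UNIV. \<Sum>b\<in>UNIV. riemann x a b a b)"
proof -
  have Ric: "Ric M am x s n = tensor2 (\<lambda>y d b. \<Sum>a\<in>UNIV. riemann y a d a b) x n s" for s n
  proof -
    have "Ric M am x s n = (\<Sum>r\<in>UNIV. \<Sum>a\<in>UNIV. \<Sum>b\<in>UNIV. E a x r * curvature a b x r n * h b x s)"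
      unfolding Ric_def Riem_eq_curvature[OF x] ..
    also have "\<dots> = (\<Sum>a\<in>UNIV. \<Sum>b\<in>UNIV. \<Sum>r\<in>UNIV. E a x r * curvature a b x r n * h b x s)"
      by (rule sum_rotate3[symmetric])
    also have "\<dots> = (\<Sum>a\<in>UNIV. \<Sum>b\<in>UNIV. comps1 (\<lambda>y r. curvature a b y r n) x a * h b x s)"
      by (simp add: comps1_def sum_distrib_right)
    also have "\<dots> = (\<Sum>a\<in>UNIV. \<Sum>b\<in>UNIV. \<Sum>d\<in>UNIV. riemann x a d a b * h d x n * h b x s)"
      unfolding tensor1_comps2[OF x, symmetric]
      by (simp add: tensor1_def riemann_def sum_distrib_right)
    also have "\<dots> = (\<Sum>d\<in>UNIV. \<Sum>b\<in>UNIV. \<Sum>a\<in>UNIV. riemann x a d a b * h d x n * h b x s)"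
      by (subst sum_rotate3, rule sum.cong[OF refl], rule sum.swap)
    finally show ?thesis by (simp add: tensor2_def sum_distrib_right)
  qed
  have "scal M am x = (\<Sum>b\<in>UNIV. \<Sum>a\<in>UNIV. riemann x a b a b)"
    unfolding scal_def Ric by (rule ginv_tensor2[OF x])
  also have "\<dots> = (\<Sum>a\<in>UNIV. \<Sum>b\<in>UNIV. riemann x a b a b)" by (rule sum.swap)
  finally show ?thesis .
qed

end

section \<open>Charged sections of the anti-self-dual bundle\<close>

text \<open>The type of \<open>W\<close> says that \<open>omega1\<close> is parallel.\<close>
locale kaehler_coframe = orthonormal_coframe +
  assumes type_11_W: "x \<in> U \<Longrightarrow> type_11 (\<lambda>a b. W a b x m)"
begin

definition xi :: "pt \<Rightarrow> 4 \<Rightarrow> complex" where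
  "xi x m = W 0 1 x m - W 2 3 x m"

lemma xi_C1: "Ck_on 1 U (\<lambda>x. xi x m)"
  unfolding xi_def by (intro Ck_on_intros W_C1)

lemma pdiff_xi: "x \<in> U \<Longrightarrow> pdiff (\<lambda>y. xi y m) l x"
  using Ck_on_imp_pdiff[OF xi_C1] by simp

lemma W_type_11_eqs: "x \<in> U \<Longrightarrow> W 0 2 x = W 3 1 x" "x \<in> U \<Longrightarrow> W 0 3 x = W 1 2 x"
  using type_11_W unfolding type_11_def by blast+

lemma type_11_curvature:
  assumes x: "x \<in> U"
  shows "type_11 (\<lambda>a b. curvature a b x m n)"
proof -
  note W_simps = skew_components[OF skew_W[OF x]] W_type_11_eqs[OF x]
  have "d1 (W 0 2) x m n = d1 (W 3 1) x m n" "d1 (W 0 3) x m n = d1 (W 1 2) x m n"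
    by (rule d1_cong[OF x], rule W_type_11_eqs, assumption)+
  then show ?thesis
    using skew_curvature[OF x] unfolding type_11_def
    by (simp add: curvature_def wedge_def sum_UNIV_4 W_simps algebra_simps)
qed

lemma d1_xi:
  assumes x: "x \<in> U"
  shows "d1 xi x m n = curvature 0 1 x m n - curvature 2 3 x m n"
proof -
  have "d1 xi x m n = d1 (W 0 1) x m n - d1 (W 2 3) x m n"
    by (simp add: d1_def xi_def pd_diff pdiff_W x)
  then show ?thesis
    by (simp add: curvature_def wedge_def sum_UNIV_4 skew_components[OF skew_W[OF x]]
      W_type_11_eqs[OF x] algebra_simps)
qed

lemma comps2_d1_xi: "x \<in> U \<Longrightarrow> comps2 (d1 xi) x c d = riemann x c d 0 1 - riemann x c d 2 3"
  by (simp add: comps2_def d1_xi riemann_def right_diff_distrib sum_subtractf)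

lemma type_11_riemann:
  assumes "x \<in> U"
  shows "type_11 (riemann x c d)"
proof -
  note type = type_11_curvature[OF assms, unfolded type_11_def]
  have "skew (riemann x c d)"
    unfolding skew_def riemann_def comps2_def
    by (intro allI, subst skewD[OF skew_curvature[OF assms]]) (simp add: sum_negf)
  then show ?thesis
    using type by (simp add: type_11_def riemann_def comps2_def)
qed

lemma type_11_comps2_d1_xi:
  assumes x: "x \<in> U"
  shows "type_11 (comps2 (d1 xi) x)"
  using kaehler_curvature(1)[OF skew_riemann_form[OF x] type_11_riemann[OF x] riemann_bianchi[OF x]]
  by (simp add: comps2_d1_xi[OF x, abs_def])

lemma scal_eq_d1_xi:
  assumes x: "x \<in> U"
  shows "scal M am x = 2 * (comps2 (d1 xi) x 0 1 - comps2 (d1 xi) x 2 3)"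
  using kaehler_curvature(2)[OF skew_riemann_form[OF x] type_11_riemann[OF x] riemann_bianchi[OF x]]
  by (simp add: comps2_d1_xi[OF x] scal_eq_riemann[OF x])

definition charged_deriv :: "complex \<Rightarrow> (pt \<Rightarrow> complex) \<Rightarrow> pt \<Rightarrow> 4 \<Rightarrow> complex" where
  "charged_deriv k \<Psi> x m = pd m \<Psi> x + \<i> * k * xi x m * \<Psi> x"

definition charged_hessian :: "complex \<Rightarrow> (pt \<Rightarrow> complex) \<Rightarrow> pt \<Rightarrow> 4 \<Rightarrow> 4 \<Rightarrow> complex" where
  "charged_hessian k \<Psi> x a b = nabla1 (comps1 (charged_deriv k \<Psi>)) x a b
     + \<i> * k * comps1 xi x a * comps1 (charged_deriv k \<Psi>) x b"

lemma charged_deriv_C1: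
  assumes "Ck_on 2 U \<Psi>"
  shows "Ck_on 1 U (\<lambda>x. charged_deriv k \<Psi> x m)"
  unfolding charged_deriv_def
  by (intro Ck_on_intros xi_C1 Ck_on_pd[OF assms] Ck_on_mono[OF assms]) simp_all

lemma pdiff_comps1_charged_deriv:
  assumes "Ck_on 2 U \<Psi>" "x \<in> U"
  shows "pdiff (\<lambda>y. comps1 (charged_deriv k \<Psi>) y a) l x"
proof -
  have "Ck_on 1 U (\<lambda>y. comps1 (charged_deriv k \<Psi>) y a)"
    unfolding comps1_def by (intro Ck_on_intros E_C1 charged_deriv_C1 assms)
  from Ck_on_imp_pdiff[OF this _ assms(2)] show ?thesis by simp
qed

lemma so_action_W_has_charge:
  assumes "x \<in> U" "has_charge k w"
  shows "so_action (\<lambda>a b. W a b x m) w a b = \<i> * k * xi x m * w a b"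
  using so_action_has_charge[OF type_11_W[OF assms(1)] assms(2)] by (simp add: xi_def)

lemma nabla2_charged:
  assumes x: "x \<in> U" and w: "has_charge k w" and \<Psi>: "\<And>l. pdiff \<Psi> l x"
  shows "nabla2 (\<lambda>y a b. \<Psi> y * w a b) x c a b = comps1 (charged_deriv k \<Psi>) x c * w a b"
proof -
  have "covd2 (\<lambda>y a b. \<Psi> y * w a b) x l a b = charged_deriv k \<Psi> x l * w a b" for l
  proof -
    have "so_action A (\<lambda>a b. \<Psi> x * w a b) a b = \<Psi> x * so_action A w a b" for A
      by (simp add: so_action_def sum_distrib_left algebra_simps)
    moreover have "pd l (\<lambda>y. \<Psi> y * w a b) x = pd l \<Psi> x * w a b"
      using pd_mult[OF \<Psi> pdiff_const] by (simp add: pd_const)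
    ultimately show ?thesis
      by (simp add: covd2_def so_action_W_has_charge[OF x w] charged_deriv_def algebra_simps)
  qed
  then show ?thesis by (simp add: nabla2_def comps1_def sum_distrib_right mult.assoc)
qed

lemma codiff_charged:
  assumes "x \<in> U" "has_charge k w" "\<And>l. pdiff \<Psi> l x"
  shows "codiff (\<lambda>y a b. \<Psi> y * w a b) x b = - contract (comps1 (charged_deriv k \<Psi>) x) w b"
  by (simp add: codiff_def nabla2_charged[OF assms] contract_def)

lemma nabla1_contract:
  assumes x: "x \<in> U" and w: "has_charge k w" and v: "\<And>a l. pdiff (\<lambda>y. v y a) l x"
  shows "nabla1 (\<lambda>y b. - contract (v y) w b) x c b
    = - contract (\<lambda>a. nabla1 v x c a + \<i> * k * comps1 xi x c * v x a) w b"
proof -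
  have "covd1 (\<lambda>y b. - contract (v y) w b) x l b
      = - contract (\<lambda>a. covd1 v x l a + \<i> * k * xi x l * v x a) w b" for l
  proof -
    have "pd l (\<lambda>y. - contract (v y) w b) x = - contract (\<lambda>a. pd l (\<lambda>y. v y a) x) w b"
      unfolding contract_def
      by (simp add: pd_minus pd_sum pd_mult pd_const pdiff_sum pdiff_mult pdiff_const v)
    moreover have "(\<Sum>c\<in>UNIV. W b c x l * contract (v x) w c)
        = contract (\<lambda>a. \<Sum>d\<in>UNIV. W a d x l * v x d) w b
          + contract (v x) (so_action (\<lambda>a b. W a b x l) w) b"
      by (rule so_action_contract[OF skew_W[OF x]])
    ultimately show ?thesis
      by (simp add: covd1_def contract_def so_action_W_has_charge[OF x w] sum_negf sum.distrib
        algebra_simps)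
  qed
  then have "nabla1 (\<lambda>y b. - contract (v y) w b) x c b
      = - (\<Sum>l\<in>UNIV. \<Sum>a\<in>UNIV. E c x l * (covd1 v x l a + \<i> * k * xi x l * v x a) * w a b)"
    by (simp add: nabla1_def comps1_def contract_def sum_negf sum_distrib_left mult.assoc)
  also have "\<dots> = - (\<Sum>a\<in>UNIV. (\<Sum>l\<in>UNIV. E c x l * (covd1 v x l a + \<i> * k * xi x l * v x a)) * w a b)"
    unfolding sum_distrib_right neg_equal_iff_equal by (rule sum.swap)
  moreover have "(\<Sum>l\<in>UNIV. E c x l * (covd1 v x l a + \<i> * k * xi x l * v x a))
      = nabla1 v x c a + \<i> * k * comps1 xi x c * v x a" for a
    by (simp add: nabla1_def comps1_def distrib_left sum.distrib sum_distrib_left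
      sum_distrib_right ac_simps)
  ultimately show ?thesis by (simp only: contract_def)
qed

lemma ext_deriv_codiff_charged:
  assumes x: "x \<in> U" and w: "has_charge k w" and \<Psi>: "Ck_on 2 U \<Psi>"
  shows "ext_deriv (codiff (\<lambda>y a b. \<Psi> y * w a b)) x a b
    = antisym_contract (charged_hessian k \<Psi> x) w a b"
proof -
  let ?v = "comps1 (charged_deriv k \<Psi>)"
  have "nabla1 (codiff (\<lambda>y a b. \<Psi> y * w a b)) x a b = - contract (charged_hessian k \<Psi> x a) w b"
    for a b
  proof -
    have "nabla1 (codiff (\<lambda>y a b. \<Psi> y * w a b)) x a b = nabla1 (\<lambda>y b. - contract (?v y) w b) x a b"
      by (rule nabla1_cong[OF x], intro ext codiff_charged w Ck_on_imp_pdiff[OF \<Psi>]) simp_all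
    also have "\<dots> = - contract (\<lambda>c. nabla1 ?v x a c + \<i> * k * comps1 xi x a * ?v x c) w b"
      by (intro nabla1_contract x w pdiff_comps1_charged_deriv \<Psi>)
    finally show ?thesis by (simp add: charged_hessian_def[abs_def])
  qed
  then show ?thesis by (simp add: ext_deriv_def antisym_contract_def)
qed

lemma d1_charged_deriv:
  assumes x: "x \<in> U" and \<Psi>: "Ck_on 2 U \<Psi>"
  shows "d1 (charged_deriv k \<Psi>) x m n
    = \<i> * k * (wedge (charged_deriv k \<Psi>) xi x m n + \<Psi> x * d1 xi x m n)"
proof -
  have diff: "pdiff \<Psi> l x" "pdiff (pd j \<Psi>) l x" for l j
    using Ck_on_imp_pdiff[OF \<Psi>] Ck_on_imp_pdiff[OF Ck_on_pd[OF \<Psi>, of 1]] x by simp_all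
  have "pd m (\<lambda>y. charged_deriv k \<Psi> y n) x
      = pd m (pd n \<Psi>) x + \<i> * k * (xi x n * pd m \<Psi> x + pd m (\<lambda>y. xi y n) x * \<Psi> x)" for m n
    unfolding charged_deriv_def mult.assoc
    by (simp add: diff pdiff_xi x pd_add pd_mult pd_const pdiff_mult pdiff_const)
  then show ?thesis
    using pd_commute[OF open_U x \<Psi>, of m n]
    by (simp add: d1_def wedge_def charged_deriv_def algebra_simps)
qed

lemma charged_hessian_commutator:
  assumes x: "x \<in> U" and \<Psi>: "Ck_on 2 U \<Psi>"
  shows "charged_hessian k \<Psi> x a b - charged_hessian k \<Psi> x b a = \<i> * k * \<Psi> x * comps2 (d1 xi) x a b"
proof -
  let ?v = "comps1 (charged_deriv k \<Psi>)"
  have "d1 (charged_deriv k \<Psi>) x m n = d1 (tensor1 ?v) x m n" for m n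
    by (rule d1_cong[OF x]) (intro ext tensor1_comps1[symmetric])
  also have "\<dots> m n = tensor2 (ext_deriv ?v) x m n" for m n
    by (intro d1_tensor1 x pdiff_comps1_charged_deriv \<Psi>)
  finally have "comps2 (d1 (charged_deriv k \<Psi>)) x a b = comps2 (tensor2 (ext_deriv ?v)) x a b"
    by (simp add: comps2_def)
  then have "ext_deriv ?v x a b = comps2 (d1 (charged_deriv k \<Psi>)) x a b"
    by (simp add: comps2_tensor2[OF x])
  also have "\<dots> = \<i> * k * (comps2 (wedge (charged_deriv k \<Psi>) xi) x a b + \<Psi> x * comps2 (d1 xi) x a b)"
    by (simp add: comps2_def d1_charged_deriv[OF x \<Psi>] sum_distrib_left sum.distrib distrib_left
      ac_simps)
  finally show ?thesis
    by (simp add: charged_hessian_def ext_deriv_def comps2_wedge algebra_simps)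
qed

text \<open>The trace part of the Hessian gives the charged wave operator, the antisymmetric part, which is
  of type (1,1), the curvature potential.\<close>
lemma asd_part_ext_deriv_codiff_charged:
  assumes x: "x \<in> U" and w: "has_charge k w" and \<Psi>: "Ck_on 2 U \<Psi>"
  defines "t \<equiv> ext_deriv (codiff (\<lambda>y a b. \<Psi> y * w a b)) x"
  shows "t a b - dual t a b
    = (- (\<Sum>c\<in>UNIV. charged_hessian k \<Psi> x c c) + k^2 / 2 * scal M am x * \<Psi> x) * w a b"
proof -
  let ?F = "comps2 (d1 xi) x"
  have t: "t = antisym_contract (charged_hessian k \<Psi> x) w"
    unfolding t_def by (intro ext ext_deriv_codiff_charged x w \<Psi>)
  have "type_11 (\<lambda>a b. \<i> * k * \<Psi> x * ?F a b)"
    using type_11_comps2_d1_xi[OF x] unfolding type_11_def skew_def by (metis mult_minus_right)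
  from so_action_has_charge[OF this w]
  have "so_action (\<lambda>a b. charged_hessian k \<Psi> x a b - charged_hessian k \<Psi> x b a) w a b
      = - (k^2 / 2 * scal M am x * \<Psi> x) * w a b"
    unfolding charged_hessian_commutator[OF x \<Psi>] scal_eq_d1_xi[OF x]
    by (simp add: power2_eq_square algebra_simps)
  moreover have "asd w" using w by (simp add: has_charge_def)
  ultimately show ?thesis
    unfolding t asd_part_antisym_contract[OF \<open>asd w\<close>] by (simp add: algebra_simps)
qed

lemma ginv_charged_deriv:
  assumes x: "x \<in> U" and \<Psi>: "Ck_on 2 U \<Psi>" and v: "\<And>y. y \<in> U \<Longrightarrow> v y = charged_deriv k \<Psi> y"
  shows "(\<Sum>l\<in>UNIV. \<Sum>m\<in>UNIV. ginv M am x l m * (cov1 M am v x m l + \<i> * k * xi x m * v x l))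
    = (\<Sum>a\<in>UNIV. charged_hessian k \<Psi> x a a)"
proof -
  let ?v = "comps1 (charged_deriv k \<Psi>)"
  have v_tensor1: "v y = tensor1 ?v y" if "y \<in> U" for y
    using v[OF that] by (intro ext) (simp add: tensor1_comps1[OF that])
  have "cov1 M am v x m l + \<i> * k * xi x m * v x l = tensor2 (charged_hessian k \<Psi>) x m l" for l m
  proof -
    have "cov1 M am v x m l = cov1 M am (tensor1 ?v) x m l"
      by (rule cov1_cong[OF x v_tensor1])
    also have "\<dots> = tensor2 (nabla1 ?v) x m l"
      by (intro cov1_nabla1 x pdiff_comps1_charged_deriv \<Psi>)
    moreover have "\<i> * k * xi x m * v x l = tensor2 (\<lambda>y a b. \<i> * k * comps1 xi y a * ?v y b) x m l"
    proof -
      have "\<i> * k * xi x m * v x l = \<i> * k * (tensor1 (comps1 xi) x m * tensor1 ?v x l)"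
        by (simp add: tensor1_comps1[OF x] v[OF x])
      then show ?thesis
        unfolding tensor1_def tensor2_def sum_product by (simp add: sum_distrib_left ac_simps)
    qed
    ultimately show ?thesis by (simp add: charged_hessian_def[abs_def] tensor2_add)
  qed
  then show ?thesis by (simp add: ginv_tensor2[OF x])
qed

end

section \<open>The decomposition of the operator\<close>

locale kerr_coframe = oriented_coframe + kaehler_coframe +
  assumes Om_frame: "x \<in> U \<Longrightarrow> Om M am 1 x m n = wedge (h 0) (h 1) x m n - wedge (h 2) (h 3) x m n"
    "x \<in> U \<Longrightarrow> Om M am 2 x m n = wedge (h 0) (h 2) x m n - wedge (h 3) (h 1) x m n"
    "x \<in> U \<Longrightarrow> Om M am 3 x m n = wedge (h 0) (h 3) x m n - wedge (h 1) (h 2) x m n"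
begin

lemma omega_frame:
  assumes "x \<in> U"
  shows "omega M am x m n = tensor2 (\<lambda>y. omega1) x m n"
    "Omp M am x m n = tensor2 (\<lambda>y. omega_plus) x m n"
    "Omm M am x m n = tensor2 (\<lambda>y. omega_minus) x m n"
  unfolding omega_def Omp_def Omm_def Om_frame[OF assms]
  by (simp_all add: tensor2_def sum_UNIV_4 omega_simps wedge_def field_simps)

lemma cov2_has_charge:
  assumes x: "x \<in> U" and w: "has_charge k w"
    and B: "\<And>y m n. y \<in> U \<Longrightarrow> B y m n = tensor2 (\<lambda>y. w) y m n"
  shows "cov2 M am B x m r s = \<i> * k * xi x m * B x r s"
proof -
  have "cov2 M am B x m r s = cov2 M am (tensor2 (\<lambda>y. w)) x m r s"
    by (rule cov2_cong[OF x]) (intro ext B)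
  also have "\<dots> = tensor2 (\<lambda>y. covd2 (\<lambda>y. w) y m) x r s"
    by (intro cov2_tensor2 x pdiff_const)
  also have "\<dots> = tensor2 (\<lambda>y a b. \<i> * k * xi y m * w a b) x r s"
    by (rule tensor2_cong) (simp add: covd2_def pd_const so_action_W_has_charge[OF x w])
  finally show ?thesis by (simp add: tensor2_cmult B[OF x])
qed

lemma aform_eq_xi:
  assumes x: "x \<in> U"
  shows "aform M am x = xi x"
proof -
  have cov_plus: "cov2 M am (Omp M am) x m r s = - \<i> * xi x m * Omp M am x r s" for m r s
    using cov2_has_charge[OF x has_charge_omega(2) omega_frame(2)] by simp
  have cov_minus: "cov2 M am (Omm M am) x m r s = \<i> * xi x m * Omm M am x r s" for m r s
    using cov2_has_charge[OF x has_charge_omega(3) omega_frame(3)] by simp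
  have "comps2 (Omp M am) x 0 2 = omega_plus 0 2"
    using comps2_tensor2[OF x, of "\<lambda>y. omega_plus" 0 2] by (simp add: comps2_def omega_frame[OF x])
  then have "comps2 (Omp M am) x 0 2 \<noteq> 0" by (simp add: omega_simps)
  then obtain r s where nonzero: "Omp M am x r s \<noteq> 0"
    unfolding comps2_def by (metis (no_types, lifting) mult_zero_right sum.neutral)
  show ?thesis
    unfolding aform_def
  proof (rule the_equality)
    fix v assume "\<forall>m r s. cov2 M am (Omp M am) x m r s + \<i> * v m * Omp M am x r s = 0 \<and>
      cov2 M am (Omm M am) x m r s - \<i> * v m * Omm M am x r s = 0"
    then have "\<i> * (v m - xi x m) * Omp M am x r s = 0" for m
      unfolding cov_plus by (simp add: algebra_simps)
    with nonzero show "v = xi x" by (intro ext) simp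
  qed (simp add: cov_plus cov_minus)
qed

lemma boxneg_eq_charged_hessian:
  assumes x: "x \<in> U" and \<Psi>: "Ck_on 2 U \<Psi>"
  shows "boxneg M am \<Psi> x = - (\<Sum>a\<in>UNIV. charged_hessian 0 \<Psi> x a a)"
proof -
  have "d0 \<Psi> y = charged_deriv 0 \<Psi> y" for y
    by (simp add: d0_def[abs_def] charged_deriv_def[abs_def])
  from ginv_charged_deriv[OF x \<Psi> this] show ?thesis by (simp add: boxneg_def)
qed

lemma Ok_eq_charged_hessian:
  assumes x: "x \<in> U" and \<Psi>: "Ck_on 2 U \<Psi>"
  shows "Ok M am k \<Psi> x = - (\<Sum>a\<in>UNIV. charged_hessian (complex_of_real k) \<Psi> x a a)
    + complex_of_real ((1 + 2 * k^2) / 6) * scal M am x * \<Psi> x"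
proof -
  define v where "v y l = pd l \<Psi> y + \<i> * complex_of_real k * aform M am y l * \<Psi> y" for y l
  have "v y = charged_deriv (complex_of_real k) \<Psi> y" if "y \<in> U" for y
    by (simp add: v_def[abs_def] charged_deriv_def[abs_def] aform_eq_xi[OF that])
  from ginv_charged_deriv[OF x \<Psi> this] show ?thesis
    unfolding Ok_def Let_def v_def[symmetric] aform_eq_xi[OF x] by simp
qed

lemma Oop_charged:
  assumes x: "x \<in> U" and w: "has_charge k w" and \<Psi>: "Ck_on 2 U \<Psi>"
  shows "Oop M am (tensor2 (\<lambda>y a b. \<Psi> y * w a b)) x m n
    = (- (\<Sum>c\<in>UNIV. charged_hessian k \<Psi> x c c) + k^2 / 2 * scal M am x * \<Psi> x)
      * tensor2 (\<lambda>y. w) x m n"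
proof -
  have asd: "asd (\<lambda>a b. \<Psi> y * w a b)" for y
    using w by (intro asd_cmult) (simp add: has_charge_def)
  have C2: "Ck_on 2 U (\<lambda>y. \<Psi> y * w a b)" for a b
    by (intro Ck_on_intros \<Psi>)
  show ?thesis
    unfolding Oop_tensor2_asd[OF x asd C2] tensor2_def asd_part_ext_deriv_codiff_charged[OF x w \<Psi>]
    by (simp add: sum_distrib_left mult.assoc)
qed

theorem Oop_decomposition:
  assumes x: "x \<in> U" and C2: "Ck_on 2 U \<Phi>" "Ck_on 2 U \<Phi>m" "Ck_on 2 U \<Phi>p"
  shows "Oop M am
      (\<lambda>y r s. \<Phi> y * omega M am y r s + \<Phi>m y * Omp M am y r s + \<Phi>p y * Omm M am y r s) x m n
    = boxneg M am \<Phi> x * omega M am x m n + Ok M am (-1) \<Phi>m x * Omp M am x m n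
      + Ok M am 1 \<Phi>p x * Omm M am x m n"
    (is "Oop M am ?B x m n = _")
proof -
  let ?t = "\<lambda>y a b. \<Phi> y * omega1 a b" and ?tm = "\<lambda>y a b. \<Phi>m y * omega_plus a b"
    and ?tp = "\<lambda>y a b. \<Phi>p y * omega_minus a b"
  have asd: "asd (?t y)" "asd (?tm y)" "asd (?tp y)" for y
    using has_charge_omega by (simp_all add: has_charge_def asd_cmult)
  have t_C2: "Ck_on 2 U (\<lambda>y. ?t y a b)" "Ck_on 2 U (\<lambda>y. ?tm y a b)" "Ck_on 2 U (\<lambda>y. ?tp y a b)"
    for a b
    by (intro Ck_on_intros C2)+
  have "?B y = tensor2 (\<lambda>y a b. ?t y a b + (?tm y a b + ?tp y a b)) y" if "y \<in> U" for y
    by (intro ext) (simp add: tensor2_add tensor2_cmult omega_frame[OF that] add.assoc)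
  then have "Oop M am ?B x m n
      = Oop M am (tensor2 (\<lambda>y a b. ?t y a b + (?tm y a b + ?tp y a b))) x m n"
    by (intro Oop_cong_Pplus[OF x] Pplus_cong)
  also have "\<dots> = Oop M am (tensor2 ?t) x m n
      + (Oop M am (tensor2 ?tm) x m n + Oop M am (tensor2 ?tp) x m n)"
    by (simp only: Oop_add[OF x] asd t_C2 asd_add Ck_on_add[OF open_U])
  finally show ?thesis
    by (simp add: Oop_charged[OF x has_charge_omega(1) C2(1)]
      Oop_charged[OF x has_charge_omega(2) C2(2)]
        Oop_charged[OF x has_charge_omega(3) C2(3)] boxneg_eq_charged_hessian[OF x C2(1)]
        Ok_eq_charged_hessian[OF x] C2 omega_frame[OF x])
qed

end

section \<open>The Kerr coframe\<close>

lemma kerr_domD: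
  assumes "x \<in> kerr_dom M am"
  shows "Cf M am x > 0" "Df x > 0" "rho am x > 0" "(rho am x)\<^sup>2 = (x$1)\<^sup>2 + am\<^sup>2 * (x$2)\<^sup>2"
proof -
  have q: "-1 < x$2" "x$2 < 1" and C: "Cf M am x > 0" and rho: "rho am x \<noteq> 0"
    using assms by (auto simp: kerr_dom_def)
  show "Cf M am x > 0" by (rule C)
  have "(x$2)^2 < 1" using q by (simp add: abs_square_less_1)
  then show "Df x > 0" by (simp add: Df_def)
  show "rho am x > 0" using rho unfolding rho_def by (simp add: order_less_le)
  show "(rho am x)\<^sup>2 = (x$1)\<^sup>2 + am\<^sup>2 * (x$2)\<^sup>2" by (simp add: rho_def)
qed

lemma open_kerr_dom: "open (kerr_dom M am)"
proof -
  have "kerr_dom M am = {x. 0 < (x$1)^2 - 2*M*(x$1) + am^2} \<inter> {x. -1 < x$2} \<inter> {x. x$2 < 1}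
      \<inter> {x. sqrt ((x$1)^2 + am^2 * (x$2)^2) \<noteq> 0}"
    by (auto simp: kerr_dom_def Cf_def rho_def)
  moreover have "open {x::pt. 0 < (x$1)^2 - 2*M*(x$1) + am^2}"
    by (intro open_Collect_less continuous_intros)
  moreover have "open {x::pt. -1 < x$2}" "open {x::pt. x$2 < 1}"
    by (intro open_Collect_less continuous_intros)+
  moreover have "open {x::pt. sqrt ((x$1)^2 + am^2 * (x$2)^2) \<noteq> 0}"
    by (intro open_Collect_neq continuous_intros)
  ultimately show ?thesis by (simp add: open_Int)
qed

lemma d1_mult:
  assumes "\<And>l. pdiff f l x" "\<And>n l. pdiff (\<lambda>y. th y n) l x"
  shows "d1 (\<lambda>y n. f y * th y n) x m n = wedge (d0 f) th x m n + f x * d1 th x m n"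
  by (simp add: d1_def d0_def wedge_def pd_mult assms algebra_simps)

definition has_log_grad :: "(pt \<Rightarrow> complex) \<Rightarrow> complex \<Rightarrow> complex \<Rightarrow> pt \<Rightarrow> bool" where
  "has_log_grad f u v x \<longleftrightarrow> (\<forall>i. has_pd f ((if i = 1 then u else if i = 2 then v else 0) * f x) i x)"

lemma has_log_gradI:
  assumes "\<And>i. has_pd f (D i) i x" "\<And>i. D i = (if i = 1 then u else if i = 2 then v else 0) * f x"
  shows "has_log_grad f u v x"
  using assms by (simp add: has_log_grad_def)

lemma has_log_grad_cong: "has_log_grad f u v x \<Longrightarrow> u = u' \<Longrightarrow> v = v' \<Longrightarrow> has_log_grad f u' v' x"
  by simp

lemma has_log_grad_mult:
  assumes "has_log_grad f u v x" "has_log_grad g u' v' x"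
  shows "has_log_grad (\<lambda>y. f y * g y) (u + u') (v + v') x"
  by (rule has_log_gradI, rule has_pd_mult)
     (use assms in \<open>auto simp: has_log_grad_def algebra_simps\<close>)

lemma has_log_grad_inverse:
  assumes "has_log_grad f u v x" "f x \<noteq> 0"
  shows "has_log_grad (\<lambda>y. inverse (f y)) (- u) (- v) x"
  by (rule has_log_gradI, rule has_pd_inverse)
     (use assms in \<open>auto simp: has_log_grad_def\<close>)

lemma has_log_grad_divide:
  assumes "has_log_grad f u v x" "has_log_grad g u' v' x" "g x \<noteq> 0"
  shows "has_log_grad (\<lambda>y. f y / g y) (u - u') (v - v') x"
  using has_log_grad_mult[OF assms(1) has_log_grad_inverse[OF assms(2,3)]]
  by (simp add: divide_inverse)

lemma has_log_grad_const: "has_log_grad (\<lambda>y. c) 0 0 x"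
  by (simp add: has_log_grad_def has_pd_const)

lemma has_log_grad_of_real_sqrt:
  assumes "open U" "x \<in> U" "\<And>y. y \<in> U \<Longrightarrow> f y > 0"
    and grad: "has_log_grad (\<lambda>y. complex_of_real (f y)) (2 * u) (2 * v) x"
  shows "has_log_grad (\<lambda>y. complex_of_real (sqrt (f y))) u v x"
proof (rule has_log_gradI, rule has_pd_of_real_sqrt[OF assms(1-3)])
  have "complex_of_real (f x) = complex_of_real (sqrt (f x)) * complex_of_real (sqrt (f x))"
    using assms(3)[OF assms(2)] by (simp flip: of_real_mult)
  moreover have "sqrt (f x) \<noteq> 0" using assms(3)[OF assms(2)] by simp
  ultimately show "(if i = 1 then 2 * u else if i = 2 then 2 * v else 0) * complex_of_real (f x)
        / (2 * complex_of_real (sqrt (f x)))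
      = (if i = 1 then u else if i = 2 then v else 0) * complex_of_real (sqrt (f x))" for i
    by simp
qed (use grad in \<open>auto simp: has_log_grad_def\<close>)

lemma has_log_grad_d0:
  "has_log_grad f u v x \<Longrightarrow> d0 f x m = (if m = 1 then u else if m = 2 then v else 0) * f x"
  unfolding has_log_grad_def d0_def using has_pd_imp_pd by blast

locale kerr_chart =
  fixes M am :: real
begin

abbreviation "U \<equiv> kerr_dom M am"
abbreviation "ca \<equiv> complex_of_real am"
abbreviation "cr \<equiv> (\<lambda>x::pt. complex_of_real (x$1))"
abbreviation "cq \<equiv> (\<lambda>x::pt. complex_of_real (x$2))"
abbreviation "cC \<equiv> (\<lambda>x. complex_of_real (Cf M am x))"
abbreviation "cD \<equiv> (\<lambda>x. complex_of_real (Df x))"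
abbreviation "sqrtC \<equiv> (\<lambda>x. complex_of_real (sqrt (Cf M am x)))"
abbreviation "sqrtD \<equiv> (\<lambda>x. complex_of_real (sqrt (Df x)))"
abbreviation "crho \<equiv> (\<lambda>x. complex_of_real (rho am x))"

lemmas Ck_on_kerr =
  Ck_on_const Ck_on_coord Ck_on_add[OF open_kerr_dom] Ck_on_diff[OF open_kerr_dom]
  Ck_on_minus[OF open_kerr_dom] Ck_on_mult[OF open_kerr_dom] Ck_on_power[OF open_kerr_dom]
  Ck_on_divide[OF open_kerr_dom] Ck_on_inverse[OF open_kerr_dom]

lemma lamp_eq_inverse: "lamp am x = inverse (cr x + \<i> * ca * cq x)"
  by (simp add: lamp_def divide_inverse Complex_eq mult.assoc)

lemma crho_square: "x \<in> U \<Longrightarrow> (crho x)^2 = (cr x)^2 + ca^2 * (cq x)^2"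
  using kerr_domD(4)[of x M am] by (simp flip: of_real_power of_real_mult of_real_add)

lemma crho_square_factor:
  assumes "x \<in> U"
  shows "(cr x + \<i> * ca * cq x) * (cr x - \<i> * ca * cq x) = (crho x)^2"
  unfolding crho_square[OF assms] by (simp add: power2_eq_square algebra_simps)

lemma kerr_nonzero:
  assumes "x \<in> U"
  shows "cC x \<noteq> 0" "cD x \<noteq> 0" "sqrtC x \<noteq> 0" "sqrtD x \<noteq> 0" "crho x \<noteq> 0"
    "cr x + \<i> * ca * cq x \<noteq> 0" "lamp am x \<noteq> 0"
proof -
  show "cr x + \<i> * ca * cq x \<noteq> 0"
    using crho_square_factor[OF assms] kerr_domD(3)[OF assms] by auto
  then show "lamp am x \<noteq> 0" by (simp add: lamp_eq_inverse)
qed (use kerr_domD[OF assms] in auto)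

lemma lamp_eq:
  assumes "x \<in> U"
  shows "lamp am x = (cr x - \<i> * ca * cq x) / (crho x)^2"
  unfolding lamp_eq_inverse
proof (rule inverse_unique)
  show "(cr x + \<i> * ca * cq x) * ((cr x - \<i> * ca * cq x) / (crho x)^2) = 1"
    using crho_square_factor[OF assms] kerr_nonzero(5)[OF assms] by simp
qed

lemma Ck_kerr_functions:
  "Ck_on k U cC" "Ck_on k U cD" "Ck_on k U sqrtC" "Ck_on k U sqrtD" "Ck_on k U crho"
    "Ck_on k U (lamp am)"
proof -
  show C: "Ck_on k U cC" and D: "Ck_on k U cD"
    unfolding Cf_def Df_def of_real_add of_real_diff of_real_mult of_real_power
    by (intro Ck_on_kerr)+
  show "Ck_on k U sqrtC" "Ck_on k U sqrtD"
    by (rule Ck_on_of_real_sqrt[OF open_kerr_dom _ C], erule kerr_domD,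
        rule Ck_on_of_real_sqrt[OF open_kerr_dom _ D], erule kerr_domD)
  have "Ck_on k U (\<lambda>x. complex_of_real ((x$1)^2 + am^2 * (x$2)^2))"
    unfolding of_real_add of_real_mult of_real_power by (intro Ck_on_kerr)
  then show "Ck_on k U crho"
    unfolding rho_def using kerr_domD(3) by (intro Ck_on_of_real_sqrt[OF open_kerr_dom])
      (auto simp: rho_def)
  show "Ck_on k U (lamp am)"
    unfolding lamp_eq_inverse[abs_def] by (intro Ck_on_kerr) (rule kerr_nonzero)
qed

lemma has_log_grad_lamp:
  assumes x: "x \<in> U"
  shows "has_log_grad (lamp am) (- lamp am x) (- \<i> * ca * lamp am x) x"
proof -
  note nonzero = kerr_nonzero(6)[OF x]
  have "has_pd (\<lambda>x. cr x + \<i> * ca * cq x) ((if i = 1 then 1 else 0)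
      + (\<i> * ca * (if i = 2 then 1 else 0) + 0 * cq x)) i x" for i
    by (intro has_pd_add has_pd_mult has_pd_const has_pd_coord)
  then have "has_log_grad (\<lambda>x. cr x + \<i> * ca * cq x) (lamp am x) (\<i> * ca * lamp am x) x"
    by (rule has_log_gradI) (use nonzero in \<open>auto simp: lamp_eq_inverse\<close>)
  from has_log_grad_inverse[OF this nonzero] show ?thesis
    by (simp add: lamp_eq_inverse[abs_def])
qed

lemma has_log_grad_sqrtC:
  assumes x: "x \<in> U"
  shows "has_log_grad sqrtC ((cr x - complex_of_real M) / cC x) 0 x"
proof (rule has_log_grad_of_real_sqrt[OF open_kerr_dom x kerr_domD(1)])
  have "has_pd cC (if i = 1 then 2 * (cr x - complex_of_real M) else 0) i x" for i
    using has_pd_add[OF has_pd_power2[OF has_pd_coord[of 1 i x]]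
        has_pd_add[OF has_pd_mult[OF has_pd_const[of "- 2 * complex_of_real M"]
          has_pd_coord[of 1 i x]]
          has_pd_const[of "ca^2"]]]
    by (auto simp: Cf_def algebra_simps split: if_splits)
  then show "has_log_grad cC (2 * ((cr x - complex_of_real M) / cC x)) (2 * 0) x"
    by (rule has_log_gradI) (use kerr_nonzero[OF x] in auto)
qed

lemma has_log_grad_sqrtD:
  assumes x: "x \<in> U"
  shows "has_log_grad sqrtD 0 (- cq x / cD x) x"
proof (rule has_log_grad_of_real_sqrt[OF open_kerr_dom x kerr_domD(2)])
  have "has_pd cD (if i = 2 then - 2 * cq x else 0) i x" for i
    using has_pd_add[OF has_pd_const[of 1]
        has_pd_mult[OF has_pd_const[of "-1"] has_pd_power2[OF has_pd_coord[of 2 i x]]]]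
    by (auto simp: Df_def algebra_simps split: if_splits)
  then show "has_log_grad cD (2 * 0) (2 * (- cq x / cD x)) x"
    by (rule has_log_gradI) (use kerr_nonzero[OF x] in auto)
qed

lemma has_log_grad_crho:
  assumes x: "x \<in> U"
  shows "has_log_grad crho (cr x / (crho x)^2) (ca^2 * cq x / (crho x)^2) x"
proof -
  have pos: "0 < (y$1)^2 + am^2 * (y$2)^2" if "y \<in> U" for y
    using kerr_domD(3)[OF that] by (simp add: rho_def)
  have "has_pd (\<lambda>x. (cr x)^2 + ca^2 * (cq x)^2) (2 * cr x * (if i = 1 then 1 else 0)
      + (ca^2 * (2 * cq x * (if i = 2 then 1 else 0)) + 0 * (cq x)^2)) i x" for i
    by (intro has_pd_add has_pd_mult has_pd_power2 has_pd_const has_pd_coord)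
  then have "has_log_grad (\<lambda>x. (cr x)^2 + ca^2 * (cq x)^2)
      (2 * (cr x / (crho x)^2)) (2 * (ca^2 * cq x / (crho x)^2)) x"
    by (rule has_log_gradI) (use kerr_nonzero[OF x] in \<open>auto simp: crho_square[OF x, symmetric]\<close>)
  then have "has_log_grad (\<lambda>x. complex_of_real ((x$1)^2 + am^2 * (x$2)^2))
      (2 * (cr x / (crho x)^2)) (2 * (ca^2 * cq x / (crho x)^2)) x"
    by simp
  from has_log_grad_of_real_sqrt[OF open_kerr_dom x pos this] show ?thesis
    by (simp add: rho_def[abs_def])
qed

definition alpha :: "4 \<Rightarrow> pt \<Rightarrow> 4 \<Rightarrow> complex" where
  "alpha a x m = (if a = 0 then (if m = 0 then 1 else if m = 3 then - ca * (1 - (cq x)^2) else 0)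
     else if a = 3 then (if m = 0 then - ca else if m = 3 then (cr x)^2 + ca^2 else 0)
     else if m = a then 1 else 0)"

definition beta :: "4 \<Rightarrow> pt \<Rightarrow> 4 \<Rightarrow> complex" where
  "beta a x m =
    (if a = 0 then (if m = 0 then (cr x)^2 + ca^2 else if m = 3 then ca else 0) / (crho x)^2
     else if a = 3 then (if m = 0 then ca * (1 - (cq x)^2) else if m = 3 then 1 else 0) / (crho x)^2
     else if m = a then 1 else 0)"

definition H :: "4 \<Rightarrow> pt \<Rightarrow> complex" where
  "H a x = (if a = 0 then \<i> * lamp am x * sqrtC x / crho x
     else if a = 1 then lamp am x * crho x / sqrtC x
     else if a = 2 then lamp am x * crho x / sqrtD x
     else lamp am x * sqrtD x / crho x)"

definition h :: "4 \<Rightarrow> pt \<Rightarrow> 4 \<Rightarrow> complex" where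
  "h a x m = H a x * alpha a x m"

definition E :: "4 \<Rightarrow> pt \<Rightarrow> 4 \<Rightarrow> complex" where
  "E a x m = beta a x m / H a x"

lemma H_components:
  "H 0 = (\<lambda>x. \<i> * lamp am x * sqrtC x / crho x)" "H 1 = (\<lambda>x. lamp am x * crho x / sqrtC x)"
  "H 2 = (\<lambda>x. lamp am x * crho x / sqrtD x)" "H 3 = (\<lambda>x. lamp am x * sqrtD x / crho x)"
  by (simp_all add: H_def[abs_def])

lemma H_nonzero: "x \<in> U \<Longrightarrow> H a x \<noteq> 0"
  using kerr_nonzero[of x] by (simp add: H_def)

lemma H_relations:
  assumes "x \<in> U"
  shows "H 0 x * H 1 x = \<i> * (H 2 x * H 3 x)"
  using kerr_nonzero[OF assms] by (simp add: H_def)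

lemma Ck_H: "Ck_on k U (H a)"
proof -
  have "\<forall>a. Ck_on k U (H a)"
    unfolding all_4 H_components
    by (intro conjI Ck_on_kerr Ck_kerr_functions kerr_nonzero; assumption)
  then show ?thesis by blast
qed

lemma Ck_alpha: "Ck_on k U (\<lambda>x. alpha a x m)"
proof -
  have "\<forall>a m. Ck_on k U (\<lambda>x. alpha a x m)"
    unfolding all_4 alpha_def by (simp, intro conjI Ck_on_kerr)
  then show ?thesis by blast
qed

lemma Ck_beta: "Ck_on k U (\<lambda>x. beta a x m)"
proof -
  have "\<forall>a m. Ck_on k U (\<lambda>x. beta a x m)"
    unfolding all_4 beta_def by (auto intro!: Ck_on_kerr Ck_kerr_functions dest: kerr_nonzero)
  then show ?thesis by blast
qed

lemma Ck_h: "Ck_on k U (\<lambda>x. h a x m)"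
  unfolding h_def by (intro Ck_on_kerr Ck_H Ck_alpha)

lemma Ck_E: "Ck_on k U (\<lambda>x. E a x m)"
  unfolding E_def by (intro Ck_on_kerr Ck_H Ck_beta H_nonzero)

lemma alpha_beta:
  assumes x: "x \<in> U"
  shows "(\<Sum>m\<in>UNIV. alpha a x m * beta b x m) = (if a = b then 1 else 0)"
proof -
  have "\<forall>a b. (\<Sum>m\<in>UNIV. alpha a x m * beta b x m) = (if a = b then 1 else 0)"
    unfolding all_4 using kerr_nonzero(5)[OF x]
    by (simp add: sum_UNIV_4 alpha_def beta_def add_divide_distrib[symmetric]
      diff_divide_distrib[symmetric] divide_eq_eq)
      (unfold crho_square[OF x], simp add: power2_eq_square algebra_simps)
  then show ?thesis by blast
qed

lemma h_E:
  assumes x: "x \<in> U"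
  shows "(\<Sum>m\<in>UNIV. h a x m * E b x m) = (if a = b then 1 else 0)"
proof -
  have "(\<Sum>m\<in>UNIV. h a x m * E b x m) = H a x / H b x * (\<Sum>m\<in>UNIV. alpha a x m * beta b x m)"
    by (simp add: h_def E_def sum_distrib_left ac_simps)
  then show ?thesis by (simp add: alpha_beta[OF x] H_nonzero[OF x])
qed

definition nu :: "4 \<Rightarrow> complex" where
  "nu a = (if a = 0 then \<i> else 1)"

lemma h_eq_ec: "h a x m = nu a * lamp am x * ec M am a x m"
proof -
  have "\<forall>a m. h a x m = nu a * lamp am x * ec M am a x m"
    unfolding all_4 by (simp add: h_def H_def alpha_def nu_def ec_def ef_def Let_def)
  then show ?thesis by blast
qed

lemma gmet_eq_h: "gmet M am x m n = (\<Sum>a\<in>UNIV. h a x m * h a x n)"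
  by (simp add: gmet_def gKerr_def sum_UNIV_4 h_eq_ec nu_def ec_def eta_def power2_eq_square
    algebra_simps)

lemma levi_civita_nu: "levi_civita a b c d * (nu a * nu b * nu c * nu d) = \<i> * levi_civita a b c d"
proof -
  have "\<forall>a b c d. levi_civita a b c d * (nu a * nu b * nu c * nu d) = \<i> * levi_civita a b c d"
    unfolding all_4 by (simp add: levi_civita_simps nu_def)
  then show ?thesis by blast
qed

lemma vol_eq_h:
  assumes x: "x \<in> U"
  shows "complex_of_real (vol M am x m n p q) = - \<i> / (lamp am x)^4 *
    (\<Sum>a\<in>UNIV. \<Sum>b\<in>UNIV. \<Sum>c\<in>UNIV. \<Sum>d\<in>UNIV.
      levi_civita a b c d * h a x m * h b x n * h c x p * h d x q)"
proof -
  have "- \<i> / (lamp am x)^4 * (levi_civita a b c d * h a x m * h b x n * h c x p * h d x q)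
      = levi_civita a b c d * ec M am a x m * ec M am b x n * ec M am c x p * ec M am d x q"
    for a b c d
  proof -
    have "- \<i> / (lamp am x)^4 * (levi_civita a b c d * h a x m * h b x n * h c x p * h d x q)
        = - \<i> * (levi_civita a b c d * (nu a * nu b * nu c * nu d))
          * (ec M am a x m * ec M am b x n * ec M am c x p * ec M am d x q)"
      using kerr_nonzero(7)[OF x] by (simp add: h_eq_ec power4_eq_xxxx)
    then show ?thesis by (simp add: levi_civita_nu)
  qed
  then have "- \<i> / (lamp am x)^4 *
      (\<Sum>a\<in>UNIV. \<Sum>b\<in>UNIV. \<Sum>c\<in>UNIV. \<Sum>d\<in>UNIV.
        levi_civita a b c d * h a x m * h b x n * h c x p * h d x q)
    = (\<Sum>a\<in>UNIV. \<Sum>b\<in>UNIV. \<Sum>c\<in>UNIV. \<Sum>d\<in>UNIV.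
        levi_civita a b c d * ec M am a x m * ec M am b x n * ec M am c x p * ec M am d x q)"
    unfolding sum_distrib_left by (simp only:)
  also have "\<dots> = complex_of_real (vol M am x m n p q)"
    by (simp add: vol_def det_levi_civita ec_def)
  finally show ?thesis by simp
qed

definition dphi :: "pt \<Rightarrow> 4 \<Rightarrow> complex" where
  "dphi x m = (if m = 3 then 1 else 0)"

lemma dphi_eq_alpha:
  assumes x: "x \<in> U"
  shows "dphi x m = (ca * alpha 0 x m + alpha 3 x m) / (crho x)^2"
proof -
  have "\<forall>m. (crho x)^2 * dphi x m = ca * alpha 0 x m + alpha 3 x m"
    unfolding all_4 crho_square[OF x]
    by (simp add: dphi_def alpha_def power2_eq_square algebra_simps)
  then have "(crho x)^2 * dphi x m = ca * alpha 0 x m + alpha 3 x m" by blast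
  then show ?thesis using kerr_nonzero(5)[OF x] by (simp add: field_simps)
qed

lemma d1_alpha:
  "d1 (alpha 0) x m n = 2 * ca * cq x * wedge (alpha 2) dphi x m n"
  "d1 (alpha 1) x m n = 0" "d1 (alpha 2) x m n = 0"
  "d1 (alpha 3) x m n = 2 * cr x * wedge (alpha 1) dphi x m n"
proof -
  have "has_pd (\<lambda>y. - (ca * (1 - (cq y)^2))) (if i = 2 then 2 * ca * cq x else 0) i x" for i
    using has_pd_mult[OF has_pd_const[of "- ca"] has_pd_add[OF has_pd_const[of 1]
        has_pd_mult[OF has_pd_const[of "-1"] has_pd_power2[OF has_pd_coord[of 2 i x]]]]]
    by (auto simp: ac_simps split: if_splits)
  then have "pd i (\<lambda>y. alpha 0 y m) x = (if i = 2 \<and> m = 3 then 2 * ca * cq x else 0)" for i m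
    by (cases "m = 3"; cases "m = 0") (simp_all add: alpha_def pd_const has_pd_imp_pd)
  then show "d1 (alpha 0) x m n = 2 * ca * cq x * wedge (alpha 2) dphi x m n"
    by (simp add: d1_def wedge_def alpha_def dphi_def)
  have "has_pd (\<lambda>y. (cr y)^2 + ca^2) (if i = 1 then 2 * cr x else 0) i x" for i
    using has_pd_add[OF has_pd_power2[OF has_pd_coord[of 1 i x]] has_pd_const[of "ca^2"]]
    by (auto split: if_splits)
  then have "pd i (\<lambda>y. alpha 3 y m) x = (if i = 1 \<and> m = 3 then 2 * cr x else 0)" for i m
    by (cases "m = 3"; cases "m = 0") (simp_all add: alpha_def pd_const has_pd_imp_pd)
  then show "d1 (alpha 3) x m n = 2 * cr x * wedge (alpha 1) dphi x m n"
    by (simp add: d1_def wedge_def alpha_def dphi_def)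
qed (simp_all add: d1_def alpha_def pd_const)

text \<open>The logarithmic gradient of \<open>\<lambda>\<^sub>+\<rho>\<close>.\<close>
definition conf_r :: "pt \<Rightarrow> complex" where
  "conf_r x = \<i> * ca * cq x / (crho x)^2"

definition conf_q :: "pt \<Rightarrow> complex" where
  "conf_q x = - \<i> * ca * cr x / (crho x)^2"

definition conn_A :: "pt \<Rightarrow> complex" where
  "conn_A x = (conf_r x - 2 * cr x / (crho x)^2 + (cr x - complex_of_real M) / cC x) / H 1 x"

definition conn_B :: "pt \<Rightarrow> complex" where
  "conn_B x = - (conf_q x - 2 * ca^2 * cq x / (crho x)^2 - cq x / cD x) / H 2 x"

definition conn_P :: "pt \<Rightarrow> complex" where
  "conn_P x = conf_q x / H 2 x"

definition conn_R :: "pt \<Rightarrow> complex" where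
  "conn_R x = conf_r x / H 1 x"

lemma has_log_grad_H:
  assumes x: "x \<in> U"
  shows "has_log_grad (H 0) (conf_r x - 2 * cr x / (crho x)^2 + (cr x - complex_of_real M) / cC x)
      (conf_q x - 2 * ca^2 * cq x / (crho x)^2) x"
    "has_log_grad (H 1) (conf_r x - (cr x - complex_of_real M) / cC x) (conf_q x) x"
    "has_log_grad (H 2) (conf_r x) (conf_q x + cq x / cD x) x"
    "has_log_grad (H 3) (conf_r x - 2 * cr x / (crho x)^2)
        (conf_q x - 2 * ca^2 * cq x / (crho x)^2 - cq x / cD x) x"
proof -
  note grads = has_log_grad_lamp[OF x] has_log_grad_sqrtC[OF x] has_log_grad_sqrtD[OF x]
    has_log_grad_crho[OF x]
  note nz = kerr_nonzero[OF x]
  note mult = has_log_grad_mult and divide = has_log_grad_cong[OF has_log_grad_divide]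
  note eqs = lamp_eq[OF x] conf_r_def conf_q_def diff_divide_distrib power2_eq_square algebra_simps
  show "has_log_grad (H 0) (conf_r x - 2 * cr x / (crho x)^2 + (cr x - complex_of_real M) / cC x)
      (conf_q x - 2 * ca^2 * cq x / (crho x)^2) x"
    unfolding H_components
    by (rule divide[OF mult[OF mult[OF has_log_grad_const grads(1)] grads(2)] grads(4) nz(5)])
      (simp_all add: eqs)
  show "has_log_grad (H 1) (conf_r x - (cr x - complex_of_real M) / cC x) (conf_q x) x"
    unfolding H_components by (rule divide[OF mult[OF grads(1) grads(4)] grads(2) nz(3)])
      (simp_all add: eqs)
  show "has_log_grad (H 2) (conf_r x) (conf_q x + cq x / cD x) x"
    unfolding H_components by (rule divide[OF mult[OF grads(1) grads(4)] grads(3) nz(4)])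
      (simp_all add: eqs)
  show "has_log_grad (H 3) (conf_r x - 2 * cr x / (crho x)^2)
      (conf_q x - 2 * ca^2 * cq x / (crho x)^2 - cq x / cD x) x"
    unfolding H_components by (rule divide[OF mult[OF grads(1) grads(3)] grads(4) nz(5)])
      (simp_all add: eqs)
qed

lemma d1_h_log_grad:
  assumes x: "x \<in> U" and "has_log_grad (H a) u v x"
  shows "d1 (h a) x m n = H a x * (u * wedge (alpha 1) (alpha a) x m n
    + v * wedge (alpha 2) (alpha a) x m n + d1 (alpha a) x m n)"
proof -
  have "pdiff (H a) l x" "pdiff (\<lambda>y. alpha a y n) l x" for l n
    using Ck_on_imp_pdiff[OF Ck_H[of 1] _ x] Ck_on_imp_pdiff[OF Ck_alpha[of 1] _ x] by simp_all
  then have "d1 (h a) x m n = wedge (d0 (H a)) (alpha a) x m n + H a x * d1 (alpha a) x m n"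
    unfolding h_def[abs_def] by (rule d1_mult)
  moreover have "d0 (H a) x m = H a x * (u * alpha 1 x m + v * alpha 2 x m)" for m
    using has_log_grad_d0[OF assms(2)] by (simp add: alpha_def)
  ultimately show ?thesis by (simp add: wedge_def algebra_simps)
qed

lemma wedge_h: "wedge (h a) (h b) x m n = H a x * H b x * wedge (alpha a) (alpha b) x m n"
  by (simp add: wedge_def h_def algebra_simps)

lemma wedge_swap: "wedge u v x m n = - wedge v u x m n"
  by (simp add: wedge_def)

lemma wedge_dphi:
  assumes "x \<in> U"
  shows "wedge th dphi x m n
    = ca * wedge th (alpha 0) x m n / (crho x)^2 + wedge th (alpha 3) x m n / (crho x)^2"
  by (simp add: wedge_def dphi_eq_alpha[OF assms] add_divide_distrib diff_divide_distrib
    algebra_simps)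

lemma conn_H_products:
  assumes x: "x \<in> U"
  shows "conn_A x * H 0 x * H 1 x
      = (conf_r x - 2 * cr x / (crho x)^2 + (cr x - complex_of_real M) / cC x) * H 0 x"
    "conn_B x * H 3 x * H 2 x = - (conf_q x - 2 * ca^2 * cq x / (crho x)^2 - cq x / cD x) * H 3 x"
    "conn_P x * H 0 x * H 2 x = conf_q x * H 0 x" "conn_P x * H 1 x * H 2 x = conf_q x * H 1 x"
    "conn_R x * H 1 x * H 2 x = conf_r x * H 2 x" "conn_R x * H 3 x * H 1 x = conf_r x * H 3 x"
    "conn_R x * H 2 x * H 3 x = ca * cq x / (crho x)^2 * H 0 x"
    "conn_P x * H 0 x * H 1 x = ca * cr x / (crho x)^2 * H 3 x"
proof -
  note nz = H_nonzero[OF x, of 1] H_nonzero[OF x, of 2]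
  have "conn_R x * H 2 x * H 3 x = - \<i> * conf_r x * H 0 x"
    "conn_P x * H 0 x * H 1 x = \<i> * conf_q x * H 3 x"
  proof -
    have "\<i> * (conn_R x * H 2 x * H 3 x) = conn_R x * (H 0 x * H 1 x)"
      by (simp add: H_relations[OF x])
    then have "\<i> * (conn_R x * H 2 x * H 3 x) = conf_r x * H 0 x"
      using nz by (simp add: conn_R_def)
    then have "\<i> * (\<i> * (conn_R x * H 2 x * H 3 x)) = \<i> * (conf_r x * H 0 x)" by simp
    then show "conn_R x * H 2 x * H 3 x = - \<i> * conf_r x * H 0 x"
      by (simp add: minus_equation_iff flip: mult.assoc)
    show "conn_P x * H 0 x * H 1 x = \<i> * conf_q x * H 3 x"
      using nz by (simp add: H_relations[OF x] conn_P_def mult.assoc)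
  qed
  then show "conn_R x * H 2 x * H 3 x = ca * cq x / (crho x)^2 * H 0 x"
    "conn_P x * H 0 x * H 1 x = ca * cr x / (crho x)^2 * H 3 x"
    by (simp_all add: conf_r_def conf_q_def flip: mult.assoc)
qed (use H_nonzero[OF x, of 1] H_nonzero[OF x, of 2] in
  \<open>simp_all add: conn_A_def conn_B_def conn_P_def conn_R_def\<close>)

lemma d1_h:
  assumes x: "x \<in> U"
  shows "d1 (h 0) x m n = - (conn_A x * wedge (h 0) (h 1) x m n)
      - conn_P x * wedge (h 0) (h 2) x m n + 2 * (conn_R x * wedge (h 2) (h 3) x m n)"
    "d1 (h 1) x m n = - (conn_P x * wedge (h 1) (h 2) x m n)"
    "d1 (h 2) x m n = conn_R x * wedge (h 1) (h 2) x m n"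
    "d1 (h 3) x m n = - 2 * (conn_P x * wedge (h 0) (h 1) x m n)
      - conn_R x * wedge (h 3) (h 1) x m n + conn_B x * wedge (h 3) (h 2) x m n"
proof -
  note coeffs = wedge_h mult.assoc[symmetric] conn_H_products[OF x]
  note swap = wedge_swap[of "alpha 1" "alpha 0"] wedge_swap[of "alpha 2" "alpha 0"]
    wedge_swap[of "alpha 2" "alpha 1"]
    wedge_swap[of "alpha 3" "alpha 1"] wedge_swap[of "alpha 3" "alpha 2"]
  show "d1 (h 0) x m n = - (conn_A x * wedge (h 0) (h 1) x m n) - conn_P x * wedge (h 0) (h 2) x m n
      + 2 * (conn_R x * wedge (h 2) (h 3) x m n)"
    unfolding d1_h_log_grad[OF x has_log_grad_H(1)[OF x]] coeffs d1_alpha wedge_dphi[OF x] swap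
    by (simp add: algebra_simps add_divide_distrib diff_divide_distrib power2_eq_square)
  show "d1 (h 1) x m n = - (conn_P x * wedge (h 1) (h 2) x m n)"
    unfolding d1_h_log_grad[OF x has_log_grad_H(2)[OF x]] coeffs d1_alpha swap
    by (simp add: wedge_def algebra_simps)
  show "d1 (h 2) x m n = conn_R x * wedge (h 1) (h 2) x m n"
    unfolding d1_h_log_grad[OF x has_log_grad_H(3)[OF x]] coeffs d1_alpha
    by (simp add: wedge_def algebra_simps)
  show "d1 (h 3) x m n = - 2 * (conn_P x * wedge (h 0) (h 1) x m n)
      - conn_R x * wedge (h 3) (h 1) x m n + conn_B x * wedge (h 3) (h 2) x m n"
    unfolding d1_h_log_grad[OF x has_log_grad_H(4)[OF x]] coeffs d1_alpha wedge_dphi[OF x] swap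
    by (simp add: algebra_simps add_divide_distrib diff_divide_distrib power2_eq_square)
qed

text \<open>The skew solution of the structure equation for the differentials in \<open>d1_h\<close>.\<close>
definition W_upper :: "4 \<Rightarrow> 4 \<Rightarrow> pt \<Rightarrow> 4 \<Rightarrow> complex" where
  "W_upper a b x m =
    (if (a, b) = (0, 1) then conn_A x * h 0 x m + conn_P x * h 3 x m
     else if (a, b) = (2, 3) then conn_B x * h 3 x m - conn_R x * h 0 x m
     else if (a, b) \<in> {(0, 2), (3, 1)} then conn_P x * h 0 x m + conn_R x * h 3 x m
     else if (a, b) \<in> {(0, 3), (1, 2)} then conn_P x * h 1 x m - conn_R x * h 2 x m
     else 0)"

definition W :: "4 \<Rightarrow> 4 \<Rightarrow> pt \<Rightarrow> 4 \<Rightarrow> complex" where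
  "W a b x m = W_upper a b x m - W_upper b a x m"

lemma Ck_W: "Ck_on k U (\<lambda>x. W a b x m)"
proof -
  have "Ck_on k U conn_A" "Ck_on k U conn_B" "Ck_on k U conn_P" "Ck_on k U conn_R"
    unfolding conn_A_def conn_B_def conn_P_def conn_R_def conf_r_def conf_q_def
    by (intro Ck_on_kerr Ck_kerr_functions Ck_H power_not_zero kerr_nonzero H_nonzero; assumption)+
  then have "\<forall>a b. Ck_on k U (\<lambda>x. W_upper a b x m)"
    unfolding all_4 W_upper_def by (auto intro!: Ck_on_kerr Ck_h)
  then show ?thesis unfolding W_def by (intro Ck_on_kerr) auto
qed

lemma type_11_W: "type_11 (\<lambda>a b. W a b x m)"
  by (simp add: type_11_def skew_def W_def W_upper_def)

lemma structure_eq: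
  assumes x: "x \<in> U"
  shows "d1 (h a) x m n + (\<Sum>b\<in>UNIV. wedge (W a b) (h b) x m n) = 0"
proof -
  have "\<forall>a. d1 (h a) x m n + (\<Sum>b\<in>UNIV. wedge (W a b) (h b) x m n) = 0"
    unfolding all_4 d1_h[OF x] by (simp add: sum_UNIV_4 wedge_def W_def W_upper_def algebra_simps)
  then show ?thesis by blast
qed

lemma orthonormal_coframe_h: "orthonormal_coframe M am U h E W"
proof unfold_locales
  show "skew (\<lambda>a b. W a b x m)" for x m
    using type_11_W by (simp add: type_11_def)
qed (rule open_kerr_dom h_E Ck_h Ck_E Ck_W gmet_eq_h structure_eq; assumption?)+

lemma Om_eq_h:
  "Om M am 1 x m n = wedge (h 0) (h 1) x m n - wedge (h 2) (h 3) x m n"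
  "Om M am 2 x m n = wedge (h 0) (h 2) x m n - wedge (h 3) (h 1) x m n"
  "Om M am 3 x m n = wedge (h 0) (h 3) x m n - wedge (h 1) (h 2) x m n"
  by (simp_all add: Om_def Sig_def wedge_def h_eq_ec nu_def power2_eq_square algebra_simps)

lemma kerr_coframe_h: "kerr_coframe M am U h E W"
proof -
  interpret orthonormal_coframe M am U h E W by (rule orthonormal_coframe_h)
  show ?thesis
    by unfold_locales (rule kerr_nonzero vol_eq_h type_11_W Om_eq_h; assumption?)+
qed

end

theorem theoremB:
  fixes M am :: real
  shows
   "(\<forall>B :: pt \<Rightarrow> 4 \<Rightarrow> 4 \<Rightarrow> complex.
       (\<forall>r s. smooth_fn (kerr_dom M am) (\<lambda>y. B y r s)) \<and>
       (\<forall>y\<in>kerr_dom M am. \<forall>r s. B y r s = - B y s r) \<longrightarrow>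
       (\<forall>x\<in>kerr_dom M am. \<forall>m n. Oop M am B x m n = lapH M am (Pplus M am B) x m n))
    \<and>
    (\<forall>Phi Phip Phim :: pt \<Rightarrow> complex.
       smooth_fn (kerr_dom M am) Phi \<and> smooth_fn (kerr_dom M am) Phip \<and> smooth_fn (kerr_dom M am) Phim \<longrightarrow>
       (\<forall>x\<in>kerr_dom M am. \<forall>m n.
          Oop M am (\<lambda>y r s. Phi y * omega M am y r s + Phim y * Omp M am y r s + Phip y * Omm M am y r s) x m n
          = boxneg M am Phi x * omega M am x m n
            + Ok M am (-1) Phim x * Omp M am x m n
            + Ok M am 1 Phip x * Omm M am x m n))"
proof -
  interpret kerr_chart M am .
  interpret kerr_coframe M am U h E W by (rule kerr_coframe_h)
  note C2 = smooth_fn_imp_Ck_on[where k = 2]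
  show ?thesis
  proof (intro conjI allI impI ballI; elim conjE)
    fix B :: "pt \<Rightarrow> 4 \<Rightarrow> 4 \<Rightarrow> complex" and x m n
    assume "\<forall>r s. smooth_fn U (\<lambda>y. B y r s)" "\<forall>y\<in>U. \<forall>r s. B y r s = - B y s r" "x \<in> U"
    then show "Oop M am B x m n = lapH M am (Pplus M am B) x m n"
      by (intro Oop_eq_lapH C2) blast+
  qed (intro Oop_decomposition C2)
qed

end
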